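(* Let $n\ge 1$ and $d\ge 1$ be integers, and put $s_0=\min\{s\in\mathbb{Z}_{\ge 1} : ns-\binom{d-s+n}{n}\ge 0\}$. The generic form of degree $d$ in $n+1$ variables over $\mathbb{C}$ is the sum of $s_0$ codimension one forms of degree $d$ and no fewer. That is, there is a nonempty Zariski open subset $U\subset \mathbb{P}S_d$ such that every $f\in S_d$ with $[f]\in U$ can be written as $f=\hat f_1+\dots+\hat f_{s_0}$ with each $\hat f_i\in S_d$ a codimension one form, and no such $f$ can be written as a sum of fewer than $s_0$ codimension one forms of degree $d$.
   Context: Let $S=\mathbb{C}[X_0,\dots,X_n]$ and $T=\mathbb{C}[\partial_0,\dots,\partial_n]$, with $T$ acting on $S$ by differentiation ($\partial_i$ acts as $\partial/\partial X_i$; the action is written $D\circ f$). $S_d$ and $T_d$ denote the homogeneous pieces of degree $d$. For $f\in S_d$, $f^\perp=\{D\in T: D\circ f=0\}$ is a homogeneous ideal of $T$, with degree $t$ piece $(f^\perp)_t$. A form $g\in S_d$ is called a codimension one form if $(g^\perp)_1\neq 0$, i.e. there is a nonzero $L\in T_1$ with $L\circ g=0$ (equivalently, after a linear change of variables $g$ involves at most $n$ variables). A codimension one decomposition of $f\in S_d$ is a presentation $f=\hat f_1+\dots+\hat f_s$ with all $\hat f_i\in S_d$ codimension one forms. *)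

theory Defs
  imports Complex_Main "HOL-Library.Poly_Mapping"
begin

text \<open>
  Complex polynomials in variables indexed by a type \<open>'v\<close> are finitely supported functions from
  exponents to coefficients, where an exponent is a finitely supported function \<open>'v \<Rightarrow>\<^sub>0 nat\<close>.
  The ring structure on \<open>'v cpoly\<close> is the convolution structure of \<^theory>\<open>HOL-Library.Poly_Mapping\<close>.
\<close>

type_synonym 'v cpoly = "('v \<Rightarrow>\<^sub>0 nat) \<Rightarrow>\<^sub>0 complex"

definition expo_deg :: "('v \<Rightarrow>\<^sub>0 nat) \<Rightarrow> nat"
  where "expo_deg m = (\<Sum>i\<in>Poly_Mapping.keys m. Poly_Mapping.lookup m i)"

definition expos :: "'v set \<Rightarrow> nat \<Rightarrow> ('v \<Rightarrow>\<^sub>0 nat) set"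
  where "expos V d = {m. Poly_Mapping.keys m \<subseteq> V \<and> expo_deg m = d}"

definition polys :: "'v set \<Rightarrow> 'v cpoly set"
  where "polys V = {p. \<forall>m\<in>Poly_Mapping.keys p. Poly_Mapping.keys m \<subseteq> V}"

definition forms :: "'v set \<Rightarrow> nat \<Rightarrow> 'v cpoly set"
  where "forms V d = {p. Poly_Mapping.keys p \<subseteq> expos V d}"

definition const_poly :: "complex \<Rightarrow> 'v cpoly"
  where "const_poly c = Poly_Mapping.single 0 c"

definition eval_poly :: "'v cpoly \<Rightarrow> ('v \<Rightarrow> complex) \<Rightarrow> complex"
  where "eval_poly P x =
    (\<Sum>m\<in>Poly_Mapping.keys P. Poly_Mapping.lookup P m *
      (\<Prod>i\<in>Poly_Mapping.keys m. x i ^ Poly_Mapping.lookup m i))"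

text \<open>
  \<open>S\<close> and \<open>T\<close> are both polynomial rings in \<open>n + 1\<close> variables, indexed by \<open>{0..n}\<close>; as sets they are
  represented by the same polynomials, and in \<open>T\<close> the variable with index \<open>i\<close> stands for \<open>\<partial>\<^sub>i\<close>.
\<close>

abbreviation S_deg :: "nat \<Rightarrow> nat \<Rightarrow> nat cpoly set"
  where "S_deg n d \<equiv> forms {0..n} d"

abbreviation T_ring :: "nat \<Rightarrow> nat cpoly set"
  where "T_ring n \<equiv> polys {0..n}"

abbreviation (input) T_deg :: "nat \<Rightarrow> nat \<Rightarrow> nat cpoly set"
  where "T_deg n t \<equiv> forms {0..n} t"

text \<open>
  The truncated subtraction of exponents below is harmless: if \<open>X\<^sub>i\<close> does not occur in the
  monomial, the coefficient of the corresponding term is \<open>0\<close>.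
\<close>

definition partial :: "nat \<Rightarrow> nat cpoly \<Rightarrow> nat cpoly"
  where "partial i f =
    (\<Sum>m\<in>Poly_Mapping.keys f.
      Poly_Mapping.single (m - Poly_Mapping.single i 1)
        (of_nat (Poly_Mapping.lookup m i) * Poly_Mapping.lookup f m))"

text \<open>
  A monomial of \<open>T\<close> acts by the composition of the powers of the operators \<open>\<partial>\<^sub>i\<close>. These commute, so
  listing the variables in increasing order is only a choice of representation.
\<close>

definition monom_act :: "(nat \<Rightarrow>\<^sub>0 nat) \<Rightarrow> nat cpoly \<Rightarrow> nat cpoly"
  where "monom_act a f =
    fold (\<lambda>i. partial i ^^ Poly_Mapping.lookup a i)
      (sorted_list_of_set (Poly_Mapping.keys a)) f"

definition diff_act :: "nat cpoly \<Rightarrow> nat cpoly \<Rightarrow> nat cpoly"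
  where "diff_act D f =
    (\<Sum>a\<in>Poly_Mapping.keys D. const_poly (Poly_Mapping.lookup D a) * monom_act a f)"

definition perp :: "nat \<Rightarrow> nat cpoly \<Rightarrow> nat cpoly set"
  where "perp n f = {D \<in> T_ring n. diff_act D f = 0}"

definition perp_deg :: "nat \<Rightarrow> nat cpoly \<Rightarrow> nat \<Rightarrow> nat cpoly set"
  where "perp_deg n f t = perp n f \<inter> T_deg n t"

definition codim_one_form :: "nat \<Rightarrow> nat \<Rightarrow> nat cpoly \<Rightarrow> bool"
  where "codim_one_form n d g \<longleftrightarrow> g \<in> S_deg n d \<and> perp_deg n g 1 \<noteq> {0}"

definition codim_one_decomposition ::
    "nat \<Rightarrow> nat \<Rightarrow> nat cpoly \<Rightarrow> nat \<Rightarrow> (nat \<Rightarrow> nat cpoly) \<Rightarrow> bool"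
  where "codim_one_decomposition n d f s g \<longleftrightarrow>
    (\<forall>i\<in>{1..s}. codim_one_form n d (g i)) \<and> f = (\<Sum>i=1..s. g i)"

text \<open>
  The point \<open>[f]\<close> is the line spanned by \<open>f\<close>. For \<open>f = 0\<close> this is \<open>{0}\<close>, which is not a point of
  \<open>proj_forms n d\<close>.
\<close>

definition proj_point :: "nat cpoly \<Rightarrow> nat cpoly set"
  where "proj_point f = {const_poly c * f | c. True}"

definition proj_forms :: "nat \<Rightarrow> nat \<Rightarrow> nat cpoly set set"
  where "proj_forms n d = proj_point ` (S_deg n d - {0})"

text \<open>
  The homogeneous coordinates on \<open>\<P>S\<^sub>d\<close> are the coefficients of a form, so they are
  indexed by the exponents of degree \<open>d\<close>. A Zariski closed subset is the common zero locus of a set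
  of homogeneous polynomials, of possibly different degrees, in these coordinates.
\<close>

definition zariski_closed :: "nat \<Rightarrow> nat \<Rightarrow> nat cpoly set set \<Rightarrow> bool"
  where "zariski_closed n d Z \<longleftrightarrow>
    (\<exists>\<F> :: (nat \<Rightarrow>\<^sub>0 nat) cpoly set.
      (\<forall>P\<in>\<F>. \<exists>e. P \<in> forms (expos {0..n} d) e) \<and>
      Z = proj_point ` {f \<in> S_deg n d - {0}.
            \<forall>P\<in>\<F>. eval_poly P (Poly_Mapping.lookup f) = 0})"

definition zariski_open :: "nat \<Rightarrow> nat \<Rightarrow> nat cpoly set set \<Rightarrow> bool"
  where "zariski_open n d U \<longleftrightarrow>
    U \<subseteq> proj_forms n d \<and> zariski_closed n d (proj_forms n d - U)"

text \<open>
  The natural number subtraction \<open>d + n - s\<close> agrees with \<open>d - s + n\<close> for \<open>s \<le> d + n\<close>. The value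
  \<open>s = d\<close> already satisfies the inequality when \<open>n, d \<ge> 1\<close>, so larger \<open>s\<close> do not affect the minimum.
\<close>

definition s_zero :: "nat \<Rightarrow> nat \<Rightarrow> nat"
  where "s_zero n d =
    (LEAST s. s \<ge> 1 \<and> int n * int s - int ((d + n - s) choose n) \<ge> 0)"

end

theory Submission
  imports Defs "HOL-Computational_Algebra.Fundamental_Theorem_Algebra" "HOL-Library.FuncSet"
begin

text \<open>
  A sum of forms \<open>f\<^sub>i\<close> with \<open>L\<^sub>i \<circ> f\<^sub>i = 0\<close> is killed by the product \<open>\<Lambda> = L\<^sub>1 \<cdots> L\<^sub>s\<close>; conversely, for
  pairwise non-proportional \<open>L\<^sub>i\<close> the kernel of \<open>\<Lambda>\<close> on \<open>S\<^sub>d\<close> is the sum of the kernels of the \<open>L\<^sub>i\<close>.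

  Lower bound: in a chart where each \<open>L\<^sub>i\<close> has a coordinate equal to \<open>1\<close>, the pairs \<open>(\<Lambda>, f)\<close> with
  \<open>\<Lambda> \<circ> f = 0\<close> are parametrized by \<open>n s + dim S\<^sub>d - dim S\<^sub>d\<^sub>-\<^sub>s\<close> polynomial parameters. If this is less than
  \<open>dim S\<^sub>d\<close>, a count of monomials gives a polynomial relation among the coefficients of \<open>f\<close>.

  Upper bound: by quantifier elimination the decomposable forms are a constructible set, so either
  they contain a nonempty principal open set or some nonzero polynomial vanishes on them. To exclude
  the latter, take \<open>f\<^sub>i = \<Sum>\<^sub>k \<ell>\<^sub>i\<^sub>k\<^sup>d / d!\<close> with \<open>L\<^sub>i\<close> orthogonal to \<open>\<ell>\<^sub>i\<^sub>1, \<dots>, \<ell>\<^sub>i\<^sub>n\<close>. The decompositions near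
  \<open>\<Sum>\<^sub>i f\<^sub>i\<close> reach every first-order direction, because modulo the kernel of \<open>\<Lambda>\<close> the available directions
  are the span of the \<open>n s \<ge> dim S\<^sub>d\<^sub>-\<^sub>s\<close> powers \<open>\<ell>\<^sub>i\<^sub>k\<^sup>d\<^sup>-\<^sup>s\<close>. All general position statements hold when the \<open>\<ell>\<^sub>i\<^sub>k\<close>
  lie at distinct positive real points of one monomial curve, by Descartes' rule of signs.

  Both sets are stable under scaling, so a suitable homogeneous component of the product of the two
  polynomials defines the open set.
\<close>

section \<open>Polynomial functions\<close>

text \<open>The inequality defining \<open>s_zero\<close> is a dimension count: each linear form has
  n parameters up to scaling, and \<Lambda> maps S_d onto S_(d-s), so the pairs (\<Lambda>, f) have
  at least dim S_d parameters exactly when n s \<ge> dim S_(d-s). Enough parameters do not by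
  themselves make the map to S_d dominant. This is the obstacle in the upper bound, and it calls for
  an explicit base point for all n and d. Points on the curve with coordinates t^(D^j) reduce every
  independence statement needed there to counting positive roots of a real polynomial with few
  terms. The tangent computation rests on D_a (X_0 D_b f) = a_0 D_b f whenever D_a f = 0. Hence,
  modulo the kernel of \<Lambda>, moving L_i contributes a_0 times the other L_j applied to D_b f_i,
  a combination of the powers of degree d - s whose coefficients are prescribed freely through b.
  These tangents are realized by exact curves of decomposable forms, so Taylor expansion of a single
  polynomial replaces an implicit function argument.\<close>

inductive_set polyfun :: "'v set \<Rightarrow> (('v \<Rightarrow> complex) \<Rightarrow> complex) set" for V :: "'v set" where
  const: "(\<lambda>x. c) \<in> polyfun V"
| var: "v \<in> V \<Longrightarrow> (\<lambda>x. x v) \<in> polyfun V"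
| add: "P \<in> polyfun V \<Longrightarrow> Q \<in> polyfun V \<Longrightarrow> (\<lambda>x. P x + Q x) \<in> polyfun V"
| mult: "P \<in> polyfun V \<Longrightarrow> Q \<in> polyfun V \<Longrightarrow> (\<lambda>x. P x * Q x) \<in> polyfun V"

lemma polyfun_uminus: "P \<in> polyfun V \<Longrightarrow> (\<lambda>x. - P x) \<in> polyfun V"
  using polyfun.mult[OF polyfun.const[of "-1"], of P] by simp

lemma polyfun_diff: "P \<in> polyfun V \<Longrightarrow> Q \<in> polyfun V \<Longrightarrow> (\<lambda>x. P x - Q x) \<in> polyfun V"
  using polyfun.add[OF _ polyfun_uminus, of P V Q] by simp

lemma polyfun_sum: "(\<And>i. i \<in> A \<Longrightarrow> P i \<in> polyfun V) \<Longrightarrow> (\<lambda>x. \<Sum>i\<in>A. P i x) \<in> polyfun V"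
  by (induction A rule: infinite_finite_induct) (simp_all add: polyfun.const polyfun.add)

lemma polyfun_prod: "(\<And>i. i \<in> A \<Longrightarrow> P i \<in> polyfun V) \<Longrightarrow> (\<lambda>x. \<Prod>i\<in>A. P i x) \<in> polyfun V"
  by (induction A rule: infinite_finite_induct) (simp_all add: polyfun.const polyfun.mult)

lemma polyfun_power: "P \<in> polyfun V \<Longrightarrow> (\<lambda>x. P x ^ k) \<in> polyfun V"
  by (induction k) (simp_all add: polyfun.const polyfun.mult)

lemmas polyfun_intros = polyfun.intros polyfun_uminus polyfun_diff polyfun_sum polyfun_prod polyfun_power

lemma polyfun_subst:
  assumes "P \<in> polyfun V" "\<And>v. v \<in> V \<Longrightarrow> (\<lambda>x. \<sigma> x v) \<in> polyfun W"
  shows "(\<lambda>x. P (\<sigma> x)) \<in> polyfun W"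
  using assms by (induction) (simp_all add: polyfun.const polyfun.add polyfun.mult)

lemma polyfun_mono: "P \<in> polyfun V \<Longrightarrow> V \<subseteq> W \<Longrightarrow> P \<in> polyfun W"
  by (induction rule: polyfun.induct) (auto intro: polyfun.intros)

lemma polyfun_tendsto:
  assumes "P \<in> polyfun V" "\<And>v. v \<in> V \<Longrightarrow> ((\<lambda>e. u e v) \<longlongrightarrow> z v) F"
  shows "((\<lambda>e. P (u e)) \<longlongrightarrow> P z) F"
  using assms by (induction) (auto intro: tendsto_intros)

text \<open>A polynomial in one variable of degree less than \<open>m\<close> with coefficients depending on parameters.\<close>

definition poly_family :: "nat \<Rightarrow> (('v \<Rightarrow> complex) \<Rightarrow> complex poly) \<Rightarrow> bool" where
  "poly_family m p \<longleftrightarrow> (\<forall>j. (\<lambda>x. coeff (p x) j) \<in> polyfun UNIV) \<and> (\<forall>x j. m \<le> j \<longrightarrow> coeff (p x) j = 0)"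

lemma poly_family_mono: "poly_family m p \<Longrightarrow> m \<le> k \<Longrightarrow> poly_family k p"
  by (auto simp: poly_family_def)

lemma poly_family_add: "poly_family m p \<Longrightarrow> poly_family k q \<Longrightarrow> poly_family (max m k) (\<lambda>x. p x + q x)"
  by (simp add: poly_family_def polyfun_diff polyfun.add polyfun.mult)

lemma poly_family_diff: "poly_family m p \<Longrightarrow> poly_family k q \<Longrightarrow> poly_family (max m k) (\<lambda>x. p x - q x)"
  by (simp add: poly_family_def polyfun_diff polyfun.add polyfun.mult)

lemma poly_family_smult: "poly_family m p \<Longrightarrow> c \<in> polyfun UNIV \<Longrightarrow> poly_family m (\<lambda>x. smult (c x) (p x))"
  by (simp add: poly_family_def polyfun_diff polyfun.add polyfun.mult)

lemma poly_family_monom: "c \<in> polyfun UNIV \<Longrightarrow> poly_family (Suc k) (\<lambda>x. monom (c x) k)"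
proof -
  have "(\<lambda>x. if k = j then c x else 0) \<in> polyfun UNIV" if "c \<in> polyfun UNIV" for j
    using that by (cases "k = j") (auto intro: polyfun_intros)
  then show "c \<in> polyfun UNIV \<Longrightarrow> ?thesis" by (auto simp: poly_family_def)
qed

lemma poly_family_mult: assumes "poly_family m p" "poly_family k q" shows "poly_family (m + k) (\<lambda>x. p x * q x)"
proof -
  have "coeff (p x * q x) j = 0" if "m + k \<le> j" for x j
    unfolding coeff_mult
  proof (rule sum.neutral, safe)
    fix i assume "i \<le> j"
    then have "m \<le> i \<or> k \<le> j - i" using that by linarith
    then show "coeff (p x) i * coeff (q x) (j - i) = 0" using assms by (auto simp: poly_family_def)
  qed
  then show ?thesis using assms by (auto simp: poly_family_def coeff_mult intro!: polyfun_intros)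
qed

lemma poly_family_power: "poly_family m p \<Longrightarrow> \<exists>k. poly_family k (\<lambda>x. p x ^ a)"
proof (induction a)
  case 0
  have "poly_family (Suc 0) (\<lambda>x. monom 1 0)" by (intro poly_family_monom polyfun_intros)
  then show ?case by (auto simp: one_pCons monom_0)
next
  case (Suc a)
  then show ?case using poly_family_mult by fastforce
qed

text \<open>A polynomial in the parameters and \<open>t\<close> is regrouped by powers of
  \<open>t\<close>. The degree bound \<open>m\<close> is uniform in \<open>x\<close>; the
  elimination below recurses on such bounds.\<close>

lemma polyfun_family:
  assumes "P \<in> polyfun UNIV" "\<And>v. \<exists>m p. poly_family m p \<and> (\<forall>x t. \<sigma> x t v = poly (p x) t)"
  shows "\<exists>m p. poly_family m p \<and> (\<forall>x t. P (\<sigma> x t) = poly (p x) t)"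
  using assms(1)
proof induction
  case (const c)
  have "poly_family (Suc 0) (\<lambda>x. monom c 0)" by (intro poly_family_monom polyfun_intros)
  then show ?case by (auto simp: monom_0 intro!: exI[of _ "Suc 0"] exI[of _ "\<lambda>x. [:c:]"])
next
  case (var v)
  then show ?case using assms(2) by blast
next
  case (add P Q)
  then obtain m p k q where "poly_family m p" "\<forall>x t. P (\<sigma> x t) = poly (p x) t" "poly_family k q" "\<forall>x t. Q (\<sigma> x t) = poly (q x) t"
    by blast
  then show ?case using poly_family_add[of m p k q] by (intro exI[of _ "max m k"] exI[of _ "\<lambda>x. p x + q x"]) auto
next
  case (mult P Q)
  then obtain m p k q where "poly_family m p" "\<forall>x t. P (\<sigma> x t) = poly (p x) t" "poly_family k q" "\<forall>x t. Q (\<sigma> x t) = poly (q x) t"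
    by blast
  then show ?case using poly_family_mult[of m p k q] by (intro exI[of _ "m + k"] exI[of _ "\<lambda>x. p x * q x"]) auto
qed

lemma poly_family_linear:
  assumes "c \<in> polyfun UNIV" "b \<in> polyfun UNIV"
  shows "poly_family 2 (\<lambda>x. [:c x, b x:])"
proof -
  have "poly_family (max (Suc 0) (Suc 1)) (\<lambda>x. monom (c x) 0 + monom (b x) 1)"
    by (intro poly_family_add poly_family_monom assms)
  moreover have "monom u 0 + monom v 1 = [:u, v:]" for u v :: complex
    by (simp add: monom_0 monom_Suc)
  ultimately show ?thesis by (simp add: numeral_2_eq_2)
qed

text \<open>Taylor expansion at \<open>y\<close>: coefficient \<open>j\<close> of \<open>p z\<close>
  is the homogeneous part of degree \<open>j\<close> of z \<mapsto> P (y + z).\<close>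

lemma polyfun_line:
  assumes "P \<in> polyfun UNIV"
  shows "\<exists>m p. poly_family m p \<and> (\<forall>z t. P (\<lambda>v. y v + t * z v) = poly (p z) t)"
proof (rule polyfun_family[OF assms])
  fix v show "\<exists>m p. poly_family m p \<and> (\<forall>x t. y v + t * x v = poly (p x) t)"
    by (intro exI[of _ 2] exI[of _ "\<lambda>x. [:y v, x v:]"]) (auto intro!: poly_family_linear polyfun_intros)
qed

lemma polyfun_upd:
  assumes "P \<in> polyfun UNIV"
  shows "\<exists>m p. poly_family m p \<and> (\<forall>x t. P (x(k := t)) = poly (p x) t)"
proof (rule polyfun_family[OF assms])
  fix v show "\<exists>m p. poly_family m p \<and> (\<forall>x t. (x(k := t)) v = poly (p x) t)"
  proof (cases "v = k")
    case True
    then show ?thesis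
      by (intro exI[of _ 2] exI[of _ "\<lambda>x. [:0, 1:]"]) (auto intro!: poly_family_linear polyfun_intros)
  next
    case False
    have "poly_family 2 (\<lambda>x. [:x v, 0:])" by (auto intro!: poly_family_linear polyfun_intros simp del: pCons_0_0)
    then show ?thesis using False
      by (intro exI[of _ 2] exI[of _ "\<lambda>x. [:x v, 0:]"]) auto
  qed
qed

section \<open>Constructible sets and quantifier elimination over the complex numbers\<close>

text \<open>Quantifier-free formulas in negation normal form, so that induction meets no
  complement.\<close>

inductive constructible :: "(('v \<Rightarrow> complex) \<Rightarrow> bool) \<Rightarrow> bool" where
  eq: "P \<in> polyfun UNIV \<Longrightarrow> constructible (\<lambda>x. P x = 0)"
| neq: "P \<in> polyfun UNIV \<Longrightarrow> constructible (\<lambda>x. P x \<noteq> 0)"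
| conj: "constructible A \<Longrightarrow> constructible B \<Longrightarrow> constructible (\<lambda>x. A x \<and> B x)"
| disj: "constructible A \<Longrightarrow> constructible B \<Longrightarrow> constructible (\<lambda>x. A x \<or> B x)"

lemma constructible_const: "constructible (\<lambda>x. b)"
  using constructible.eq[OF polyfun.const[of "0::complex"]] constructible.eq[OF polyfun.const[of "1::complex"]]
  by (cases b) auto

lemma constructible_ball: "finite A \<Longrightarrow> (\<And>i. i \<in> A \<Longrightarrow> constructible (S i)) \<Longrightarrow> constructible (\<lambda>x. \<forall>i\<in>A. S i x)"
  by (induction A rule: finite_induct) (simp_all add: constructible_const constructible.conj constructible.disj)

lemma constructible_bex: "finite A \<Longrightarrow> (\<And>i. i \<in> A \<Longrightarrow> constructible (S i)) \<Longrightarrow> constructible (\<lambda>x. \<exists>i\<in>A. S i x)"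
  by (induction A rule: finite_induct) (simp_all add: constructible_const constructible.conj constructible.disj)

lemma constructible_fam_nonzero:
  assumes "poly_family m p" shows "constructible (\<lambda>x. p x \<noteq> 0)"
proof -
  have "p x \<noteq> 0 \<longleftrightarrow> (\<exists>j\<in>{..<m}. coeff (p x) j \<noteq> 0)" for x
  proof
    assume "p x \<noteq> 0"
    then have "coeff (p x) (degree (p x)) \<noteq> 0" by simp
    moreover from this have "degree (p x) < m" using assms unfolding poly_family_def by (meson not_le)
    ultimately show "\<exists>j\<in>{..<m}. coeff (p x) j \<noteq> 0" by blast
  qed auto
  moreover have "constructible (\<lambda>x. \<exists>j\<in>{..<m}. coeff (p x) j \<noteq> 0)"
    using assms by (intro constructible_bex constructible.neq) (simp_all add: poly_family_def)
  ultimately show ?thesis by simp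
qed

lemma poly_family_drop_lead:
  assumes "poly_family (Suc m) p"
  shows "poly_family m (\<lambda>x. p x - monom (coeff (p x) m) m)"
proof -
  have "poly_family (max (Suc m) (Suc m)) (\<lambda>x. p x - monom (coeff (p x) m) m)"
    using assms by (intro poly_family_diff poly_family_monom) (auto simp: poly_family_def)
  moreover have "coeff (p x - monom (coeff (p x) m) m) j = 0" if "m \<le> j" for x j
    using that assms by (cases "m = j") (auto simp: poly_family_def)
  ultimately show ?thesis unfolding poly_family_def by blast
qed

text \<open>One step of pseudo-division: cross-multiplying by the top coefficients cancels degree
  \<open>a\<close> without dividing, so the coefficients stay polynomial in the parameters.\<close>

lemma poly_family_reduce:
  assumes p: "poly_family (Suc a) p" and q: "poly_family (Suc b) q" and "b \<le> a"
  shows "poly_family a (\<lambda>x. smult (coeff (q x) b) (p x) - monom (coeff (p x) a) (a - b) * q x)"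
proof -
  let ?r = "\<lambda>x. smult (coeff (q x) b) (p x) - monom (coeff (p x) a) (a - b) * q x"
  have "poly_family (max (Suc a) (Suc (a - b) + Suc b)) ?r"
    using assms by (intro poly_family_diff poly_family_mult poly_family_monom poly_family_smult) (auto simp: poly_family_def)
  moreover have "coeff (?r x) j = 0" if "a \<le> j" for x j
    using assms that by (cases "a = j") (auto simp: poly_family_def coeff_monom_mult)
  ultimately show ?thesis unfolding poly_family_def by blast
qed

text \<open>The formal degree \<open>a\<close> drops whether or not the coefficient there vanishes,
  so the true degree of \<open>p x\<close> never has to be distinguished. Each step multiplies
  \<open>p x\<close> by a nonzero number and subtracts a multiple of \<open>q x\<close>, which
  preserves divisibility by \<open>q x\<close>.\<close>

lemma poly_family_rem:
  assumes q: "poly_family (Suc b) q" and p: "poly_family a p"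
  shows "\<exists>r. poly_family b r \<and> (\<forall>x. coeff (q x) b \<noteq> 0 \<longrightarrow> (q x dvd p x \<longleftrightarrow> q x dvd r x))"
  using p
proof (induction a arbitrary: p)
  case 0
  then show ?case using poly_family_mono[of 0 p b] by auto
next
  case (Suc a)
  show ?case
  proof (cases "Suc a \<le> b")
    case True
    then show ?thesis using Suc.prems poly_family_mono by blast
  next
    case False
    let ?r = "\<lambda>x. smult (coeff (q x) b) (p x) - monom (coeff (p x) a) (a - b) * q x"
    have "poly_family a ?r" using False Suc.prems q by (intro poly_family_reduce) auto
    then obtain r where "poly_family b r" "\<forall>x. coeff (q x) b \<noteq> 0 \<longrightarrow> (q x dvd ?r x \<longleftrightarrow> q x dvd r x)"
      using Suc.IH by blast
    moreover have "q x dvd ?r x \<longleftrightarrow> q x dvd p x" if "coeff (q x) b \<noteq> 0" for x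
      using that by (simp add: dvd_diff_left_iff dvd_smult_iff dvd_diff_right_iff)
    ultimately show ?thesis by blast
  qed
qed

text \<open>With nonzero top coefficient, \<open>p x\<close> has degree exactly
  \<open>Suc b\<close>. All its roots are then roots of \<open>q x\<close> iff \<open>p x\<close>
  divides \<open>q x ^ Suc b\<close>, and this is tested by the vanishing of a remainder of smaller
  degree.\<close>

lemma constructible_single:
  assumes p: "poly_family (Suc (Suc b)) p" and q: "poly_family k q"
  shows "constructible (\<lambda>x. coeff (p x) (Suc b) \<noteq> 0 \<and> (\<exists>t. poly (p x) t = 0 \<and> poly (q x) t \<noteq> 0))"
proof -
  let ?b = "Suc b"
  obtain k' where "poly_family k' (\<lambda>x. q x ^ ?b)" using poly_family_power[OF q] by blast
  then obtain r where r: "poly_family ?b r"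
    "\<forall>x. coeff (p x) ?b \<noteq> 0 \<longrightarrow> (p x dvd q x ^ ?b \<longleftrightarrow> p x dvd r x)"
    using poly_family_rem[OF p] by blast
  have "(coeff (p x) ?b \<noteq> 0 \<and> (\<exists>t. poly (p x) t = 0 \<and> poly (q x) t \<noteq> 0)) \<longleftrightarrow>
      coeff (p x) ?b \<noteq> 0 \<and> r x \<noteq> 0" for x
  proof (cases "coeff (p x) ?b = 0")
    case False
    have d: "degree (p x) = ?b"
    proof (rule antisym)
      show "degree (p x) \<le> ?b" using p by (intro degree_le) (auto simp: poly_family_def)
      show "?b \<le> degree (p x)" using False by (rule le_degree)
    qed
    have p0: "p x \<noteq> 0" using False by auto
    have "(\<exists>t. poly (p x) t = 0 \<and> poly (q x) t \<noteq> 0) \<longleftrightarrow> \<not> p x dvd r x"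
      using nullstellensatz_univariate[of "p x" "q x"] d p0 r(2) False by auto
    also have "p x dvd r x \<longleftrightarrow> r x = 0"
    proof
      assume a: "p x dvd r x"
      show "r x = 0"
      proof (rule ccontr)
        assume "r x \<noteq> 0"
        then have "?b \<le> degree (r x)" using dvd_imp_degree_le[OF a] d by simp
        moreover have "coeff (r x) (degree (r x)) \<noteq> 0" using \<open>r x \<noteq> 0\<close> by simp
        ultimately show False using r(1) unfolding poly_family_def by blast
      qed
    qed auto
    finally show ?thesis using False by simp
  qed simp
  moreover have "constructible (\<lambda>x. coeff (p x) ?b \<noteq> 0 \<and> r x \<noteq> 0)"
    using p r by (intro constructible.conj constructible.neq constructible_fam_nonzero) (auto simp: poly_family_def)
  ultimately show ?thesis by simp
qed

text \<open>Euclid's algorithm with parameters: two equations are replaced by smaller ones after a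
  case split on the top coefficient of the one with the smaller bound, until at most one is left.
  The length enters the measure because removing an equation with bound \<open>0\<close> does not
  change the sum of the bounds.\<close>

lemma constructible_elim:
  assumes "\<forall>(m, p)\<in>set ps. poly_family m p" "poly_family k q"
  shows "constructible (\<lambda>x. \<exists>t. (\<forall>(m, p)\<in>set ps. poly (p x) t = 0) \<and> poly (q x) t \<noteq> 0)"
  using assms(1)
proof (induction "sum_list (map fst ps) + length ps" arbitrary: ps rule: less_induct)
  case less
  let ?C = "\<lambda>ps x. \<exists>t. (\<forall>(m, p)\<in>set ps. poly (p x) t = 0) \<and> poly (q x) t \<noteq> 0"
  have perm: "constructible (?C ps)" if "set qs = set ps" "constructible (?C qs)" for qs
    using that by simp
  have swap: ?case if two: "ps' = (Suc (Suc a), p) # (Suc (Suc b), p2) # rest" "b \<le> a"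
      "set ps' = set ps" "sum_list (map fst ps') + length ps' = sum_list (map fst ps) + length ps"
    for ps' a p b p2 rest
  proof -
    let ?A = "(Suc (Suc a), p) # (Suc b, \<lambda>x. p2 x - monom (coeff (p2 x) (Suc b)) (Suc b)) # rest"
    let ?r = "\<lambda>x. smult (coeff (p2 x) (Suc b)) (p x) - monom (coeff (p x) (Suc a)) (Suc a - Suc b) * p2 x"
    let ?B = "(Suc a, ?r) # (Suc (Suc b), p2) # rest"
    have f: "poly_family (Suc (Suc a)) p" "poly_family (Suc (Suc b)) p2" "\<forall>(m, p)\<in>set rest. poly_family m p"
      using less.prems two(3)[symmetric] by (auto simp: two(1))
    have A: "constructible (?C ?A)"
      by (rule less.hyps) (use f poly_family_drop_lead[OF f(2)] two(4) in \<open>auto simp: two(1)\<close>)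
    have B: "constructible (?C ?B)"
      by (rule less.hyps) (use f poly_family_reduce[OF f(1,2)] two(2,4) in \<open>auto simp: two(1)\<close>)
    have "?C ps' x \<longleftrightarrow> coeff (p2 x) (Suc b) = 0 \<and> ?C ?A x \<or> coeff (p2 x) (Suc b) \<noteq> 0 \<and> ?C ?B x" for x
    proof (cases "coeff (p2 x) (Suc b) = 0")
      case True
      then show ?thesis by (simp add: two(1))
    next
      case False
      then have "poly (p x) t = 0 \<and> poly (p2 x) t = 0 \<longleftrightarrow> poly (?r x) t = 0 \<and> poly (p2 x) t = 0" for t
        by auto
      then have "(\<forall>(m, p)\<in>set ps'. poly (p x) t = 0) \<longleftrightarrow> (\<forall>(m, p)\<in>set ?B. poly (p x) t = 0)" for t
        unfolding two(1) by (simp only: list.set ball_simps case_prod_conv) blast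
      then show ?thesis using False by presburger
    qed
    moreover have "constructible (\<lambda>x. coeff (p2 x) (Suc b) = 0 \<and> ?C ?A x \<or> coeff (p2 x) (Suc b) \<noteq> 0 \<and> ?C ?B x)"
      by (intro constructible.intros A B) (use f in \<open>auto simp: poly_family_def\<close>)
    ultimately show ?thesis using perm[OF two(3)] by presburger
  qed
  \<comment> \<open>Bound \<open>0\<close> forces the zero polynomial, and bound
    \<open>Suc 0\<close> a constant in \<open>t\<close>, whose vanishing is a condition on
    \<open>x\<close> alone.\<close>
  consider "ps = []" | p xs ys where "ps = xs @ (0, p) # ys" | p xs ys where "ps = xs @ (Suc 0, p) # ys"
    | m p where "ps = [(Suc (Suc m), p)]"
    | a p b p2 rest where "ps = (Suc (Suc a), p) # (Suc (Suc b), p2) # rest"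
  proof -
    have nz: "m = 0 \<or> m = Suc 0 \<or> (\<exists>k. m = Suc (Suc k))" for m :: nat by presburger
    show ?thesis
    proof (cases "\<exists>x\<in>set ps. fst x = 0 \<or> fst x = Suc 0")
      case True
      then show ?thesis using that(2,3) by (metis prod.collapse split_list)
    next
      case False
      then have big: "\<exists>k. m = Suc (Suc k)" if "(m, p) \<in> set ps" for m p
        using that nz[of m] by force
      show ?thesis
      proof (cases ps)
        case Nil
        then show ?thesis by (rule that(1))
      next
        case (Cons z zs)
        obtain a p where z: "z = (Suc (Suc a), p)" using big[of "fst z" "snd z"] Cons
          by (metis list.set_intros(1) prod.collapse)
        show ?thesis
        proof (cases zs)
          case Nil
          then show ?thesis using that(4) Cons z by simp
        next
          case (Cons y ys)
          obtain b p2 where "y = (Suc (Suc b), p2)"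
            using big[of "fst y" "snd y"] Cons \<open>ps = z # zs\<close>
            by (metis list.set_intros(1,2) prod.collapse)
          then show ?thesis using that(5) Cons z \<open>ps = z # zs\<close> by simp
        qed
      qed
    qed
  qed
  then show ?case
  proof cases
    case 1
    have "?C ps x \<longleftrightarrow> q x \<noteq> 0" for x
      using 1 poly_all_0_iff_0[of "q x"] by auto
    then show ?thesis using constructible_fam_nonzero[OF assms(2)] by simp
  next
    case (2 p xs ys)
    then have "p x = 0" for x using less.prems by (auto simp: poly_family_def poly_eq_iff)
    then have "?C ps = ?C (xs @ ys)" by (auto simp: 2 fun_eq_iff)
    moreover have "constructible (?C (xs @ ys))"
      by (rule less.hyps) (use less.prems in \<open>auto simp: 2\<close>)
    ultimately show ?thesis by simp
  next
    case (3 p xs ys)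
    then have f: "poly_family (Suc 0) p" using less.prems by auto
    then have "p x = [:coeff (p x) 0:]" for x
      by (auto simp: poly_family_def poly_eq_iff coeff_pCons split: nat.splits)
    then have *: "poly (p x) t = coeff (p x) 0" for x t by (metis poly_const_conv)
    have "?C ps = (\<lambda>x. coeff (p x) 0 = 0 \<and> ?C (xs @ ys) x)" by (auto simp: 3 fun_eq_iff *)
    moreover have "constructible (?C (xs @ ys))"
      by (rule less.hyps) (use less.prems in \<open>auto simp: 3\<close>)
    ultimately show ?thesis using f by (auto intro!: constructible.conj constructible.eq simp: poly_family_def)
  next
    case (4 m p)
    then have f: "poly_family (Suc (Suc m)) p" using less.prems by auto
    let ?A = "[(Suc m, \<lambda>x. p x - monom (coeff (p x) (Suc m)) (Suc m))]"
    have A: "constructible (?C ?A)"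
      by (rule less.hyps) (use 4 poly_family_drop_lead[OF f] in auto)
    have "?C ps x \<longleftrightarrow> coeff (p x) (Suc m) = 0 \<and> ?C ?A x \<or>
       coeff (p x) (Suc m) \<noteq> 0 \<and> (\<exists>t. poly (p x) t = 0 \<and> poly (q x) t \<noteq> 0)" for x
      by (cases "coeff (p x) (Suc m) = 0") (auto simp: 4)
    moreover have "constructible (\<lambda>x. coeff (p x) (Suc m) = 0 \<and> ?C ?A x \<or>
       coeff (p x) (Suc m) \<noteq> 0 \<and> (\<exists>t. poly (p x) t = 0 \<and> poly (q x) t \<noteq> 0))"
      by (intro constructible.disj constructible.conj[OF constructible.eq] A constructible_single[OF f assms(2)])
        (use f in \<open>auto simp: poly_family_def\<close>)
    ultimately show ?thesis by presburger
  next
    case (5 a p b p2 rest)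
    show ?thesis
    proof (cases "b \<le> a")
      case True
      then show ?thesis using swap[OF 5] by blast
    next
      case False
      then show ?thesis by (intro swap[OF refl, of a b p2 p rest]) (auto simp: 5)
    qed
  qed
qed

text \<open>Disjunctive normal form in which the inequations of a conjunct are multiplied into a
  single one, so that the elimination meets only one \<open>q\<close>.\<close>

lemma constructible_dnf:
  assumes "constructible S"
  shows "\<exists>F. finite F \<and> (\<forall>z\<in>F. set (fst z) \<subseteq> polyfun UNIV \<and> snd z \<in> polyfun UNIV) \<and>
    S = (\<lambda>x. \<exists>z\<in>F. (\<forall>p\<in>set (fst z). p x = 0) \<and> snd z x \<noteq> 0)"
  using assms
proof induction
  case (eq P)
  have "(\<lambda>x. 1) \<in> polyfun UNIV" by (rule polyfun.const)
  with eq show ?case by (intro exI[of _ "{([P], \<lambda>x. 1)}"]) simp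
next
  case (neq P)
  then show ?case by (intro exI[of _ "{([], P)}"]) simp
next
  case (conj A B)
  from conj.IH(1) obtain F where
    F: "finite F" "\<forall>z\<in>F. set (fst z) \<subseteq> polyfun UNIV \<and> snd z \<in> polyfun UNIV"
      "A = (\<lambda>x. \<exists>z\<in>F. (\<forall>p\<in>set (fst z). p x = 0) \<and> snd z x \<noteq> 0)" by (elim exE conjE)
  from conj.IH(2) obtain G where
    G: "finite G" "\<forall>z\<in>G. set (fst z) \<subseteq> polyfun UNIV \<and> snd z \<in> polyfun UNIV"
      "B = (\<lambda>x. \<exists>z\<in>G. (\<forall>p\<in>set (fst z). p x = 0) \<and> snd z x \<noteq> 0)" by (elim exE conjE)
  let ?m = "\<lambda>w. (fst (fst w) @ fst (snd w), \<lambda>x. snd (fst w) x * snd (snd w) x)"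
  show ?case
  proof (intro exI[of _ "?m ` (F \<times> G)"] conjI ext ballI)
    fix z assume "z \<in> ?m ` (F \<times> G)"
    then obtain f g where z: "f \<in> F" "g \<in> G" "z = ?m (f, g)" by blast
    show "set (fst z) \<subseteq> polyfun UNIV" using F(2) G(2) z by simp
    show "snd z \<in> polyfun UNIV" using F(2) G(2) z by (simp add: polyfun.mult)
  next
    fix x
    show "(A x \<and> B x) = (\<exists>z\<in>?m ` (F \<times> G). (\<forall>p\<in>set (fst z). p x = 0) \<and> snd z x \<noteq> 0)"
      unfolding F(3) G(3) by (simp add: ball_Un bex_simps(7)) blast
  qed (use F G in simp)
next
  case (disj A B)
  from disj.IH(1) obtain F where
    F: "finite F" "\<forall>z\<in>F. set (fst z) \<subseteq> polyfun UNIV \<and> snd z \<in> polyfun UNIV"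
      "A = (\<lambda>x. \<exists>z\<in>F. (\<forall>p\<in>set (fst z). p x = 0) \<and> snd z x \<noteq> 0)" by (elim exE conjE)
  from disj.IH(2) obtain G where
    G: "finite G" "\<forall>z\<in>G. set (fst z) \<subseteq> polyfun UNIV \<and> snd z \<in> polyfun UNIV"
      "B = (\<lambda>x. \<exists>z\<in>G. (\<forall>p\<in>set (fst z). p x = 0) \<and> snd z x \<noteq> 0)" by (elim exE conjE)
  show ?case
    by (rule exI[of _ "F \<union> G"]) (use F(1,2) G(1,2) in \<open>simp add: F(3) G(3) ball_Un bex_Un\<close>)
qed

text \<open>Chevalley's theorem for the projection along one coordinate: the quantifier passes
  through the disjunction, and each conjunct is a system in one unknown.\<close>

lemma constructible_ex:
  assumes "constructible S"
  shows "constructible (\<lambda>x. \<exists>t. S (x(k := t)))"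
proof -
  obtain F where F: "finite F" "\<forall>z\<in>F. set (fst z) \<subseteq> polyfun UNIV \<and> snd z \<in> polyfun UNIV"
      "S = (\<lambda>x. \<exists>z\<in>F. (\<forall>p\<in>set (fst z). p x = 0) \<and> snd z x \<noteq> 0)"
    using constructible_dnf[OF assms] by (elim exE conjE)
  define u where "u p = (SOME r. poly_family (fst r) (snd r) \<and> (\<forall>x t. p (x(k := t)) = poly (snd r x) t))"
    for p :: "('a \<Rightarrow> complex) \<Rightarrow> complex"
  have u: "poly_family (fst (u p)) (snd (u p))" "p (x(k := t)) = poly (snd (u p) x) t"
    if "p \<in> polyfun UNIV" for p x t
  proof -
    have "\<exists>r. poly_family (fst r) (snd r) \<and> (\<forall>x t. p (x(k := t)) = poly (snd r x) t)"
      using polyfun_upd[OF that, of k] by auto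
    from someI_ex[OF this]
    have "poly_family (fst (u p)) (snd (u p)) \<and> (\<forall>x t. p (x(k := t)) = poly (snd (u p) x) t)"
      unfolding u_def .
    then show "poly_family (fst (u p)) (snd (u p))" "p (x(k := t)) = poly (snd (u p) x) t" by blast+
  qed
  have "(\<exists>t. S (x(k := t))) \<longleftrightarrow>
    (\<exists>z\<in>F. \<exists>t. (\<forall>(m, p)\<in>set (map u (fst z)). poly (p x) t = 0) \<and> poly (snd (u (snd z)) x) t \<noteq> 0)" for x
  proof -
    have "((\<forall>p\<in>set (fst z). p (x(k := t)) = 0) \<and> snd z (x(k := t)) \<noteq> 0) \<longleftrightarrow>
      (\<forall>(m, p)\<in>set (map u (fst z)). poly (p x) t = 0) \<and> poly (snd (u (snd z)) x) t \<noteq> 0"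
      if "z \<in> F" for z t
    proof -
      have "p (x(k := t)) = poly (snd (u p) x) t" if "p \<in> set (fst z)" for p
        using F(2) \<open>z \<in> F\<close> that by (intro u(2)) blast
      moreover have "snd z (x(k := t)) = poly (snd (u (snd z)) x) t"
        using F(2) \<open>z \<in> F\<close> by (intro u(2)) blast
      ultimately show ?thesis by (simp add: case_prod_beta)
    qed
    then show ?thesis unfolding F(3) by blast
  qed
  moreover have "constructible (\<lambda>x. \<exists>z\<in>F. \<exists>t. (\<forall>(m, p)\<in>set (map u (fst z)). poly (p x) t = 0) \<and> poly (snd (u (snd z)) x) t \<noteq> 0)"
  proof (rule constructible_bex[OF F(1)], rule constructible_elim)
    fix z assume "z \<in> F"
    then have z: "set (fst z) \<subseteq> polyfun UNIV" "snd z \<in> polyfun UNIV" using F(2) by auto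
    show "\<forall>(m, p)\<in>set (map u (fst z)). poly_family m p" using z u(1) by (auto simp: case_prod_beta)
    show "poly_family (fst (u (snd z))) (snd (u (snd z)))" using z u(1) by blast
  qed
  ultimately show ?thesis by presburger
qed

lemma constructible_ex_finite:
  assumes "finite W" "constructible S"
  shows "constructible (\<lambda>x. \<exists>z. S (\<lambda>v. if v \<in> W then z v else x v))"
  using assms
proof (induction W arbitrary: S rule: finite_induct)
  case empty
  then show ?case by simp
next
  case (insert k W)
  have "(\<exists>z. S (\<lambda>v. if v \<in> insert k W then z v else x v)) \<longleftrightarrow>
     (\<exists>z. \<exists>t. S ((\<lambda>v. if v \<in> W then z v else x v)(k := t)))" for x
  proof
    assume "\<exists>z. S (\<lambda>v. if v \<in> insert k W then z v else x v)"
    then obtain z where z: "S (\<lambda>v. if v \<in> insert k W then z v else x v)" by blast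
    have "(\<lambda>v. if v \<in> insert k W then z v else x v) = (\<lambda>v. if v \<in> W then z v else x v)(k := z k)"
      by auto
    then show "\<exists>z. \<exists>t. S ((\<lambda>v. if v \<in> W then z v else x v)(k := t))" using z by metis
  next
    assume "\<exists>z. \<exists>t. S ((\<lambda>v. if v \<in> W then z v else x v)(k := t))"
    then obtain z t where z: "S ((\<lambda>v. if v \<in> W then z v else x v)(k := t))" by blast
    have "(\<lambda>v. if v \<in> insert k W then (z(k := t)) v else x v) = (\<lambda>v. if v \<in> W then z v else x v)(k := t)"
      using insert.hyps by auto
    then show "\<exists>z. S (\<lambda>v. if v \<in> insert k W then z v else x v)" using z by metis
  qed
  then show ?case using insert.IH[OF constructible_ex[OF insert.prems, of k]] by presburger
qed

section \<open>Generic behaviour of constructible sets\<close>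

text \<open>The forms occupy only a part of the parameter space, the remaining unknowns being
  \<open>0\<close>. Closure under lines is what irreducibility of that part will rest on.\<close>

definition affine_set :: "('v \<Rightarrow> complex) set \<Rightarrow> bool" where
  "affine_set X \<longleftrightarrow> (\<forall>x\<in>X. \<forall>y\<in>X. \<forall>t. (\<lambda>v. x v + t * (y v - x v)) \<in> X)"

text \<open>Irreducibility: on the line through \<open>x\<close> and \<open>y\<close> both functions
  are nonzero polynomials in one variable, and so is their product.\<close>

lemma polyfun_common_nonzero:
  assumes X: "affine_set X" and P: "P \<in> polyfun UNIV" "x \<in> X" "P x \<noteq> 0"
    and Q: "Q \<in> polyfun UNIV" "y \<in> X" "Q y \<noteq> 0"
  shows "\<exists>z\<in>X. P z \<noteq> 0 \<and> Q z \<noteq> 0"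
proof -
  obtain p where p: "\<And>t. P (\<lambda>v. x v + t * (y v - x v)) = poly p t"
    using polyfun_line[OF P(1), of x] by (metis (no_types))
  obtain q where q: "\<And>t. Q (\<lambda>v. x v + t * (y v - x v)) = poly q t"
    using polyfun_line[OF Q(1), of x] by (metis (no_types))
  have "poly p 0 \<noteq> 0" "poly q 1 \<noteq> 0" using p[of 0] q[of 1] P(3) Q(3) by auto
  then have "p * q \<noteq> 0" by auto
  then obtain t where "poly (p * q) t \<noteq> 0" using poly_all_0_iff_0 by blast
  then show ?thesis using X P(2) Q(2) p[of t] q[of t] unfolding affine_set_def
    by (intro bexI[of _ "\<lambda>v. x v + t * (y v - x v)"]) auto
qed

text \<open>An atom is decided where its polynomial is nonzero, or on all of \<open>X\<close> if the
  polynomial vanishes there. Two such open sets meet by irreducibility, so the decisions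
  combine.\<close>

lemma constructible_dichotomy:
  assumes "constructible S" and X: "affine_set X" "x0 \<in> X"
  shows "\<exists>Q\<in>polyfun UNIV. (\<exists>x\<in>X. Q x \<noteq> 0) \<and>
    ((\<forall>x\<in>X. Q x \<noteq> 0 \<longrightarrow> S x) \<or> (\<forall>x\<in>X. Q x \<noteq> 0 \<longrightarrow> \<not> S x))"
  using assms(1)
proof induction
  case (eq P)
  show ?case
  proof (cases "\<exists>x\<in>X. P x \<noteq> 0")
    case True
    then show ?thesis using eq by (intro bexI[of _ P]) simp_all
  next
    case False
    then show ?thesis using X(2) by (intro bexI[of _ "\<lambda>x. 1"]) (auto intro: polyfun.const)
  qed
next
  case (neq P)
  show ?case
  proof (cases "\<exists>x\<in>X. P x \<noteq> 0")
    case True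
    then show ?thesis using neq by (intro bexI[of _ P]) simp_all
  next
    case False
    then show ?thesis using X(2) by (intro bexI[of _ "\<lambda>x. 1"]) (auto intro: polyfun.const)
  qed
next
  case (conj A B)
  then obtain P Q where
    P: "P \<in> polyfun UNIV" "\<exists>x\<in>X. P x \<noteq> 0" "(\<forall>x\<in>X. P x \<noteq> 0 \<longrightarrow> A x) \<or> (\<forall>x\<in>X. P x \<noteq> 0 \<longrightarrow> \<not> A x)" and
    Q: "Q \<in> polyfun UNIV" "\<exists>x\<in>X. Q x \<noteq> 0" "(\<forall>x\<in>X. Q x \<noteq> 0 \<longrightarrow> B x) \<or> (\<forall>x\<in>X. Q x \<noteq> 0 \<longrightarrow> \<not> B x)"
    by blast
  have "\<exists>z\<in>X. P z * Q z \<noteq> 0" using polyfun_common_nonzero[OF X(1) P(1) _ _ Q(1)] P(2) Q(2) by auto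
  moreover have "(\<lambda>x. P x * Q x) \<in> polyfun UNIV" using P(1) Q(1) by (rule polyfun.mult)
  ultimately show ?case by (rule_tac bexI[of _ "\<lambda>x. P x * Q x"]) (use P(3) Q(3) in auto)
next
  case (disj A B)
  then obtain P Q where
    P: "P \<in> polyfun UNIV" "\<exists>x\<in>X. P x \<noteq> 0" "(\<forall>x\<in>X. P x \<noteq> 0 \<longrightarrow> A x) \<or> (\<forall>x\<in>X. P x \<noteq> 0 \<longrightarrow> \<not> A x)" and
    Q: "Q \<in> polyfun UNIV" "\<exists>x\<in>X. Q x \<noteq> 0" "(\<forall>x\<in>X. Q x \<noteq> 0 \<longrightarrow> B x) \<or> (\<forall>x\<in>X. Q x \<noteq> 0 \<longrightarrow> \<not> B x)"
    by blast
  have "\<exists>z\<in>X. P z * Q z \<noteq> 0" using polyfun_common_nonzero[OF X(1) P(1) _ _ Q(1)] P(2) Q(2) by auto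
  moreover have "(\<lambda>x. P x * Q x) \<in> polyfun UNIV" using P(1) Q(1) by (rule polyfun.mult)
  ultimately show ?case by (rule_tac bexI[of _ "\<lambda>x. P x * Q x"]) (use P(3) Q(3) in auto)
qed

text \<open>
  The lowest homogeneous part of \<open>Q\<close> at \<open>y\<close> vanishes at the tangent vector of each curve through \<open>y\<close> in
  the zero set of \<open>Q\<close>. At \<open>e = 0\<close> the difference quotient below is \<open>0\<close>.
\<close>

lemma polyfun_vanish_of_curves:
  assumes Q: "Q \<in> polyfun UNIV"
    and curve: "\<And>z. z \<in> Z \<Longrightarrow> \<exists>\<gamma>. \<gamma> 0 = y \<and> (\<forall>v. ((\<lambda>e. \<gamma> e v) has_field_derivative z v) (at 0)) \<and>
        (\<forall>e. (\<lambda>v. (\<gamma> e v - y v) / e) \<in> Z) \<and> (\<forall>e. Q (\<gamma> e) = 0)"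
    and "z \<in> Z"
  shows "Q (\<lambda>v. y v + z v) = 0"
proof -
  obtain N p where poly_family: "poly_family N p" and p: "\<And>z t. Q (\<lambda>v. y v + t * z v) = poly (p z) t"
    using polyfun_line[OF Q, of y] by blast
  \<comment> \<open>The difference quotients \<open>u e\<close> stay in \<open>Z\<close>, so by
    induction their Taylor coefficients below \<open>m\<close> vanish. Dividing
    \<open>Q (\<gamma> e) = 0\<close> by \<open>e ^ m\<close> leaves \<open>H e\<close>, whose limit
    at \<open>0\<close> is the coefficient \<open>m\<close> at the tangent vector.\<close>
  have coef: "\<forall>z\<in>Z. coeff (p z) m = 0" for m
  proof (induction m rule: less_induct)
    case (less m)
    show ?case
    proof
      fix z assume "z \<in> Z"
      then obtain \<gamma> where g: "\<gamma> 0 = y" "\<And>v. ((\<lambda>e. \<gamma> e v) has_field_derivative z v) (at 0)"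
        "\<And>e. (\<lambda>v. (\<gamma> e v - y v) / e) \<in> Z" "\<And>e. Q (\<gamma> e) = 0" using curve by blast
      define u where "u e = (\<lambda>v. (\<gamma> e v - y v) / e)" for e
      define H where "H e = (\<Sum>j<N. e ^ j * coeff (p (u e)) (j + m))" for e
      have u: "((\<lambda>e. u e v) \<longlongrightarrow> z v) (at 0)" for v
        using g(2)[of v] unfolding u_def has_field_derivative_iff by (simp add: g(1))
      have cf: "((\<lambda>e. coeff (p (u e)) i) \<longlongrightarrow> coeff (p z) i) (at 0)" for i
      proof -
        have "(\<lambda>x. coeff (p x) i) \<in> polyfun UNIV" using poly_family unfolding poly_family_def by blast
        then show ?thesis by (rule polyfun_tendsto[OF _ u])
      qed
      have "(H \<longlongrightarrow> (\<Sum>j<N. 0 ^ j * coeff (p z) (j + m))) (at 0)"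
        unfolding H_def by (intro tendsto_sum tendsto_mult tendsto_power tendsto_ident_at cf)
      moreover have "(\<Sum>j<N. 0 ^ j * coeff (p z) (j + m)) = coeff (p z) m"
      proof (cases "N = 0")
        case True
        then show ?thesis using poly_family by (auto simp: poly_family_def)
      next
        case False
        then have "(\<Sum>j<N. 0 ^ j * coeff (p z) (j + m)) = (\<Sum>j\<in>{0}. 0 ^ j * coeff (p z) (j + m))"
          by (intro sum.mono_neutral_right) (auto simp: power_0_left)
        then show ?thesis by simp
      qed
      moreover have "eventually (\<lambda>e. H e = 0) (at 0)"
      proof (rule eventually_at_filter[THEN iffD2], rule always_eventually, intro allI impI)
        fix e :: complex assume e: "e \<noteq> 0"
        have low: "coeff (p (u e)) j = 0" if "j < m" for j
          using less[OF that] g(3) by (auto simp: u_def)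
        have high: "coeff (p (u e)) j = 0" if "j \<ge> N" for j using poly_family that by (auto simp: poly_family_def)
        have "\<gamma> e = (\<lambda>v. y v + e * u e v)" using e by (auto simp: u_def)
        then have "0 = poly (p (u e)) e" using g(4)[of e] p by metis
        also have "\<dots> = (\<Sum>j<N+m. coeff (p (u e)) j * e ^ j)"
          unfolding poly_altdef
          by (intro sum.mono_neutral_cong) (use high in \<open>auto simp: coeff_eq_0\<close>)
        also have "\<dots> = (\<Sum>j\<in>{m..<N+m}. coeff (p (u e)) j * e ^ j)"
          by (intro sum.mono_neutral_right) (use low in auto)
        also have "\<dots> = (\<Sum>j<N. coeff (p (u e)) (j + m) * e ^ (j + m))"
          using sum.shift_bounds_nat_ivl[of "\<lambda>j. coeff (p (u e)) j * e ^ j" 0 m N]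
          by (simp add: atLeast0LessThan)
        also have "\<dots> = e ^ m * H e" by (simp add: H_def sum_distrib_left power_add mult_ac)
        finally show "H e = 0" using e by simp
      qed
      ultimately show "coeff (p z) m = 0"
        using tendsto_unique[of "at (0::complex)" H "coeff (p z) m" 0]
        by (simp add: tendsto_eventually)
    qed
  qed
  then have "p z = 0" using \<open>z \<in> Z\<close> by (auto simp: poly_eq_iff)
  then show ?thesis using p[of 1 z] by simp
qed

section \<open>Linear systems and generalized Vandermonde matrices\<close>

text \<open>The bound \<open>Max T\<close> serves the induction: the root found between the old
  maximum and the new point is distinct from all earlier ones.\<close>

lemma Rolle_roots:
  fixes f f' :: "real \<Rightarrow> real"
  assumes "finite T" "T \<noteq> {}" "T \<subseteq> {0<..}"
    and "\<And>t. t \<in> T \<Longrightarrow> f t = 0" "\<And>t. t > 0 \<Longrightarrow> (f has_real_derivative f' t) (at t)"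
  shows "\<exists>T'. finite T' \<and> T' \<subseteq> {0<..<Max T} \<and> card T' = card T - 1 \<and> (\<forall>t\<in>T'. f' t = 0)"
  using assms(1-4)
proof (induction T rule: finite_linorder_max_induct)
  case empty
  then show ?case by simp
next
  case (insert b A)
  show ?case
  proof (cases "A = {}")
    case True
    then show ?thesis by (intro exI[of _ "{}"]) simp
  next
    case False
    then obtain T' where T': "finite T'" "T' \<subseteq> {0<..<Max A}" "card T' = card A - 1" "\<forall>t\<in>T'. f' t = 0"
      using insert by auto
    let ?a = "Max A"
    have a: "?a \<in> A" using False insert by simp
    then have ab: "0 < ?a" "?a < b" "f ?a = 0" "f b = 0" using insert by auto
    obtain c where c: "?a < c" "c < b" "f' c = 0"
    proof -
      have "continuous_on {?a..b} f"
      proof (intro continuous_at_imp_continuous_on ballI)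
        fix x assume "x \<in> {?a..b}"
        then show "isCont f x" using ab by (intro DERIV_isCont[OF assms(5)]) simp
      qed
      moreover have "(f has_derivative (\<lambda>h. f' x * h)) (at x)" if "?a < x" for x
        using assms(5)[of x] ab that by (simp add: has_field_derivative_def)
      ultimately obtain c where "?a < c" "c < b" "(\<lambda>h. f' c * h) = (\<lambda>h. 0)"
        using Rolle_deriv[of ?a b f "\<lambda>x h. f' x * h"] ab by auto
      then show ?thesis using that by (metis mult.right_neutral)
    qed
    have "Max (insert b A) = b" using insert by (intro Max_eqI) auto
    moreover have "c \<notin> T'" using T' c by auto
    moreover have "card A > 0" using a insert by (auto simp: card_gt_0_iff)
    moreover have "b \<notin> A" using insert by auto
    ultimately show ?thesis using T' c ab insert(1)
      by (intro exI[of _ "insert c T'"]) auto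
  qed
qed

text \<open>
  The bound of Descartes' rule of signs: a real polynomial with \<open>k\<close> terms has fewer than \<open>k\<close>
  positive roots. Dividing by the lowest power and differentiating removes one term.
\<close>

lemma generalized_vandermonde_real:
  fixes w :: "'a \<Rightarrow> nat" and c :: "'a \<Rightarrow> real"
  assumes "finite A" "inj_on w A" "finite T" "T \<subseteq> {0<..}" "card A \<le> card T"
    and "\<And>t. t \<in> T \<Longrightarrow> (\<Sum>a\<in>A. c a * t ^ w a) = 0"
  shows "\<forall>a\<in>A. c a = 0"
  using assms
proof (induction "card A" arbitrary: A w c T)
  case 0
  then show ?case by simp
next
  case (Suc k)
  then have "A \<noteq> {}" by auto
  then obtain b where b: "b \<in> A" "\<And>a. a \<in> A \<Longrightarrow> w b \<le> w a"
    using ex_min_if_finite[of "w ` A"] Suc.prems(1) by (metis (mono_tags, lifting) finite_imageI image_iff image_is_empty linorder_not_less)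
  let ?A = "A - {b}"
  define f where "f t = (\<Sum>a\<in>A. c a * t ^ (w a - w b))" for t
  define f' where "f' t = (\<Sum>a\<in>?A. (c a * real (w a - w b)) * t ^ (w a - w b - 1))" for t
  have d: "(f has_real_derivative f' t) (at t)" for t
  proof -
    have "(f has_real_derivative (\<Sum>a\<in>A. (c a * real (w a - w b)) * t ^ (w a - w b - 1))) (at t)"
      unfolding f_def by (auto intro!: derivative_eq_intros sum.cong)
    moreover have "(\<Sum>a\<in>A. (c a * real (w a - w b)) * t ^ (w a - w b - 1)) = f' t"
      unfolding f'_def using Suc.prems(1) b(1) by (simp add: sum.remove[of A b])
    ultimately show ?thesis by simp
  qed
  have f0: "f t = 0" if "t \<in> T" for t
  proof -
    have "t ^ w b * f t = (\<Sum>a\<in>A. c a * t ^ w a)"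
      unfolding f_def sum_distrib_left
      by (intro sum.cong refl) (use b(2) in \<open>simp add: power_add[symmetric] mult.left_commute\<close>)
    moreover have "t > 0" using that Suc.prems(4) by auto
    ultimately show ?thesis using Suc.prems(6)[OF that] by auto
  qed
  have Tne: "T \<noteq> {}" using Suc by auto
  obtain T' where T': "finite T'" "T' \<subseteq> {0<..<Max T}" "card T' = card T - 1" "\<forall>t\<in>T'. f' t = 0"
    using Rolle_roots[OF Suc.prems(3) Tne Suc.prems(4) f0 d] by blast
  have lt: "w b < w a" if "a \<in> ?A" for a
    using b that Suc.prems(2) by (metis DiffE inj_onD insertI1 le_neq_implies_less)
  \<comment> \<open>The other exponents exceed \<open>w b\<close>, so they remain distinct after
    lowering by \<open>w b + 1\<close>; the term count and the number of known roots both drop by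
    one.\<close>
  have "\<forall>a\<in>?A. c a * real (w a - w b) = 0"
  proof (rule Suc.hyps(1)[of ?A "\<lambda>a. w a - w b - 1" T'])
    show "inj_on (\<lambda>a. w a - w b - 1) ?A"
    proof (rule inj_onI)
      fix x y assume xy: "x \<in> ?A" "y \<in> ?A" "w x - w b - 1 = w y - w b - 1"
      then have "w x = w y" using lt[of x] lt[of y] by linarith
      then show "x = y" using xy Suc.prems(2) by (auto dest: inj_onD)
    qed
    show "k = card ?A" using Suc.hyps(2) Suc.prems(1) b(1) by simp
    show "card ?A \<le> card T'" using Suc.hyps(2) Suc.prems(1,5) b(1) T'(3) by simp
    show "T' \<subseteq> {0<..}" using T'(2) by auto
    show "(\<Sum>a\<in>?A. c a * real (w a - w b) * t ^ (w a - w b - 1)) = 0" if "t \<in> T'" for t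
      using T'(4) that by (simp add: f'_def)
    show "finite ?A" "finite T'" using Suc.prems(1) T'(1) by auto
  qed
  then have z: "c a = 0" if "a \<in> ?A" for a using lt[OF that] that by auto
  obtain t where t: "t \<in> T" using Tne by blast
  have "f t = c b" unfolding f_def using Suc.prems(1) b(1) z by (simp add: sum.remove[of A b])
  then have "c b = 0" using f0[OF t] by simp
  then show ?case using z by blast
qed

lemma generalized_vandermonde:
  fixes w :: "'a \<Rightarrow> nat" and c :: "'a \<Rightarrow> complex"
  assumes "finite A" "inj_on w A" "finite T" "T \<subseteq> {0<..}" "card A \<le> card T"
    and z: "\<And>t. t \<in> T \<Longrightarrow> (\<Sum>a\<in>A. c a * of_real t ^ w a) = 0" and "a \<in> A"
  shows "c a = 0"
proof -
  have *: "(\<Sum>a\<in>A. Re (c a) * t ^ w a) = 0" "(\<Sum>a\<in>A. Im (c a) * t ^ w a) = 0" if "t \<in> T" for t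
    using arg_cong[OF z[OF that], of Re] arg_cong[OF z[OF that], of Im]
    by (simp_all add: of_real_power[symmetric] del: of_real_power)
  have "\<forall>a\<in>A. Re (c a) = 0" by (rule generalized_vandermonde_real[OF assms(1-5) *(1)])
  moreover have "\<forall>a\<in>A. Im (c a) = 0" by (rule generalized_vandermonde_real[OF assms(1-5) *(2)])
  ultimately show ?thesis using \<open>a \<in> A\<close> by (simp add: complex_eq_iff)
qed

text \<open>Gaussian elimination by induction on the equations: a pivot \<open>p\<close> is removed
  from the unknowns, and its value is recovered from equation \<open>b\<close>.\<close>

lemma underdetermined_solution:
  fixes M :: "'a \<Rightarrow> 'b \<Rightarrow> 'k::field"
  assumes "finite B" "finite A" "card B < card A"
  shows "\<exists>z. (\<exists>a\<in>A. z a \<noteq> 0) \<and> (\<forall>b\<in>B. (\<Sum>a\<in>A. z a * M a b) = 0)"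
  using assms
proof (induction B arbitrary: A M rule: finite_induct)
  case empty
  then have "A \<noteq> {}" by auto
  then show ?case by (intro exI[of _ "\<lambda>_. 1"]) auto
next
  case (insert b B)
  show ?case
  proof (cases "\<forall>a\<in>A. M a b = 0")
    case True
    then show ?thesis using insert.IH[of A M] insert by auto
  next
    case False
    then obtain p where p: "p \<in> A" "M p b \<noteq> 0" by blast
    let ?A = "A - {p}"
    have "card B < card ?A" using insert p by simp
    then obtain z where z: "\<exists>a\<in>?A. z a \<noteq> 0"
      "\<forall>c\<in>B. (\<Sum>a\<in>?A. z a * (M a c - M a b / M p b * M p c)) = 0"
    proof -
      have "\<exists>z. (\<exists>a\<in>?A. z a \<noteq> 0) \<and> (\<forall>c\<in>B. (\<Sum>a\<in>?A. z a * (M a c - M a b / M p b * M p c)) = 0)"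
        by (rule insert.IH) (use insert.prems \<open>card B < card ?A\<close> in auto)
      then show ?thesis using that by blast
    qed
    let ?s = "\<Sum>a\<in>?A. z a * M a b / M p b"
    let ?z = "z(p := - ?s)"
    have eq: "(\<Sum>a\<in>A. ?z a * M a c) = (\<Sum>a\<in>?A. z a * (M a c - M a b / M p b * M p c))" for c
    proof -
      have "(\<Sum>a\<in>A. ?z a * M a c) = - ?s * M p c + (\<Sum>a\<in>?A. z a * M a c)"
        using insert p by (subst sum.remove[of A p]) auto
      also have "\<dots> = (\<Sum>a\<in>?A. z a * (M a c - M a b / M p b * M p c))"
        by (simp add: right_diff_distrib sum_subtractf sum_distrib_right mult.assoc)
      finally show ?thesis .
    qed
    show ?thesis
    proof (intro exI[of _ ?z] conjI ballI)
      show "\<exists>a\<in>A. ?z a \<noteq> 0" using z(1) by auto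
      show "(\<Sum>a\<in>A. ?z a * M a c) = 0" if "c \<in> insert b B" for c
        unfolding eq using z(2) p that by auto
    qed
  qed
qed

text \<open>Adjoining \<open>- h\<close> as an extra column \<open>None\<close> makes the system
  underdetermined. Injectivity forces the new unknown to be nonzero, and dividing by it solves the
  original system.\<close>

lemma square_system_solvable:
  fixes M :: "'a \<Rightarrow> 'b \<Rightarrow> 'k::field"
  assumes "finite A" "finite B" "card A = card B"
    and inj: "\<forall>z. (\<forall>b\<in>B. (\<Sum>a\<in>A. z a * M a b) = 0) \<longrightarrow> (\<forall>a\<in>A. z a = 0)"
  shows "\<exists>z. \<forall>b\<in>B. (\<Sum>a\<in>A. z a * M a b) = h b"
proof -
  let ?A = "insert None (Some ` A)"
  let ?M = "\<lambda>x b. case x of None \<Rightarrow> - h b | Some a \<Rightarrow> M a b"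
  have "card B < card ?A" using assms by (simp add: card_image)
  then obtain z where z: "\<exists>a\<in>?A. z a \<noteq> 0" "\<forall>b\<in>B. (\<Sum>a\<in>?A. z a * ?M a b) = 0"
    using underdetermined_solution[of B ?A ?M] assms by auto
  have s: "(\<Sum>a\<in>?A. z a * ?M a b) = (\<Sum>a\<in>A. z (Some a) * M a b) - z None * h b" for b
    using assms(1) by (simp add: sum.reindex)
  have "z None \<noteq> 0"
  proof
    assume n: "z None = 0"
    then have "\<forall>b\<in>B. (\<Sum>a\<in>A. z (Some a) * M a b) = 0" using z(2) s by simp
    then have "\<forall>a\<in>A. z (Some a) = 0" using inj[rule_format, of "\<lambda>a. z (Some a)"] by blast
    then show False using z(1) n by auto
  qed
  moreover have "(\<Sum>a\<in>A. z (Some a) / z None * M a b) = h b" if "b \<in> B" for b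
  proof -
    have "(\<Sum>a\<in>A. z (Some a) / z None * M a b) = (\<Sum>a\<in>A. z (Some a) * M a b) / z None"
      by (simp add: sum_divide_distrib)
    moreover have "(\<Sum>a\<in>A. z (Some a) * M a b) = z None * h b" using z(2) that s[of b] by simp
    ultimately show ?thesis using \<open>z None \<noteq> 0\<close> by simp
  qed
  ultimately show ?thesis by (intro exI[of _ "\<lambda>a. z (Some a) / z None"]) simp
qed

text \<open>Row rank equals column rank: a vector in the kernel of the transpose is paired with
  preimages of the unit vectors, which reads off each of its entries as \<open>0\<close>.\<close>

lemma square_system_transpose:
  fixes M :: "'a \<Rightarrow> 'b \<Rightarrow> 'k::field"
  assumes "finite A" "finite B" "card A = card B"
    and inj: "\<forall>z. (\<forall>b\<in>B. (\<Sum>a\<in>A. z a * M a b) = 0) \<longrightarrow> (\<forall>a\<in>A. z a = 0)"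
  shows "\<exists>y. \<forall>a\<in>A. (\<Sum>b\<in>B. y b * M a b) = h a"
proof (rule square_system_solvable; (intro allI impI ballI)?)
  fix y b0
  assume y: "\<forall>a\<in>A. (\<Sum>b\<in>B. y b * M a b) = 0" and b0: "b0 \<in> B"
  obtain z where z: "\<forall>b\<in>B. (\<Sum>a\<in>A. z a * M a b) = (if b = b0 then 1 else 0)"
    using square_system_solvable[OF assms, of "\<lambda>b. if b = b0 then 1 else 0"] by blast
  have "0 = (\<Sum>a\<in>A. z a * (\<Sum>b\<in>B. y b * M a b))" using y by simp
  also have "\<dots> = (\<Sum>b\<in>B. y b * (\<Sum>a\<in>A. z a * M a b))"
    unfolding sum_distrib_left by (subst sum.swap) (simp add: mult_ac)
  also have "\<dots> = (\<Sum>b\<in>B. if b = b0 then y b else 0)" using z by (intro sum.cong) auto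
  also have "\<dots> = y b0" using b0 assms by simp
  finally show "y b0 = 0" by simp
qed (use assms in auto)

text \<open>Both sums are expansions in base \<open>D\<close> with digits at the places
  \<open>u v\<close>; the digit at the lowest place is found modulo \<open>D\<close> after removing
  the common power.\<close>

lemma inj_on_base_expansion:
  fixes u \<alpha> \<beta> :: "'a \<Rightarrow> nat" and D :: nat
  assumes "inj_on u V" "finite V" "D > 0"
    and "\<And>v. v \<in> V \<Longrightarrow> \<alpha> v < D" "\<And>v. v \<in> V \<Longrightarrow> \<beta> v < D"
    and "(\<Sum>v\<in>V. \<alpha> v * D ^ u v) = (\<Sum>v\<in>V. \<beta> v * D ^ u v)" "v \<in> V"
  shows "\<alpha> v = \<beta> v"
  using assms
proof (induction "card V" arbitrary: V v)
  case 0
  then show ?case by simp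
next
  case (Suc k)
  have ne: "u ` V \<noteq> {}" using Suc.prems by auto
  then obtain b where b: "b \<in> V" "u b = Min (u ` V)"
    using Min_in[of "u ` V"] Suc.prems(2) by (metis finite_imageI imageE)
  have lt: "u b < u a" if "a \<in> V" "a \<noteq> b" for a
  proof -
    have "u b \<le> u a" using b that Suc.prems(2) by simp
    moreover have "u b \<noteq> u a" using that b Suc.prems(1) by (metis inj_onD)
    ultimately show ?thesis by simp
  qed
  have split: "\<exists>q. (\<Sum>v\<in>V. \<gamma> v * D ^ u v) = D ^ u b * (\<gamma> b + D * q)" for \<gamma> :: "'a \<Rightarrow> nat"
  proof -
    have "(\<Sum>v\<in>V - {b}. \<gamma> v * D ^ u v) = (\<Sum>v\<in>V - {b}. D ^ u b * D * (\<gamma> v * D ^ (u v - Suc (u b))))"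
    proof (intro sum.cong refl)
      fix v assume "v \<in> V - {b}"
      then have "u v = Suc (u b) + (u v - Suc (u b))" using lt[of v] by simp
      then have "D ^ u v = D ^ u b * D * D ^ (u v - Suc (u b))"
        by (metis power_Suc2 power_add)
      then show "\<gamma> v * D ^ u v = D ^ u b * D * (\<gamma> v * D ^ (u v - Suc (u b)))" by simp
    qed
    then have "(\<Sum>v\<in>V. \<gamma> v * D ^ u v) = D ^ u b * (\<gamma> b + D * (\<Sum>v\<in>V - {b}. \<gamma> v * D ^ (u v - Suc (u b))))"
      using Suc.prems(2) b(1) by (simp add: sum.remove[of V b] sum_distrib_left algebra_simps)
    then show ?thesis by blast
  qed
  obtain q where q: "(\<Sum>v\<in>V. \<alpha> v * D ^ u v) = D ^ u b * (\<alpha> b + D * q)" using split by blast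
  obtain r where r: "(\<Sum>v\<in>V. \<beta> v * D ^ u v) = D ^ u b * (\<beta> b + D * r)" using split by blast
  have "\<alpha> b + D * q = \<beta> b + D * r" using q r Suc.prems(3,6) by simp
  then have "(\<alpha> b + D * q) mod D = (\<beta> b + D * r) mod D" by simp
  then have bb: "\<alpha> b = \<beta> b" using Suc.prems(4,5) b(1) by simp
  have rest: "(\<Sum>v\<in>V - {b}. \<alpha> v * D ^ u v) = (\<Sum>v\<in>V - {b}. \<beta> v * D ^ u v)"
    using Suc.prems(2,6) b(1) bb by (simp add: sum.remove[of V b])
  have "\<alpha> v = \<beta> v" if "v \<in> V - {b}" for v
  proof (rule Suc.hyps(1)[of "V - {b}"])
    show "k = card (V - {b})" using Suc.hyps(2) Suc.prems(2) b(1) by simp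
    show "inj_on u (V - {b})" using Suc.prems(1) by (rule inj_on_diff)
  qed (use Suc.prems that rest in auto)
  then show ?case using bb Suc.prems by (cases "v = b") auto
qed

section \<open>Exponents, evaluation and algebraic relations\<close>

abbreviation (input) lookup where "lookup \<equiv> Poly_Mapping.lookup"
abbreviation (input) keys where "keys \<equiv> Poly_Mapping.keys"
abbreviation (input) single where "single \<equiv> Poly_Mapping.single"

lemma expo_deg_superset:
  assumes "finite I" "keys m \<subseteq> I" shows "expo_deg m = (\<Sum>i\<in>I. lookup m i)"
  unfolding expo_deg_def by (intro sum.mono_neutral_left) (use assms in \<open>auto simp: in_keys_iff\<close>)

lemma keys_add_expo: "keys (m + m') = keys m \<union> keys (m' :: 'v \<Rightarrow>\<^sub>0 nat)"
  by (auto simp: in_keys_iff lookup_add)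

lemma expo_deg_add: "expo_deg (m + m') = expo_deg m + expo_deg m'"
proof -
  have "finite (keys m \<union> keys m')" by simp
  then show ?thesis
    by (simp add: expo_deg_superset[of "keys m \<union> keys m'"] keys_add_expo lookup_add sum.distrib)
qed

lemma expo_deg_single [simp]: "expo_deg (single i k) = k"
  by (simp add: expo_deg_def)

lemma expo_deg_zero [simp]: "expo_deg 0 = 0"
  by (simp add: expo_deg_def)

lemma lookup_le_expo_deg: "lookup m i \<le> expo_deg m"
proof (cases "i \<in> keys m")
  case True
  then show ?thesis unfolding expo_deg_def by (intro member_le_sum) auto
qed (simp add: in_keys_iff)

lemma expo_deg_eq_0_iff: "expo_deg m = 0 \<longleftrightarrow> m = 0"
proof
  assume "expo_deg m = 0"
  then have "lookup m i = 0" for i using lookup_le_expo_deg[of m i] by simp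
  then show "m = 0" by (intro poly_mapping_eqI) simp
qed simp

definition monom_val :: "('v \<Rightarrow>\<^sub>0 nat) \<Rightarrow> ('v \<Rightarrow> complex) \<Rightarrow> complex" where
  "monom_val m x = (\<Prod>i\<in>keys m. x i ^ lookup m i)"

lemma monom_val_superset:
  assumes "finite I" "keys m \<subseteq> I" shows "monom_val m x = (\<Prod>i\<in>I. x i ^ lookup m i)"
  unfolding monom_val_def by (intro prod.mono_neutral_left) (use assms in \<open>auto simp: in_keys_iff\<close>)

lemma monom_val_add: "monom_val (m + m') x = monom_val m x * monom_val m' x"
proof -
  have "finite (keys m \<union> keys m')" by simp
  then show ?thesis
    by (simp add: monom_val_superset[of "keys m \<union> keys m'"] keys_add_expo lookup_add power_add prod.distrib)
qed

lemma monom_val_scale: "monom_val m (\<lambda>i. t * x i) = t ^ expo_deg m * monom_val m x"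
  by (simp add: monom_val_def expo_deg_def power_mult_distrib prod.distrib power_sum)

lemma eval_poly_superset:
  assumes "finite F" "keys p \<subseteq> F" shows "eval_poly p x = (\<Sum>m\<in>F. lookup p m * monom_val m x)"
  unfolding eval_poly_def monom_val_def[symmetric]
  by (intro sum.mono_neutral_left) (use assms in \<open>auto simp: in_keys_iff\<close>)

lemma eval_poly_add: "eval_poly (p + q) x = eval_poly p x + eval_poly q x"
proof -
  have "finite (keys p \<union> keys q)" by simp
  moreover have "keys (p + q) \<subseteq> keys p \<union> keys q" by (rule keys_add)
  ultimately show ?thesis
    by (simp add: eval_poly_superset[of "keys p \<union> keys q"] lookup_add sum.distrib ring_distribs)
qed

lemma eval_poly_zero [simp]: "eval_poly 0 x = 0"
  by (simp add: eval_poly_def)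

lemma eval_poly_sum: "eval_poly (\<Sum>i\<in>A. p i) x = (\<Sum>i\<in>A. eval_poly (p i) x)"
  by (induction A rule: infinite_finite_induct) (auto simp: eval_poly_add)

lemma eval_poly_single: "eval_poly (single m c) x = c * monom_val m x"
  using eval_poly_superset[of "{m}" "single m c" x] by simp

lemma poly_mapping_sum_single: "(\<Sum>m\<in>keys p. single m (lookup p m)) = p"
  by (intro poly_mapping_eqI)
    (auto simp: lookup_sum lookup_single when_def in_keys_iff)

lemma eval_poly_mult: "eval_poly (p * q) x = eval_poly p x * eval_poly q x"
proof -
  have "p * q = (\<Sum>m\<in>keys p. \<Sum>m'\<in>keys q. single (m + m') (lookup p m * lookup q m'))"
    by (subst (1) poly_mapping_sum_single[of p, symmetric], subst (1) poly_mapping_sum_single[of q, symmetric])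
      (simp add: sum_product mult_single)
  then have "eval_poly (p * q) x =
      (\<Sum>m\<in>keys p. \<Sum>m'\<in>keys q. (lookup p m * monom_val m x) * (lookup q m' * monom_val m' x))"
    by (simp add: eval_poly_sum eval_poly_single monom_val_add mult_ac)
  also have "\<dots> = eval_poly p x * eval_poly q x"
    by (simp add: eval_poly_superset[OF finite_keys order_refl] sum_product)
  finally show ?thesis .
qed

lemma eval_poly_one: "eval_poly 1 x = 1"
  using eval_poly_single[of 0 1 x] by (simp add: monom_val_def)

lemma eval_poly_power: "eval_poly (p ^ k) x = eval_poly p x ^ k"
  by (induction k) (simp_all add: eval_poly_mult eval_poly_one)

lemma eval_poly_prod: "eval_poly (\<Prod>i\<in>A. p i) x = (\<Prod>i\<in>A. eval_poly (p i) x)"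
  by (induction A rule: infinite_finite_induct) (simp_all add: eval_poly_mult eval_poly_one)

lemma polyfun_eval_poly:
  assumes "P \<in> polyfun V" shows "\<exists>p\<in>polys V. P = eval_poly p"
  using assms
proof induction
  case (const c)
  show ?case
    by (intro bexI[of _ "single 0 c"]) (auto simp: eval_poly_single monom_val_def polys_def)
next
  case (var v)
  then show ?case
    by (intro bexI[of _ "single (single v 1) 1"]) (auto simp: eval_poly_single monom_val_def polys_def)
next
  case (add P Q)
  then obtain p q where pq: "p \<in> polys V" "q \<in> polys V" "P = eval_poly p" "Q = eval_poly q" by blast
  have "p + q \<in> polys V" using pq(1,2) keys_add[of p q] by (auto simp: polys_def)
  then show ?case using pq by (intro bexI[of _ "p + q"]) (simp_all add: eval_poly_add)
next
  case (mult P Q)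
  then obtain p q where pq: "p \<in> polys V" "q \<in> polys V" "P = eval_poly p" "Q = eval_poly q" by blast
  have "p * q \<in> polys V"
    unfolding polys_def
  proof (intro CollectI ballI)
    fix m assume "m \<in> keys (p * q)"
    then obtain a b where "m = a + b" "a \<in> keys p" "b \<in> keys q" using keys_mult[of p q] by blast
    then show "keys m \<subseteq> V" using pq by (simp add: keys_add_expo polys_def)
  qed
  then show ?case using pq by (intro bexI[of _ "p * q"]) (simp_all add: eval_poly_mult)
qed

lemma eval_poly_forms_scale:
  assumes "p \<in> forms V e" shows "eval_poly p (\<lambda>i. t * x i) = t ^ e * eval_poly p x"
proof -
  have "eval_poly p (\<lambda>i. t * x i) = (\<Sum>m\<in>keys p. lookup p m * (t ^ e * monom_val m x))"
    unfolding eval_poly_superset[OF finite_keys order_refl]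
    by (intro sum.cong refl) (use assms in \<open>auto simp: monom_val_scale forms_def expos_def\<close>)
  then show ?thesis
    by (simp add: eval_poly_superset[OF finite_keys order_refl] sum_distrib_left mult_ac)
qed

lemma polyfun_homogeneous_components:
  assumes "P \<in> polyfun V"
  shows "\<exists>h N. (\<forall>e. h e \<in> forms V e) \<and> (\<forall>x. P x = (\<Sum>e<N. eval_poly (h e) x))"
proof -
  obtain p where p: "p \<in> polys V" "P = eval_poly p" using polyfun_eval_poly[OF assms] by blast
  define h where "h e = (\<Sum>m\<in>{m\<in>keys p. expo_deg m = e}. single m (lookup p m))" for e
  have "h e \<in> forms V e" for e
  proof -
    have "lookup (h e) m = 0" if "m \<notin> expos V e" for m
      using that p(1) by (auto simp: h_def lookup_sum lookup_single when_def expos_def polys_def intro!: sum.neutral)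
    then show ?thesis by (auto simp: forms_def in_keys_iff)
  qed
  moreover have "P x = (\<Sum>e<Suc (Max (insert 0 (expo_deg ` keys p))). eval_poly (h e) x)" for x
  proof -
    have "expo_deg m < Suc (Max (insert 0 (expo_deg ` keys p)))" if "m \<in> keys p" for m
      using that by (simp add: less_Suc_eq_le)
    then have "(\<Sum>e<Suc (Max (insert 0 (expo_deg ` keys p))). \<Sum>m\<in>{m\<in>keys p. expo_deg m = e}. single m (lookup p m))
        = (\<Sum>m\<in>keys p. single m (lookup p m))"
      by (intro sum.group) auto
    then have "p = (\<Sum>e<Suc (Max (insert 0 (expo_deg ` keys p))). h e)"
      by (simp only: h_def poly_mapping_sum_single)
    then show ?thesis using p(2) eval_poly_sum[of h] by metis
  qed
  ultimately show ?thesis by blast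
qed

text \<open>A crude count suffices, since only the growth in \<open>b\<close> with power
  \<open>card V\<close> enters the comparison of dimensions.\<close>

lemma finite_bounded_expos:
  assumes "finite V"
  shows "finite {m :: 'v \<Rightarrow>\<^sub>0 nat. keys m \<subseteq> V \<and> expo_deg m \<le> b}"
    and "card {m :: 'v \<Rightarrow>\<^sub>0 nat. keys m \<subseteq> V \<and> expo_deg m \<le> b} \<le> Suc b ^ card V"
proof -
  let ?E = "{m :: 'v \<Rightarrow>\<^sub>0 nat. keys m \<subseteq> V \<and> expo_deg m \<le> b}"
  let ?f = "\<lambda>m :: 'v \<Rightarrow>\<^sub>0 nat. restrict (lookup m) V"
  have sub: "?f ` ?E \<subseteq> PiE V (\<lambda>_. {..b})"
  proof (rule image_subsetI)
    fix m assume "m \<in> ?E"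
    then have "lookup m v \<le> b" for v using lookup_le_expo_deg[of m v] by simp
    then show "?f m \<in> PiE V (\<lambda>_. {..b})" by simp
  qed
  have inj: "inj_on ?f ?E"
  proof (rule inj_onI, rule poly_mapping_eqI)
    fix m m' i assume m: "m \<in> ?E" "m' \<in> ?E" "?f m = ?f m'"
    show "lookup m i = lookup m' i"
    proof (cases "i \<in> V")
      case True
      then show ?thesis using fun_cong[OF m(3), of i] by simp
    next
      case False
      then have "i \<notin> keys m" "i \<notin> keys m'" using m by auto
      then show ?thesis by (simp add: in_keys_iff)
    qed
  qed
  have fin: "finite (PiE V (\<lambda>_. {..b}))" using assms by (intro finite_PiE) auto
  show "finite ?E" using finite_subset[OF sub fin] inj by (rule finite_imageD)
  have "card ?E = card (?f ` ?E)" using inj by (simp add: card_image)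
  also have "\<dots> \<le> card (PiE V (\<lambda>_. {..b}))" using sub fin by (rule card_mono[rotated])
  also have "\<dots> = Suc b ^ card V" using assms by (simp add: card_PiE)
  finally show "card ?E \<le> Suc b ^ card V" .
qed

lemma finite_expos: "finite V \<Longrightarrow> finite (expos V d)"
  by (rule finite_subset[OF _ finite_bounded_expos(1)[of V d]]) (auto simp: expos_def)

text \<open>A monomial is either divisible by the variable \<open>c\<close> or free of it. This
  gives Pascal's rule for dim S_d, and the parameter count for the kernel of a directional
  derivative.\<close>

lemma expos_insert_Suc:
  assumes "c \<notin> V"
  shows "expos (insert c V) (Suc d) = (\<lambda>m. m + single c 1) ` expos (insert c V) d \<union> expos V (Suc d)"
    and "(\<lambda>m. m + single c 1) ` expos (insert c V) d \<inter> expos V (Suc d) = {}"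
proof -
  have "m \<in> (\<lambda>m. m + single c 1) ` expos (insert c V) d"
    if m: "m \<in> expos (insert c V) (Suc d)" "m \<notin> expos V (Suc d)" for m
  proof -
    have "c \<in> keys m" using m by (auto simp: expos_def)
    then have e: "m = (m - single c 1) + single c 1"
      by (intro poly_mapping_eqI) (auto simp: lookup_add lookup_minus lookup_single when_def in_keys_iff)
    have "expo_deg (m - single c 1) + 1 = Suc d"
      using m(1) e expo_deg_add[of "m - single c 1" "single c 1"] by (simp add: expos_def)
    moreover have "keys (m - single c 1) \<subseteq> keys m" using e keys_add_expo by (metis Un_upper1)
    ultimately have "m - single c 1 \<in> expos (insert c V) d" using m(1) by (auto simp: expos_def)
    then show ?thesis using e by blast
  qed
  then show "expos (insert c V) (Suc d) = (\<lambda>m. m + single c 1) ` expos (insert c V) d \<union> expos V (Suc d)"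
    by (auto simp: expos_def expo_deg_add keys_add_expo)
  show "(\<lambda>m. m + single c 1) ` expos (insert c V) d \<inter> expos V (Suc d) = {}"
    using assms by (auto simp: expos_def keys_add_expo)
qed

lemma expos_0: "expos V 0 = {0}"
  by (auto simp: expos_def expo_deg_eq_0_iff)

lemma card_expos_insert:
  assumes "finite V" "c \<notin> V"
  shows "card (expos (insert c V) (Suc d)) = card (expos (insert c V) d) + card (expos V (Suc d))"
proof -
  have "card ((\<lambda>m. m + single c 1) ` expos (insert c V) d) = card (expos (insert c V) d)"
    by (intro card_image inj_onI) simp
  then show ?thesis
    using expos_insert_Suc(2)[OF assms(2), of d] assms finite_expos[of "insert c V" d]
      finite_expos[of V "Suc d"]
    unfolding expos_insert_Suc(1)[OF assms(2), of d] by (simp add: card_Un_disjoint)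
qed

lemma card_expos:
  assumes "finite V" "V \<noteq> {}"
  shows "card (expos V d) = (card V - 1 + d) choose d"
  using assms
proof (induction arbitrary: d rule: finite_ne_induct)
  case (singleton c)
  show ?case
  proof (induction d)
    case (Suc d)
    have "expos ({} :: 'a set) (Suc d) = {}" by (auto simp: expos_def)
    then show ?case using Suc card_expos_insert[of "{}" c d] by simp
  qed (simp add: expos_0)
next
  case (insert c V)
  obtain k where k: "card V = Suc k" using insert by (metis card_0_eq not0_implies_Suc)
  show ?case
  proof (induction d)
    case (Suc d)
    have "card (expos (insert c V) (Suc d)) = (Suc k + d choose d) + (k + Suc d choose Suc d)"
      using Suc insert.IH[of "Suc d"] card_expos_insert[of V c d] insert.hyps k by simp
    then show ?case using k insert.hyps by simp
  qed (simp add: expos_0)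
qed

section \<open>Degree bounds and algebraic dependence\<close>

definition bounded_poly :: "'v set \<Rightarrow> nat \<Rightarrow> 'v cpoly \<Rightarrow> bool" where
  "bounded_poly V b p \<longleftrightarrow> (\<forall>m\<in>keys p. keys m \<subseteq> V \<and> expo_deg m \<le> b)"

lemma bounded_poly_mult:
  assumes "bounded_poly V b p" "bounded_poly V c q" shows "bounded_poly V (b + c) (p * q)"
  unfolding bounded_poly_def
proof
  fix m assume "m \<in> keys (p * q)"
  then obtain u v where "m = u + v" "u \<in> keys p" "v \<in> keys q" using keys_mult[of p q] by blast
  then show "keys m \<subseteq> V \<and> expo_deg m \<le> b + c"
    using assms by (auto simp: keys_add_expo expo_deg_add bounded_poly_def intro: add_mono)
qed

lemma bounded_poly_one: "bounded_poly V 0 1"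
  by (simp add: bounded_poly_def)

lemma bounded_poly_power: "bounded_poly V b p \<Longrightarrow> bounded_poly V (k * b) (p ^ k)"
  by (induction k) (simp_all add: bounded_poly_one bounded_poly_mult)

lemma bounded_poly_prod:
  "finite A \<Longrightarrow> (\<And>i. i \<in> A \<Longrightarrow> bounded_poly V (b i) (p i)) \<Longrightarrow>
    bounded_poly V (\<Sum>i\<in>A. b i) (\<Prod>i\<in>A. p i)"
  by (induction A rule: finite_induct) (simp_all add: bounded_poly_one bounded_poly_mult)

lemma bounded_poly_mono: "bounded_poly V b p \<Longrightarrow> b \<le> c \<Longrightarrow> bounded_poly V c p"
  by (auto simp: bounded_poly_def)

text \<open>\<open>D ^ N\<close> counts products with exponents below \<open>D\<close>, and the left
  side bounds the monomials available to them. One extra factor \<open>D\<close> outweighs the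
  constant \<open>Suc C ^ k\<close>.\<close>

lemma exists_large_base:
  fixes C k N :: nat
  assumes "k < N" shows "\<exists>D>0. (Suc (C * D)) ^ k < D ^ N"
proof -
  define D where "D = Suc (Suc C ^ k)"
  have "Suc (C * D) ^ k \<le> (Suc C * D) ^ k" by (intro power_mono) (auto simp: D_def)
  also have "\<dots> = Suc C ^ k * D ^ k" by (rule power_mult_distrib)
  also have "\<dots> < D * D ^ k" by (intro mult_strict_right_mono) (auto simp: D_def)
  also have "\<dots> = D ^ Suc k" by simp
  also have "\<dots> \<le> D ^ N" using assms by (intro power_increasing) (auto simp: D_def)
  finally show ?thesis by (intro exI[of _ D]) (auto simp: D_def)
qed

text \<open>More polynomials than variables: the products of the coordinates of \<phi> with all
  exponents below \<open>D\<close> number \<open>D ^ card Y\<close>, while their degrees grow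
  linearly in \<open>D\<close>, so they lie in a space of dimension of order
  \<open>D ^ card I\<close>.\<close>

lemma algebraic_relation:
  fixes \<phi> :: "('u \<Rightarrow> complex) \<Rightarrow> 'v \<Rightarrow> complex"
  assumes I: "finite I" and Y: "finite Y" "card I < card Y"
    and \<phi>: "\<And>v. v \<in> Y \<Longrightarrow> (\<lambda>x. \<phi> x v) \<in> polyfun I"
  shows "\<exists>Q\<in>polyfun Y. (\<exists>y. Q y \<noteq> 0) \<and> (\<forall>x. Q (\<phi> x) = 0)"
proof -
  have "\<exists>p. \<forall>v\<in>Y. p v \<in> polys I \<and> (\<lambda>x. \<phi> x v) = eval_poly (p v)"
    using polyfun_eval_poly[OF \<phi>] by (intro bchoice) blast
  then obtain p where p: "\<And>v. v \<in> Y \<Longrightarrow> p v \<in> polys I" "\<And>v x. v \<in> Y \<Longrightarrow> \<phi> x v = eval_poly (p v) x"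
    by metis
  define \<delta> where "\<delta> = Max (insert 0 (expo_deg ` (\<Union>v\<in>Y. keys (p v))))"
  have bp: "bounded_poly I \<delta> (p v)" if "v \<in> Y" for v
    unfolding bounded_poly_def
  proof (intro ballI conjI)
    fix m assume m: "m \<in> keys (p v)"
    then show "keys m \<subseteq> I" using p(1)[OF that] by (auto simp: polys_def)
    show "expo_deg m \<le> \<delta>" unfolding \<delta>_def by (intro Max_ge) (use Y(1) m that in auto)
  qed
  let ?N = "card Y"
  obtain D where D: "D > 0" "Suc (?N * \<delta> * D) ^ card I < D ^ ?N"
    using exists_large_base[OF Y(2)] by blast
  define b where "b = ?N * \<delta> * D"
  define E where "E = {m :: 'u \<Rightarrow>\<^sub>0 nat. keys m \<subseteq> I \<and> expo_deg m \<le> b}"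
  define A where "A = PiE Y (\<lambda>_. {..<D})"
  define r where "r \<alpha> = (\<Prod>v\<in>Y. p v ^ \<alpha> v)" for \<alpha> :: "'v \<Rightarrow> nat"
  have A: "finite A" "card A = D ^ ?N" using Y by (auto simp: A_def card_PiE intro: finite_PiE)
  have E: "finite E" "card E < card A"
    using finite_bounded_expos[OF I, of b] D(2) A(2) by (auto simp: E_def b_def)
  have rE: "keys (r \<alpha>) \<subseteq> E" if "\<alpha> \<in> A" for \<alpha>
  proof -
    have "bounded_poly I (\<Sum>v\<in>Y. \<alpha> v * \<delta>) (r \<alpha>)"
      unfolding r_def using Y(1) by (intro bounded_poly_prod bounded_poly_power bp)
    moreover have "(\<Sum>v\<in>Y. \<alpha> v * \<delta>) \<le> (\<Sum>v\<in>Y. D * \<delta>)"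
      using that by (intro sum_mono mult_right_mono) (auto simp: A_def PiE_iff less_imp_le)
    ultimately have "bounded_poly I b (r \<alpha>)"
      by (rule bounded_poly_mono[THEN bounded_poly_mono]) (simp add: b_def mult_ac)
    then show ?thesis by (auto simp: bounded_poly_def E_def)
  qed
  \<comment> \<open>There are more products \<open>r \<alpha>\<close> than monomials in
    \<open>E\<close>; a linear dependence among them is the relation \<open>Q\<close>.\<close>
  obtain z where z: "\<exists>\<alpha>\<in>A. z \<alpha> \<noteq> 0" "\<forall>m\<in>E. (\<Sum>\<alpha>\<in>A. z \<alpha> * lookup (r \<alpha>) m) = 0"
    using underdetermined_solution[OF E(1) A(1) E(2), of "\<lambda>\<alpha> m. lookup (r \<alpha>) m"] by blast
  define Q where "Q y = (\<Sum>\<alpha>\<in>A. z \<alpha> * (\<Prod>v\<in>Y. y v ^ \<alpha> v))" for y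
  have "Q \<in> polyfun Y"
    unfolding Q_def by (intro polyfun_sum polyfun.mult polyfun.const polyfun_prod polyfun_power polyfun.var)
  moreover have "Q (\<phi> x) = 0" for x
  proof -
    have "Q (\<phi> x) = (\<Sum>\<alpha>\<in>A. z \<alpha> * eval_poly (r \<alpha>) x)"
      unfolding Q_def r_def eval_poly_prod eval_poly_power
      by (intro sum.cong arg_cong2[where f = times] prod.cong refl) (simp add: p(2))
    also have "\<dots> = (\<Sum>\<alpha>\<in>A. \<Sum>m\<in>E. z \<alpha> * lookup (r \<alpha>) m * monom_val m x)"
      by (intro sum.cong refl) (simp add: eval_poly_superset[OF E(1) rE] sum_distrib_left mult.assoc)
    also have "\<dots> = (\<Sum>m\<in>E. (\<Sum>\<alpha>\<in>A. z \<alpha> * lookup (r \<alpha>) m) * monom_val m x)"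
      by (subst sum.swap) (simp add: sum_distrib_right)
    also have "\<dots> = 0" using z(2) by simp
    finally show ?thesis .
  qed
  moreover have "\<exists>y. Q y \<noteq> 0"
  proof (rule ccontr)
    assume "\<nexists>y. Q y \<noteq> 0"
    then have Q0: "Q y = 0" for y by blast
    \<comment> \<open>Kronecker substitution: setting the variable \<open>v\<close> to
      \<open>t ^ (D ^ u v)\<close> sends distinct monomials of \<open>Q\<close> to distinct powers
      of \<open>t\<close>, so vanishing at enough positive \<open>t\<close> kills all
      coefficients.\<close>
    obtain u :: "'v \<Rightarrow> nat" where u: "inj_on u Y" using finite_imp_inj_to_nat_seg[OF Y(1)] by blast
    define w where "w \<alpha> = (\<Sum>v\<in>Y. \<alpha> v * D ^ u v)" for \<alpha> :: "'v \<Rightarrow> nat"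
    have w: "inj_on w A"
    proof (rule inj_onI)
      fix \<alpha> \<beta> assume ab: "\<alpha> \<in> A" "\<beta> \<in> A" "w \<alpha> = w \<beta>"
      have "\<alpha> v = \<beta> v" if "v \<in> Y" for v
        by (rule inj_on_base_expansion[OF u Y(1) D(1)])
          (use ab that in \<open>auto simp: A_def PiE_iff w_def\<close>)
      then show "\<alpha> = \<beta>" using ab unfolding A_def by (metis PiE_ext)
    qed
    have "z \<alpha> = 0" if "\<alpha> \<in> A" for \<alpha>
    proof (rule generalized_vandermonde[OF A(1) w _ _ _ _ that])
      show "finite (real ` {1..card A})" "real ` {1..card A} \<subseteq> {0<..}" by auto
      show "card A \<le> card (real ` {1..card A})" by (simp add: card_image)
      fix t :: real
      have "(\<Prod>v\<in>Y. (of_real t ^ (D ^ u v)) ^ \<alpha> v) = complex_of_real t ^ w \<alpha>" for \<alpha>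
        by (simp add: w_def power_sum power_mult[symmetric] mult.commute)
      then show "(\<Sum>\<alpha>\<in>A. z \<alpha> * of_real t ^ w \<alpha>) = 0"
        using Q0[of "\<lambda>v. of_real t ^ (D ^ u v)"] by (simp add: Q_def)
    qed
    then show False using z(1) by blast
  qed
  ultimately show ?thesis by blast
qed

section \<open>Directional derivatives of forms\<close>

lemma lookup_single_mult_add: "lookup (single \<mu> c * p) (\<mu> + m) = c * lookup p m"
  for \<mu> :: "'v \<Rightarrow>\<^sub>0 nat" and c :: complex
proof -
  have "single \<mu> c * p = (\<Sum>k\<in>keys p. single (\<mu> + k) (c * lookup p k))"
    by (subst (1) poly_mapping_sum_single[of p, symmetric]) (simp add: sum_distrib_left mult_single)
  then have "lookup (single \<mu> c * p) (\<mu> + m) = (\<Sum>k\<in>keys p. if k = m then c * lookup p k else 0)"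
    by (simp add: lookup_sum lookup_single when_def)
  then show ?thesis by (simp add: in_keys_iff)
qed

lemma lookup_single_mult_notin:
  fixes \<mu> :: "'v \<Rightarrow>\<^sub>0 nat" and c :: complex
  assumes "\<And>k. m \<noteq> \<mu> + k" shows "lookup (single \<mu> c * p) m = 0"
proof -
  have "single \<mu> c * p = (\<Sum>k\<in>keys p. single (\<mu> + k) (c * lookup p k))"
    by (subst (1) poly_mapping_sum_single[of p, symmetric]) (simp add: sum_distrib_left mult_single)
  then show ?thesis using assms
    by (simp add: lookup_sum lookup_single when_def) (intro sum.neutral, metis)
qed

lemma lookup_const_poly_mult: "lookup (const_poly c * p) m = c * lookup p m"
  using lookup_single_mult_add[of 0 c p m] by (simp add: const_poly_def)

lemma const_poly_mult: "const_poly (a * b) = const_poly a * const_poly b"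
  by (simp add: const_poly_def mult_single)

lemma const_poly_add: "const_poly (a + b) = const_poly a + const_poly b"
  by (simp add: const_poly_def single_add)

lemma const_poly_0 [simp]: "const_poly 0 = 0"
  by (simp add: const_poly_def)

lemma const_poly_1 [simp]: "const_poly 1 = 1"
  by (simp add: const_poly_def)

lemma const_poly_sum: "const_poly (\<Sum>i\<in>A. f i) = (\<Sum>i\<in>A. const_poly (f i))"
  by (induction A rule: infinite_finite_induct) (simp_all add: const_poly_add)

lemma lookup_partial: "lookup (partial i f) m = of_nat (Suc (lookup m i)) * lookup f (m + single i 1)"
proof -
  have "lookup (partial i f) m =
      (\<Sum>k\<in>keys f. (of_nat (lookup k i) * lookup f k when k - single i 1 = m))"
    by (simp add: partial_def lookup_sum lookup_single)
  also have "\<dots> = (\<Sum>k\<in>keys f. if k = m + single i 1 then of_nat (lookup k i) * lookup f k else 0)"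
  proof (intro sum.cong refl)
    fix k assume "k \<in> keys f"
    have *: "k = m + single i 1" if "k - single i 1 = m" "lookup k i \<noteq> 0"
      using that by (intro poly_mapping_eqI)
        (auto simp: lookup_add lookup_minus lookup_single when_def)
    show "(of_nat (lookup k i) * lookup f k when k - single i 1 = m) =
        (if k = m + single i 1 then of_nat (lookup k i) * lookup f k else 0)"
    proof (cases "k = m + single i 1")
      case True
      then have "k - single i 1 = m" by simp
      then show ?thesis using True by (simp only: when_def if_True simp_thms)
    next
      case False
      then have "k - single i 1 = m \<Longrightarrow> lookup k i = 0" using * by blast
      then show ?thesis using False by (cases "k - single i 1 = m") simp_all
    qed
  qed
  also have "\<dots> = of_nat (Suc (lookup m i)) * lookup f (m + single i 1)"
    by (simp add: in_keys_iff lookup_add)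
  finally show ?thesis .
qed

text \<open>The operator of a linear form of \<open>T\<close> is given by its coefficient vector, so
  that scaling it and perturbing it are operations on plain functions.\<close>

definition dderiv :: "nat \<Rightarrow> (nat \<Rightarrow> complex) \<Rightarrow> nat cpoly \<Rightarrow> nat cpoly" where
  "dderiv n a f = (\<Sum>j\<in>{0..n}. const_poly (a j) * partial j f)"

definition dot :: "nat \<Rightarrow> (nat \<Rightarrow> complex) \<Rightarrow> (nat \<Rightarrow> complex) \<Rightarrow> complex" where
  "dot n a u = (\<Sum>j\<in>{0..n}. a j * u j)"

definition lin_form :: "nat \<Rightarrow> (nat \<Rightarrow> complex) \<Rightarrow> nat cpoly" where
  "lin_form n u = (\<Sum>j\<in>{0..n}. const_poly (u j) * single (single j 1) 1)"

lemma lookup_dop: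
  "lookup (dderiv n a f) m = (\<Sum>j\<in>{0..n}. a j * (of_nat (Suc (lookup m j)) * lookup f (m + single j 1)))"
  by (simp add: dderiv_def lookup_sum lookup_const_poly_mult lookup_partial)

lemma dderiv_zero [simp]: "dderiv n a 0 = 0"
  by (intro poly_mapping_eqI) (simp add: lookup_dop)

lemma dderiv_add: "dderiv n a (f + g) = dderiv n a f + dderiv n a g"
  by (intro poly_mapping_eqI) (simp add: lookup_dop lookup_add ring_distribs sum.distrib)

lemma dderiv_diff: "dderiv n a (f - g) = dderiv n a f - dderiv n a g"
  by (intro poly_mapping_eqI) (simp add: lookup_dop lookup_minus right_diff_distrib sum_subtractf)

lemma dderiv_sum: "dderiv n a (\<Sum>i\<in>A. f i) = (\<Sum>i\<in>A. dderiv n a (f i))"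
  by (induction A rule: infinite_finite_induct) (simp_all add: dderiv_add)

lemma dderiv_const_mult: "dderiv n a (const_poly c * f) = const_poly c * dderiv n a f"
  by (intro poly_mapping_eqI)
    (simp add: lookup_dop lookup_const_poly_mult sum_distrib_left mult.left_commute)

lemma dderiv_diff_scale: "dderiv n (\<lambda>j. a j - c * b j) f = dderiv n a f - const_poly c * dderiv n b f"
  by (intro poly_mapping_eqI)
    (simp add: lookup_dop lookup_minus lookup_const_poly_mult sum_distrib_left left_diff_distrib sum_subtractf mult.assoc)

lemma dderiv_scale: "dderiv n (\<lambda>j. c * a j) f = const_poly c * dderiv n a f"
  by (intro poly_mapping_eqI)
    (simp add: lookup_dop lookup_const_poly_mult sum_distrib_left mult.assoc)

lemma partial_commute: "partial i (partial j f) = partial j (partial i f)"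
proof (intro poly_mapping_eqI)
  fix m
  show "lookup (partial i (partial j f)) m = lookup (partial j (partial i f)) m"
    by (cases "i = j") (simp_all add: lookup_partial lookup_add lookup_single ac_simps)
qed

lemma dderiv_eq_sum_partial: "dderiv n a (dderiv n b f) =
    (\<Sum>i\<in>{0..n}. \<Sum>j\<in>{0..n}. const_poly (a i) * const_poly (b j) * partial i (partial j f))"
  by (intro poly_mapping_eqI)
    (simp add: lookup_dop lookup_sum mult.assoc lookup_const_poly_mult lookup_partial sum_distrib_left ac_simps)

lemma dderiv_commute: "dderiv n a (dderiv n b f) = dderiv n b (dderiv n a f)"
  unfolding dderiv_eq_sum_partial by (subst sum.swap) (simp add: partial_commute mult_ac)

lemma partial_X_mult:
  "partial i (single (single j 1) 1 * p) = (if i = j then p else 0) + single (single j 1) 1 * partial i p"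
proof (intro poly_mapping_eqI)
  fix m
  let ?X = "single (single j 1) 1 :: nat cpoly"
  have A: "lookup (?X * q) (single j 1 + k) = lookup q k" for q k
    using lookup_single_mult_add[of "single j 1" 1 q k] by simp
  have B: "lookup (?X * q) k = 0" if "lookup k j = 0" for q k
    using that by (intro lookup_single_mult_notin) (auto simp: lookup_add)
  show "lookup (partial i (?X * p)) m = lookup ((if i = j then p else 0) + ?X * partial i p) m"
  proof (cases "lookup m j = 0")
    case True
    show ?thesis
    proof (cases "i = j")
      case True
      then show ?thesis using \<open>lookup m j = 0\<close> B[of m] A[of p m]
        by (simp add: lookup_partial lookup_add add.commute)
    next
      case False
      then have "lookup (m + single i 1) j = 0" using True by (simp add: lookup_add lookup_single)
      then show ?thesis using False True B[of _ p] B[of m "partial i p"]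
        by (simp add: lookup_partial lookup_add)
    qed
  next
    case False
    have e: "m = single j 1 + (m - single j 1)"
      using False by (intro poly_mapping_eqI) (auto simp: lookup_add lookup_minus lookup_single when_def)
    obtain k where k: "m = single j 1 + k" using e by blast
    have "lookup (partial i (?X * p)) m = of_nat (Suc (lookup m i)) * lookup (?X * p) (single j 1 + (k + single i 1))"
      by (simp add: lookup_partial k add.assoc)
    also have "\<dots> = of_nat (Suc (lookup m i)) * lookup p (k + single i 1)" by (simp only: A)
    finally have L: "lookup (partial i (?X * p)) m = of_nat (Suc (lookup m i)) * lookup p (k + single i 1)" .
    have R: "lookup (?X * partial i p) m = of_nat (Suc (lookup k i)) * lookup p (k + single i 1)"
      using A[of "partial i p" k] by (simp add: k lookup_partial)
    show ?thesis unfolding lookup_add L R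
      by (cases "i = j") (auto simp: k lookup_add lookup_single add.commute algebra_simps)
  qed
qed

lemma dderiv_X_mult:
  assumes "j \<le> n"
  shows "dderiv n a (single (single j 1) 1 * p) = const_poly (a j) * p + single (single j 1) 1 * dderiv n a p"
proof -
  have "dderiv n a (single (single j 1) 1 * p) =
    (\<Sum>i\<in>{0..n}. const_poly (a i) * (if i = j then p else 0)) + single (single j 1) 1 * dderiv n a p"
    unfolding dderiv_def partial_X_mult by (simp add: ring_distribs sum.distrib sum_distrib_left mult.left_commute)
  also have "(\<Sum>i\<in>{0..n}. const_poly (a i) * (if i = j then p else 0)) = const_poly (a j) * p"
    using assms by (simp add: if_distrib cong: if_cong)
  finally show ?thesis .
qed

lemma dderiv_lin_mult: "dderiv n a (lin_form n u * p) = const_poly (dot n a u) * p + lin_form n u * dderiv n a p"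
proof -
  have "dderiv n a (lin_form n u * p) = (\<Sum>j\<in>{0..n}. const_poly (u j) * dderiv n a (single (single j 1) 1 * p))"
    by (simp add: lin_form_def sum_distrib_right dderiv_sum mult.assoc dderiv_const_mult)
  also have "\<dots> = (\<Sum>j\<in>{0..n}. const_poly (u j) * (const_poly (a j) * p + single (single j 1) 1 * dderiv n a p))"
    by (intro sum.cong refl) (simp add: dderiv_X_mult[simplified])
  also have "\<dots> = const_poly (dot n a u) * p + lin_form n u * dderiv n a p"
    by (simp add: ring_distribs sum.distrib dot_def const_poly_sum const_poly_mult lin_form_def sum_distrib_left mult_ac)
  finally show ?thesis .
qed

lemma dderiv_lin_power_mult:
  "dderiv n a (lin_form n u ^ Suc k * p) =
    const_poly (of_nat (Suc k) * dot n a u) * (lin_form n u ^ k * p) + lin_form n u ^ Suc k * dderiv n a p"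
proof (induction k)
  case 0
  then show ?case by (simp add: dderiv_lin_mult)
next
  case (Suc k)
  have "dderiv n a (lin_form n u ^ Suc (Suc k) * p) = dderiv n a (lin_form n u * (lin_form n u ^ Suc k * p))"
    by (simp add: mult.assoc)
  also have "\<dots> = const_poly (dot n a u) * (lin_form n u ^ Suc k * p) +
      lin_form n u * (const_poly (of_nat (Suc k) * dot n a u) * (lin_form n u ^ k * p) + lin_form n u ^ Suc k * dderiv n a p)"
    by (simp only: dderiv_lin_mult Suc)
  also have "\<dots> = (const_poly (dot n a u) + const_poly (of_nat (Suc k) * dot n a u)) * (lin_form n u ^ Suc k * p)
      + lin_form n u ^ Suc (Suc k) * dderiv n a p"
    by (simp add: algebra_simps)
  also have "const_poly (dot n a u) + const_poly (of_nat (Suc k) * dot n a u) =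
      (const_poly (of_nat (Suc (Suc k)) * dot n a u) :: nat cpoly)"
    by (simp add: const_poly_add[symmetric] algebra_simps)
  finally show ?case .
qed

lemma forms_iff: "f \<in> forms V d \<longleftrightarrow> (\<forall>m. m \<notin> expos V d \<longrightarrow> lookup f m = 0)"
  by (auto simp: forms_def in_keys_iff)

lemma forms_zero [simp]: "0 \<in> forms V d"
  by (simp add: forms_iff)

lemma forms_add: "f \<in> forms V d \<Longrightarrow> g \<in> forms V d \<Longrightarrow> f + g \<in> forms V d"
  by (simp add: forms_iff lookup_add)

lemma forms_diff: "f \<in> forms V d \<Longrightarrow> g \<in> forms V d \<Longrightarrow> f - g \<in> forms V d"
  by (simp add: forms_iff lookup_minus)

lemma forms_sum: "(\<And>i. i \<in> A \<Longrightarrow> f i \<in> forms V d) \<Longrightarrow> (\<Sum>i\<in>A. f i) \<in> forms V d"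
  by (simp add: forms_iff lookup_sum)

lemma forms_const_mult: "f \<in> forms V d \<Longrightarrow> const_poly c * f \<in> forms V d"
  by (simp add: forms_iff lookup_const_poly_mult)

lemma expos_add_single_iff: "m + single j 1 \<in> expos V (Suc d) \<longleftrightarrow> m \<in> expos V d \<and> j \<in> V"
  by (auto simp: expos_def expo_deg_add keys_add_expo)

lemma dderiv_forms: "f \<in> S_deg n (Suc d) \<Longrightarrow> dderiv n a f \<in> S_deg n d"
  unfolding forms_iff lookup_dop by (auto simp: expos_add_single_iff[simplified] intro!: sum.neutral)

lemma dderiv_forms_0: "f \<in> S_deg n 0 \<Longrightarrow> dderiv n a f = 0"
proof (intro poly_mapping_eqI)
  fix m assume f: "f \<in> S_deg n 0"
  have "m + single j 1 \<notin> expos {0..n} 0" for j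
    by (auto simp: expos_def expo_deg_add)
  then show "lookup (dderiv n a f) m = lookup 0 m" using f by (simp add: lookup_dop forms_iff)
qed

lemma X_mult_forms:
  assumes "f \<in> forms V d" "j \<in> V" shows "single (single j 1) 1 * f \<in> forms V (Suc d)"
  unfolding forms_iff
proof (intro allI impI)
  fix m assume m: "m \<notin> expos V (Suc d)"
  show "lookup (single (single j 1) 1 * f) m = 0"
  proof (cases "\<exists>k. m = single j 1 + k")
    case True
    then obtain k where k: "m = single j 1 + k" by blast
    then have "k \<notin> expos V d" using m assms(2) expos_add_single_iff[of k j V d] by (simp add: add.commute)
    then show ?thesis using assms(1) unfolding k lookup_single_mult_add by (simp add: forms_iff)
  next
    case False
    then show ?thesis by (intro lookup_single_mult_notin) blast
  qed
qed

lemma lin_form_mult_forms: "f \<in> S_deg n d \<Longrightarrow> lin_form n u * f \<in> S_deg n (Suc d)"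
  unfolding lin_form_def sum_distrib_right mult.assoc
  by (intro forms_sum forms_const_mult X_mult_forms) auto

lemma lin_form_power_mult_forms: "f \<in> S_deg n d \<Longrightarrow> lin_form n u ^ k * f \<in> S_deg n (k + d)"
  by (induction k) (auto simp: mult.assoc intro: lin_form_mult_forms)

lemma dderiv_power_forms: "f \<in> S_deg n (k + d) \<Longrightarrow> (dderiv n a ^^ k) f \<in> S_deg n d"
  by (induction k arbitrary: d) (auto intro: dderiv_forms)

lemma dderiv_power_forms_0:
  assumes "f \<in> S_deg n d" shows "(dderiv n a ^^ Suc d) f = 0"
  using dderiv_power_forms[of f n d 0 a] assms by (auto intro: dderiv_forms_0)

lemma dderiv_power_commute: "dderiv n b ((dderiv n a ^^ k) f) = (dderiv n a ^^ k) (dderiv n b f)"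
  by (induction k) (simp_all add: dderiv_commute[of n b])

lemma dderiv_power_zero [simp]: "(dderiv n a ^^ k) 0 = 0"
  by (induction k) simp_all

text \<open>The last clause is the point: the preimage is built from powers of the linear form of
  \<open>u\<close> and derivatives of \<open>g\<close>, all killed by \<open>D_b\<close> when b is
  orthogonal to \<open>u\<close> and \<open>D_b g = 0\<close>. Thus lifting through one operator
  stays inside the kernel of another.\<close>

lemma dderiv_surjective:
  assumes u: "dot n a u = 1" and g: "g \<in> S_deg n d"
  shows "\<exists>h\<in>S_deg n (Suc d). dderiv n a h = g \<and> (\<forall>b. dot n b u = 0 \<longrightarrow> dderiv n b g = 0 \<longrightarrow> dderiv n b h = 0)"
proof -
  let ?A = "\<lambda>k. (dderiv n a ^^ k) g"
  define T where "T k = const_poly ((-1) ^ k / fact k) * (lin_form n u ^ k * ?A k)" for k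
  \<comment> \<open>integration by parts along \<open>u\<close>; \<open>D\<^sub>a h\<close> telescopes to \<open>g\<close>\<close>
  define h where "h = (\<Sum>k<Suc d. const_poly ((-1) ^ k / fact (Suc k)) * (lin_form n u ^ Suc k * ?A k))"
  have "h \<in> S_deg n (Suc d)"
    unfolding h_def
  proof (intro forms_sum forms_const_mult)
    fix k assume "k \<in> {..<Suc d}"
    then have "?A k \<in> S_deg n (d - k)" using g by (intro dderiv_power_forms) auto
    then show "lin_form n u ^ Suc k * ?A k \<in> S_deg n (Suc d)"
      using lin_form_power_mult_forms[of "?A k" n "d - k" u "Suc k"] \<open>k \<in> {..<Suc d}\<close> by simp
  qed
  moreover have "dderiv n a h = g"
  proof -
    have "dderiv n a h = (\<Sum>k<Suc d. T k - T (Suc k))"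
      unfolding h_def dderiv_sum
    proof (intro sum.cong refl)
      fix k
      have "dderiv n a (const_poly ((-1) ^ k / fact (Suc k)) * (lin_form n u ^ Suc k * ?A k)) =
        const_poly ((-1) ^ k / fact (Suc k)) * const_poly (of_nat (Suc k)) * (lin_form n u ^ k * ?A k) +
        const_poly ((-1) ^ k / fact (Suc k)) * (lin_form n u ^ Suc k * ?A (Suc k))"
        unfolding dderiv_const_mult dderiv_lin_power_mult u by (simp add: ring_distribs mult.assoc)
      also have "const_poly ((-1) ^ k / fact (Suc k)) * const_poly (of_nat (Suc k)) =
          (const_poly ((-1) ^ k / fact k) :: nat cpoly)"
        unfolding const_poly_mult[symmetric] by (simp add: field_simps del: of_nat_Suc)
      also have "const_poly ((-1) ^ k / fact (Suc k)) * (lin_form n u ^ Suc k * ?A (Suc k)) = - T (Suc k)"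
        unfolding T_def by (intro poly_mapping_eqI) (simp add: lookup_const_poly_mult)
      finally show "dderiv n a (const_poly ((-1) ^ k / fact (Suc k)) * (lin_form n u ^ Suc k * ?A k)) = T k - T (Suc k)"
        by (simp add: T_def)
    qed
    also have "\<dots> = T 0 - T (Suc d)" by (rule sum_lessThan_telescope')
    also have "\<dots> = g" using dderiv_power_forms_0[OF g, of a] by (simp add: T_def)
    finally show ?thesis .
  qed
  moreover have "dderiv n b h = 0" if "dot n b u = 0" "dderiv n b g = 0" for b
    unfolding h_def dderiv_sum dderiv_const_mult dderiv_lin_power_mult
    using that by (simp add: dderiv_power_commute)
  ultimately show ?thesis by blast
qed

lemma dderiv_foldr_commute:
  "dderiv n b (foldr (\<lambda>j. dderiv n (a j)) js f) = foldr (\<lambda>j. dderiv n (a j)) js (dderiv n b f)"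
  by (induction js) (simp_all add: dderiv_commute[of n b])

lemma dderiv_foldr_diff: "foldr (\<lambda>j. dderiv n (a j)) js (f - g) =
    foldr (\<lambda>j. dderiv n (a j)) js f - foldr (\<lambda>j. dderiv n (a j)) js g"
  by (induction js) (simp_all add: dderiv_diff)

lemma dderiv_foldr_sum: "foldr (\<lambda>j. dderiv n (a j)) js (\<Sum>i\<in>A. f i) =
    (\<Sum>i\<in>A. foldr (\<lambda>j. dderiv n (a j)) js (f i))"
  by (induction js) (simp_all add: dderiv_sum)

lemma dderiv_foldr_const_mult: "foldr (\<lambda>j. dderiv n (a j)) js (const_poly c * f) =
    const_poly c * foldr (\<lambda>j. dderiv n (a j)) js f"
  by (induction js) (simp_all add: dderiv_const_mult)

lemma dderiv_foldr_forms: "f \<in> S_deg n (length js + d) \<Longrightarrow> foldr (\<lambda>j. dderiv n (a j)) js f \<in> S_deg n d"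
  by (induction js arbitrary: d) (auto intro: dderiv_forms)

lemma dderiv_foldr_remove1:
  "j \<in> set js \<Longrightarrow> foldr (\<lambda>j. dderiv n (a j)) js f = foldr (\<lambda>j. dderiv n (a j)) (remove1 j js) (dderiv n (a j) f)"
  by (induction js) (auto simp: dderiv_foldr_commute[symmetric] dderiv_commute)

text \<open>\<open>D_a h\<close> for the head of the list is split by induction; each part is lifted
  through this operator within the kernel of its own one, and what remains of \<open>h\<close> is
  killed by the head. Non-proportionality appears as a vector \<open>u\<close> on which one form is
  \<open>1\<close> and the other \<open>0\<close>.\<close>

lemma kernel_of_product:
  assumes "distinct js"
    and "\<And>i j. i \<in> set js \<Longrightarrow> j \<in> set js \<Longrightarrow> i \<noteq> j \<Longrightarrow> \<exists>u. dot n (a j) u = 1 \<and> dot n (a i) u = 0"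
    and "h \<in> S_deg n d" "foldr (\<lambda>j. dderiv n (a j)) js h = 0"
  shows "\<exists>g. (\<forall>i\<in>set js. g i \<in> S_deg n d \<and> dderiv n (a i) (g i) = 0) \<and> h = (\<Sum>i\<in>set js. g i)"
  using assms
proof (induction js arbitrary: h d)
  case Nil
  then show ?case by simp
next
  case (Cons j js)
  show ?case
  proof (cases d)
    case 0
    \<comment> \<open>Derivatives of constants vanish, so one slot can carry all of
      \<open>h\<close>.\<close>
    have "h = (\<Sum>i\<in>set (j # js). if i = j then h else 0)" by simp
    then show ?thesis using Cons.prems(3) 0
      by (intro exI[of _ "\<lambda>i. if i = j then h else 0"]) (auto simp: dderiv_forms_0)
  next
    case (Suc d')
    let ?h = "dderiv n (a j) h"
    have "?h \<in> S_deg n d'" using Cons.prems(3) Suc by (auto intro: dderiv_forms)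
    moreover have "foldr (\<lambda>j. dderiv n (a j)) js ?h = 0" using Cons.prems(4) by (simp add: dderiv_foldr_commute)
    ultimately obtain g where g: "\<forall>i\<in>set js. g i \<in> S_deg n d' \<and> dderiv n (a i) (g i) = 0" "?h = (\<Sum>i\<in>set js. g i)"
      using Cons.IH[of ?h d'] Cons.prems(1,2) by auto
    have "\<exists>f\<in>S_deg n d. dderiv n (a j) f = g i \<and> dderiv n (a i) f = 0" if i: "i \<in> set js" for i
    proof -
      have "i \<noteq> j" using i Cons.prems(1) by auto
      then obtain u where "dot n (a j) u = 1" "dot n (a i) u = 0" using Cons.prems(2)[of i j] i by auto
      then show ?thesis using dderiv_surjective[of n "a j" u "g i" d'] g(1) i Suc by blast
    qed
    then obtain f where f: "\<And>i. i \<in> set js \<Longrightarrow> f i \<in> S_deg n d \<and> dderiv n (a j) (f i) = g i \<and> dderiv n (a i) (f i) = 0"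
      by metis
    let ?f = "f(j := h - (\<Sum>i\<in>set js. f i))"
    have "dderiv n (a j) (h - (\<Sum>i\<in>set js. f i)) = 0"
      using f g(2) by (simp add: dderiv_diff dderiv_sum)
    moreover have "h - (\<Sum>i\<in>set js. f i) \<in> S_deg n d"
      using Cons.prems(3) f by (intro forms_diff forms_sum) auto
    moreover have "(\<Sum>i\<in>set (j # js). ?f i) = h"
    proof -
      have "(\<Sum>i\<in>set js. ?f i) = (\<Sum>i\<in>set js. f i)" using Cons.prems(1) by (intro sum.cong) auto
      then show ?thesis using Cons.prems(1) by simp
    qed
    ultimately show ?thesis using f by (intro exI[of _ ?f]) auto
  qed
qed

text \<open>This is \<open>\<ell>\<^sup>e / e!\<close> for the linear form \<open>\<ell>\<close> with coefficient vector \<open>x\<close>.\<close>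

definition power_form :: "nat \<Rightarrow> nat \<Rightarrow> (nat \<Rightarrow> complex) \<Rightarrow> nat cpoly" where
  "power_form n e x = (\<Sum>m\<in>expos {0..n} e. single m (\<Prod>i\<in>{0..n}. x i ^ lookup m i / fact (lookup m i)))"

lemma lookup_gform: "lookup (power_form n e x) m =
    (if m \<in> expos {0..n} e then \<Prod>i\<in>{0..n}. x i ^ lookup m i / fact (lookup m i) else 0)"
  by (simp add: power_form_def lookup_sum lookup_single when_def finite_expos)

lemma power_form_forms: "power_form n e x \<in> S_deg n e"
  by (simp add: forms_iff lookup_gform)

text \<open>Division by the factorial absorbs the factor \<open>Suc e\<close> of the usual power
  rule, so iterated derivatives carry only the values of the linear forms at
  \<open>x\<close>.\<close>

lemma dderiv_gform: "dderiv n a (power_form n (Suc e) x) = const_poly (dot n a x) * power_form n e x"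
proof (intro poly_mapping_eqI)
  fix m
  let ?c = "\<lambda>m. \<Prod>i\<in>{0..n}. x i ^ lookup m i / fact (lookup m i)"
  have c: "of_nat (Suc (lookup m j)) * ?c (m + single j 1) = x j * ?c m" if "j \<in> {0..n}" for j
  proof -
    have "?c (m + single j 1) = x j ^ Suc (lookup m j) / fact (Suc (lookup m j)) *
        (\<Prod>i\<in>{0..n} - {j}. x i ^ lookup m i / fact (lookup m i))"
      using that by (subst prod.remove[of _ j]) (auto simp: lookup_add lookup_single when_def intro!: prod.cong)
    moreover have "?c m = x j ^ lookup m j / fact (lookup m j) *
        (\<Prod>i\<in>{0..n} - {j}. x i ^ lookup m i / fact (lookup m i))"
      using that by (subst prod.remove[of _ j]) auto
    moreover have "of_nat (Suc k) * (y ^ Suc k / fact (Suc k) * r) = y * (y ^ k / fact k * r)"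
      for k and y r :: complex
      by (simp add: field_simps del: of_nat_Suc)
    ultimately show ?thesis by (simp only:)
  qed
  show "lookup (dderiv n a (power_form n (Suc e) x)) m = lookup (const_poly (dot n a x) * power_form n e x) m"
  proof (cases "m \<in> expos {0..n} e")
    case True
    then have "lookup (dderiv n a (power_form n (Suc e) x)) m = (\<Sum>j\<in>{0..n}. a j * (x j * ?c m))"
      unfolding lookup_dop lookup_gform
      by (intro sum.cong refl) (simp only: expos_add_single_iff c simp_thms if_True)
    then show ?thesis using True
      by (simp add: lookup_const_poly_mult lookup_gform dot_def sum_distrib_right mult.assoc)
  next
    case False
    then show ?thesis
      by (simp add: lookup_dop lookup_const_poly_mult lookup_gform expos_add_single_iff[simplified])
  qed
qed

lemma dderiv_foldr_gform:
  "foldr (\<lambda>j. dderiv n (a j)) js (power_form n (length js + e) x) =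
    const_poly (\<Prod>j\<leftarrow>js. dot n (a j) x) * power_form n e x"
proof (induction js arbitrary: e)
  case (Cons j js)
  have "foldr (\<lambda>j. dderiv n (a j)) js (power_form n (length (j # js) + e) x) =
      const_poly (\<Prod>j\<leftarrow>js. dot n (a j) x) * power_form n (Suc e) x"
    using Cons[of "Suc e"] by simp
  then show ?case by (simp add: dderiv_const_mult dderiv_gform const_poly_mult mult.assoc mult.left_commute)
qed simp

section \<open>Codimension one forms as kernels of directional derivatives\<close>

lemma expos_1: "expos V 1 = (\<lambda>j. single j 1) ` V"
proof
  show "expos V 1 \<subseteq> (\<lambda>j. single j 1) ` V"
  proof
    fix m assume m: "m \<in> expos V 1"
    then have "m \<noteq> 0" by (auto simp: expos_def)
    then obtain j where j: "j \<in> keys m" by (metis all_not_in_conv keys_eq_empty)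
    then have "m = (m - single j 1) + single j 1"
      by (intro poly_mapping_eqI) (auto simp: lookup_add lookup_minus lookup_single when_def in_keys_iff)
    moreover from this have "expo_deg (m - single j 1) = 0"
      using m expo_deg_add[of "m - single j 1" "single j 1"] by (simp add: expos_def)
    ultimately have "m = single j 1" by (simp add: expo_deg_eq_0_iff)
    then show "m \<in> (\<lambda>j. single j 1) ` V" using m j by (auto simp: expos_def)
  qed
qed (auto simp: expos_def)

lemma single_1_eq_iff: "(single i 1 :: 'v \<Rightarrow>\<^sub>0 nat) = single j 1 \<longleftrightarrow> i = j"
  by (metis lookup_single_eq lookup_single_not_eq zero_neq_one)

lemma monom_act_single: "monom_act (single j 1) f = partial j f"
  by (simp add: monom_act_def)

lemma diff_act_linear:
  assumes "D \<in> T_deg n 1" shows "diff_act D f = dderiv n (\<lambda>j. lookup D (single j 1)) f"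
proof -
  have "diff_act D f = (\<Sum>m\<in>expos {0..n} 1. const_poly (lookup D m) * monom_act m f)"
    unfolding diff_act_def
    by (intro sum.mono_neutral_left) (use assms in \<open>auto simp: forms_def in_keys_iff finite_expos\<close>)
  also have "\<dots> = (\<Sum>j\<in>{0..n}. const_poly (lookup D (single j 1)) * partial j f)"
    unfolding expos_1 by (subst sum.reindex) (auto simp: inj_on_def single_1_eq_iff[simplified] monom_act_single[simplified])
  finally show ?thesis by (simp add: dderiv_def)
qed

text \<open>Since \<open>0\<close> always lies in \<open>perp_deg\<close>, differing from
  \<open>{0}\<close> means containing a nonzero operator; its coefficients at the variables form the
  vector \<open>a\<close>, and \<open>lin_form\<close> gives the way back.\<close>

lemma codim_one_form_iff:
  "codim_one_form n d g \<longleftrightarrow> g \<in> S_deg n d \<and> (\<exists>a. (\<exists>j\<le>n. a j \<noteq> 0) \<and> dderiv n a g = 0)"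
proof -
  have sub: "D \<in> T_ring n" if "D \<in> T_deg n 1" for D
    using that by (auto simp: forms_def polys_def expos_def)
  have zero: "0 \<in> perp_deg n g 1" by (simp add: perp_deg_def perp_def polys_def diff_act_def)
  show ?thesis
  proof
    assume c: "codim_one_form n d g"
    then obtain D where D: "D \<in> perp_deg n g 1" "D \<noteq> 0" using zero by (auto simp: codim_one_form_def)
    then have T: "D \<in> T_deg n 1" "diff_act D g = 0" by (auto simp: perp_deg_def perp_def)
    obtain m where m: "lookup D m \<noteq> 0" using D(2) by (metis lookup_zero poly_mapping_eqI)
    then have "m \<in> expos {0..n} 1" using T(1) by (auto simp: forms_iff)
    then obtain j where "j \<le> n" "m = single j 1" unfolding expos_1 by auto
    then show "g \<in> S_deg n d \<and> (\<exists>a. (\<exists>j\<le>n. a j \<noteq> 0) \<and> dderiv n a g = 0)"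
      using c m T diff_act_linear[OF T(1), of g] by (auto simp: codim_one_form_def)
  next
    assume r: "g \<in> S_deg n d \<and> (\<exists>a. (\<exists>j\<le>n. a j \<noteq> 0) \<and> dderiv n a g = 0)"
    then obtain a j where a: "j \<le> n" "a j \<noteq> 0" "dderiv n a g = 0" by blast
    define D :: "nat cpoly" where "D = lin_form n a"
    have l: "lookup D (single i 1) = a i" if "i \<le> n" for i
    proof -
      show ?thesis using that
        by (simp add: D_def lin_form_def lookup_sum lookup_const_poly_mult lookup_single when_def single_1_eq_iff[simplified] if_distrib cong: if_cong)
    qed
    have "single (single i 1) 1 \<in> forms {0..n} 1" if "i \<le> n" for i
      using that by (auto simp: forms_def expos_def)
    then have T: "D \<in> T_deg n 1" unfolding D_def lin_form_def
      by (intro forms_sum forms_const_mult) auto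
    have "diff_act D g = dderiv n (\<lambda>j. lookup D (single j 1)) g" by (rule diff_act_linear[OF T])
    also have "\<dots> = dderiv n a g" unfolding dderiv_def by (intro sum.cong refl) (use l in auto)
    finally have "D \<in> perp_deg n g 1" using a(3) T sub[OF T] by (simp add: perp_deg_def perp_def)
    moreover have "D \<noteq> 0" using l[OF a(1)] a(2) by auto
    ultimately show "codim_one_form n d g" using r by (auto simp: codim_one_form_def)
  qed
qed

section \<open>Few summands are special\<close>

lemma polyfun_cong:
  assumes "P \<in> polyfun V" "\<And>v. v \<in> V \<Longrightarrow> x v = y v" shows "P x = P y"
  using assms by induction simp_all

text \<open>
  If \<open>a\<^sub>c = 1\<close>, then \<open>f\<close> is determined by \<open>D\<^sub>a f\<close> and its coefficients at the monomials free of \<open>X\<^sub>c\<close>: the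
  coefficient at \<open>X\<^sub>c\<^sup>r\<^sup>+\<^sup>1 \<mu>\<close> is found recursively from that of \<open>D\<^sub>a f\<close> at \<open>X\<^sub>c\<^sup>r \<mu>\<close>.
\<close>

lemma kernel_parametrization:
  assumes "\<forall>j\<in>set js. c j \<le> n" "length js \<le> d"
  shows "\<exists>k \<phi>. k + card (expos {0..n} (d - length js)) = n * length js + card (expos {0..n} d) \<and>
    (\<forall>m. (\<lambda>x. \<phi> x m) \<in> polyfun {..<k}) \<and>
    (\<forall>f a. f \<in> S_deg n d \<longrightarrow> (\<forall>j\<in>set js. a j (c j) = 1) \<longrightarrow>
       foldr (\<lambda>j. dderiv n (a j)) js f = 0 \<longrightarrow> (\<exists>x. \<phi> x = lookup f))"
  using assms
proof (induction js arbitrary: d)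
  case Nil
  then show ?case
    by (intro exI[of _ 0] exI[of _ "\<lambda>x m. 0"]) (auto intro: polyfun.const)
next
  case (Cons j js)
  obtain d' where d: "d = Suc d'" using Cons.prems(2) by (cases d) auto
  define C where "C = c j"
  have C: "C \<le> n" using Cons.prems(1) by (simp add: C_def)
  let ?V = "{0..n}" and ?W = "{0..n} - {C}"
  have VW: "?V = insert C ?W" using C by auto
  have "length js \<le> d'" "\<forall>j\<in>set js. c j \<le> n" using Cons.prems d by auto
  from Cons.IH[OF this(2,1)] obtain k' \<phi>' where
    IH: "k' + card (expos ?V (d' - length js)) = n * length js + card (expos ?V d') \<and>
    (\<forall>m. (\<lambda>x. \<phi>' x m) \<in> polyfun {..<k'}) \<and>
    (\<forall>f a. f \<in> S_deg n d' \<longrightarrow> (\<forall>j\<in>set js. a j (c j) = 1) \<longrightarrow>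
       foldr (\<lambda>j. dderiv n (a j)) js f = 0 \<longrightarrow> (\<exists>x. \<phi>' x = lookup f))" by (elim exE)
  note k' = IH[THEN conjunct1] and pf = IH[THEN conjunct2, THEN conjunct1, rule_format]
    and sol = IH[THEN conjunct2, THEN conjunct2, rule_format]
  define E where "E = expos ?W d"
  have E: "finite E" by (simp add: E_def finite_expos)
  have cardV: "card (expos ?V d) = card (expos ?V d') + card E"
    using card_expos_insert[of ?W C d'] unfolding VW[symmetric] by (simp add: E_def d)
  \<comment> \<open>The parameters are \<open>k'\<close> for the derivative of \<open>f\<close>,
    \<open>n\<close> for the entries of the linear form other than the one normalized to
    \<open>1\<close>, and one for each monomial free of \<open>X_C\<close>.\<close>
  define k where "k = k' + n + card E"
  have cW: "card ?W = n" using C by simp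
  obtain u where u: "bij_betw u ?W {..<n}"
    using ex_bij_betw_finite_nat[of ?W] cW by (auto simp: atLeast0LessThan)
  obtain w where w: "bij_betw w E {..<card E}"
    using ex_bij_betw_finite_nat[OF E] by (auto simp: atLeast0LessThan)
  \<comment> \<open>\<open>x\<close> encodes the pair of linear form and form; the polynomials found
    next must return the coefficients of \<open>f\<close> on every such encoding.\<close>
  define comp where "comp x a f \<longleftrightarrow> f \<in> S_deg n d \<and> \<phi>' x = lookup (dderiv n a f) \<and> a C = 1 \<and>
    (\<forall>j\<in>?W. x (k' + u j) = a j) \<and> (\<forall>m\<in>E. x (k' + n + w m) = lookup f m)" for x a f
  have ex: "\<exists>P\<in>polyfun {..<k}. \<forall>x a f. comp x a f \<longrightarrow> P x = lookup f m" for m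
  proof (induction "lookup m C" arbitrary: m)
    case 0
    show ?case
    proof (cases "m \<in> expos ?V d")
      case True
      then have m: "m \<in> E" using 0 by (auto simp: E_def expos_def in_keys_iff)
      have "k' + n + w m < k" using bij_betwE[OF w] m by (simp add: k_def)
      then show ?thesis using m by (intro bexI[of _ "\<lambda>x. x (k' + n + w m)"] polyfun.var) (auto simp: comp_def)
    next
      case False
      then show ?thesis by (intro bexI[of _ "\<lambda>x. 0"] polyfun.const) (auto simp: comp_def forms_iff)
    qed
  next
    case (Suc r)
    define \<mu> where "\<mu> = m - single C 1"
    have m: "m = \<mu> + single C 1"
      unfolding \<mu>_def using Suc(2)
      by (intro poly_mapping_eqI) (auto simp: lookup_add lookup_minus lookup_single when_def)
    have r: "lookup \<mu> C = r" using Suc(2) by (simp add: m lookup_add)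
    have "\<exists>P\<in>polyfun {..<k}. \<forall>x a f. comp x a f \<longrightarrow> P x = lookup f (\<mu> + single i 1)" if "i \<in> ?W" for i
      by (rule Suc(1)) (use that r in \<open>auto simp: lookup_add lookup_single\<close>)
    then obtain P where P: "\<And>i. i \<in> ?W \<Longrightarrow> P i \<in> polyfun {..<k}"
      "\<And>i x a f. i \<in> ?W \<Longrightarrow> comp x a f \<Longrightarrow> P i x = lookup f (\<mu> + single i 1)" by metis
    \<comment> \<open>The coefficient of the derivative at \<mu>, solved for the coefficient of
      \<open>f\<close> at \<open>m\<close>. The other terms have exponent \<open>r\<close> in
      \<open>X_C\<close>, so they are known by induction.\<close>
    define R where "R x = (\<phi>' x \<mu> - (\<Sum>i\<in>?W. x (k' + u i) * (of_nat (Suc (lookup \<mu> i)) * P i x))) *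
        inverse (of_nat (Suc r))" for x
    have uk: "k' + u i < k" if "i \<in> ?W" for i using bij_betwE[OF u, rule_format, OF that] by (simp add: k_def)
    have "(\<lambda>x. \<phi>' x \<mu>) \<in> polyfun {..<k}" using pf by (rule polyfun_mono) (auto simp: k_def)
    then have "R \<in> polyfun {..<k}"
      unfolding R_def
      by (intro polyfun.mult polyfun.const polyfun_diff polyfun_sum polyfun.var P(1)) (use uk in auto)
    moreover have "R x = lookup f m" if c: "comp x a f" for x a f
    proof -
      have "\<phi>' x \<mu> = (\<Sum>i\<in>?V. a i * (of_nat (Suc (lookup \<mu> i)) * lookup f (\<mu> + single i 1)))"
        using c by (simp add: comp_def lookup_dop)
      also have "\<dots> = a C * (of_nat (Suc r) * lookup f m) +
          (\<Sum>i\<in>?W. a i * (of_nat (Suc (lookup \<mu> i)) * lookup f (\<mu> + single i 1)))"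
        using C by (subst sum.remove[of _ C]) (simp_all only: r m finite_atLeastAtMost atLeastAtMost_iff le0 simp_thms)
      also have "(\<Sum>i\<in>?W. a i * (of_nat (Suc (lookup \<mu> i)) * lookup f (\<mu> + single i 1))) =
          (\<Sum>i\<in>?W. x (k' + u i) * (of_nat (Suc (lookup \<mu> i)) * P i x))"
        using c P(2)[OF _ c] by (intro sum.cong refl) (auto simp: comp_def)
      finally show ?thesis using c unfolding R_def comp_def by (simp add: field_simps del: of_nat_Suc)
    qed
    ultimately show ?case by blast
  qed
  have "\<exists>\<phi>. \<forall>m. \<phi> m \<in> polyfun {..<k} \<and> (\<forall>x a f. comp x a f \<longrightarrow> \<phi> m x = lookup f m)"
    using ex by (intro choice) blast
  then obtain \<phi> where \<phi>: "\<And>m. \<phi> m \<in> polyfun {..<k}" "\<And>m x a f. comp x a f \<Longrightarrow> \<phi> m x = lookup f m"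
    by blast
  show ?case
  proof (intro exI[of _ k] exI[of _ "\<lambda>x m. \<phi> m x"] conjI allI impI)
    show "k + card (expos ?V (d - length (j # js))) = n * length (j # js) + card (expos ?V d)"
      using k' cardV by (simp add: k_def d)
    show "(\<lambda>x. \<phi> m x) \<in> polyfun {..<k}" for m by (rule \<phi>(1))
    fix f a
    assume f: "f \<in> S_deg n d" and a: "\<forall>j\<in>set (j # js). a j (c j) = 1"
      and z: "foldr (\<lambda>j. dderiv n (a j)) (j # js) f = 0"
    let ?f = "dderiv n (a j) f"
    have "?f \<in> S_deg n d'" using f d by (auto intro: dderiv_forms)
    moreover have "foldr (\<lambda>j. dderiv n (a j)) js ?f = 0" using z by (simp add: dderiv_foldr_commute)
    ultimately obtain x' where x': "\<phi>' x' = lookup ?f" using sol[of ?f a] a by (meson list.set_intros(2))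
    define x where "x i = (if i < k' then x' i else if i < k' + n then a j (inv_into ?W u (i - k'))
        else lookup f (inv_into E w (i - k' - n)))" for i
    have "\<phi>' x = \<phi>' x'"
    proof
      fix m show "\<phi>' x m = \<phi>' x' m" using polyfun_cong[OF pf, of x x' m] by (simp add: x_def)
    qed
    moreover have "x (k' + u i) = a j i" if "i \<in> ?W" for i
    proof -
      have "u i < n" using bij_betwE[OF u] that by auto
      moreover have "inv_into ?W u (u i) = i" using u that by (intro inv_into_f_f) (auto simp: bij_betw_def)
      ultimately show ?thesis by (simp add: x_def)
    qed
    moreover have "x (k' + n + w m) = lookup f m" if "m \<in> E" for m
    proof -
      have "inv_into E w (w m) = m" using w that by (intro inv_into_f_f) (auto simp: bij_betw_def)
      then show ?thesis by (simp add: x_def)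
    qed
    ultimately have "comp x (a j) f" using f x' a by (simp add: comp_def C_def)
    then show "\<exists>x. (\<lambda>m. \<phi> m x) = lookup f" using \<phi>(2) by blast
  qed
qed

definition decomposable :: "nat \<Rightarrow> nat \<Rightarrow> nat \<Rightarrow> nat cpoly \<Rightarrow> bool" where
  "decomposable n d s f \<longleftrightarrow> (\<exists>g. codim_one_decomposition n d f s g)"

text \<open>Each linear form is divided by a nonzero coordinate \<open>c j\<close>, which places it
  in an affine chart. The operators commute, so the one killing a summand can be applied
  first.\<close>

lemma decomposable_annihilated:
  assumes "decomposable n d s f"
  shows "f \<in> S_deg n d \<and> (\<exists>a c. (\<forall>j\<in>set [1..<Suc s]. c j \<le> n \<and> a j (c j) = 1) \<and>
    foldr (\<lambda>j. dderiv n (a j)) [1..<Suc s] f = 0)"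
proof -
  obtain g where g: "\<And>i. i \<in> {1..s} \<Longrightarrow> codim_one_form n d (g i)" "f = (\<Sum>i=1..s. g i)"
    using assms unfolding decomposable_def codim_one_decomposition_def by blast
  have "\<exists>b k. k \<le> n \<and> b k = 1 \<and> dderiv n b (g i) = 0" if "i \<in> {1..s}" for i
  proof -
    obtain b k where b: "k \<le> n" "b k \<noteq> 0" "dderiv n b (g i) = 0"
      using g(1)[OF \<open>i \<in> {1..s}\<close>] unfolding codim_one_form_iff by blast
    have "dderiv n (\<lambda>j. inverse (b k) * b j) (g i) = 0" using b(3) by (simp add: dderiv_scale)
    then show ?thesis using b by (intro exI[of _ "\<lambda>j. inverse (b k) * b j"] exI[of _ k]) simp
  qed
  then obtain a c where ac: "\<And>i. i \<in> {1..s} \<Longrightarrow> c i \<le> n \<and> a i (c i) = 1 \<and> dderiv n (a i) (g i) = 0" by metis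
  have mem: "i \<in> set [1..<Suc s] \<longleftrightarrow> i \<in> {1..s}" for i by auto
  have "foldr (\<lambda>j. dderiv n (a j)) [1..<Suc s] (g i) = 0" if "i \<in> {1..s}" for i
  proof -
    have "foldr (\<lambda>j. dderiv n (a j)) js (0 :: nat cpoly) = 0" for js by (induction js) simp_all
    then show ?thesis using that ac[OF that] by (subst dderiv_foldr_remove1[of i]) (auto simp del: upt_Suc)
  qed
  then have "foldr (\<lambda>j. dderiv n (a j)) [1..<Suc s] f = 0" unfolding g(2) dderiv_foldr_sum by simp
  moreover have "f \<in> S_deg n d" unfolding g(2) using g(1) by (intro forms_sum) (auto simp: codim_one_form_iff)
  ultimately show ?thesis using ac unfolding Ball_def mem by (intro conjI exI[of _ a] exI[of _ c]) (blast | assumption)+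
qed

lemma affine_UNIV: "affine_set UNIV"
  by (simp add: affine_set_def)

lemma polyfun_prod_nonzero:
  assumes "finite A" "\<And>i. i \<in> A \<Longrightarrow> Q i \<in> polyfun V \<and> (\<exists>y. Q i y \<noteq> 0)"
  shows "\<exists>y. (\<Prod>i\<in>A. Q i y) \<noteq> 0"
  using assms
proof (induction A rule: finite_induct)
  case (insert i A)
  then obtain y z where y: "Q i y \<noteq> 0" "(\<Prod>i\<in>A. Q i z) \<noteq> 0" by blast
  have "Q i \<in> polyfun UNIV" "(\<lambda>y. \<Prod>i\<in>A. Q i y) \<in> polyfun UNIV"
    using insert.prems by (auto intro!: polyfun_mono[OF _ subset_UNIV] polyfun_prod)
  then show ?case
    using polyfun_common_nonzero[of UNIV "Q i" y "\<lambda>y. \<Prod>i\<in>A. Q i y" z] y affine_UNIV insert.hyps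
    by auto
qed simp

text \<open>A relation is found separately for each choice \<open>c\<close> of charts; as there are
  finitely many, their product vanishes on every decomposable form.\<close>

lemma few_summands_special:
  assumes "s \<le> d" "n * s < card (expos {0..n} (d - s))"
  shows "\<exists>Q\<in>polyfun (expos {0..n} d). (\<exists>y. Q y \<noteq> 0) \<and> (\<forall>f. decomposable n d s f \<longrightarrow> Q (lookup f) = 0)"
proof -
  let ?js = "[1..<Suc s]" and ?Y = "expos {0..n} d"
  define A where "A = PiE (set ?js) (\<lambda>_. {0..n})"
  define good where "good c Q \<longleftrightarrow> Q \<in> polyfun ?Y \<and> (\<exists>y. Q y \<noteq> 0) \<and>
    (\<forall>f a. f \<in> S_deg n d \<longrightarrow> (\<forall>j\<in>set ?js. a j (c j) = 1) \<longrightarrow>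
       foldr (\<lambda>j. dderiv n (a j)) ?js f = 0 \<longrightarrow> Q (lookup f) = 0)"
    for c :: "nat \<Rightarrow> nat" and Q :: "((nat \<Rightarrow>\<^sub>0 nat) \<Rightarrow> complex) \<Rightarrow> complex"
  have "\<forall>c\<in>A. \<exists>Q. good c Q"
  proof
    fix c assume "c \<in> A"
    have cn: "\<forall>j\<in>set ?js. c j \<le> n" using \<open>c \<in> A\<close> unfolding A_def by (auto simp del: upt_Suc set_upt dest: PiE_mem)
    have "length ?js \<le> d" using assms(1) by simp
    from kernel_parametrization[OF cn this] obtain k \<phi> where
      K: "k + card (expos {0..n} (d - length ?js)) = n * length ?js + card ?Y \<and>
      (\<forall>m. (\<lambda>x. \<phi> x m) \<in> polyfun {..<k}) \<and>
      (\<forall>f a. f \<in> S_deg n d \<longrightarrow> (\<forall>j\<in>set ?js. a j (c j) = 1) \<longrightarrow>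
       foldr (\<lambda>j. dderiv n (a j)) ?js f = 0 \<longrightarrow> (\<exists>x. \<phi> x = lookup f))"
      by (elim exE)
    note k = K[THEN conjunct1] and \<phi> = K[THEN conjunct2, THEN conjunct1, rule_format]
      and sol = K[THEN conjunct2, THEN conjunct2, rule_format]
    \<comment> \<open>As \<open>k + dim S_(d-s) = n s + dim S_d\<close>, the assumption says
      precisely that there are fewer parameters than coefficients.\<close>
    have "card {..<k} < card ?Y" using k assms(2) by (simp del: upt_Suc)
    then obtain Q where Q: "Q \<in> polyfun ?Y" "\<exists>y. Q y \<noteq> 0" "\<And>x. Q (\<phi> x) = 0"
      using algebraic_relation[of "{..<k}" ?Y \<phi>] \<phi> finite_expos by blast
    have "Q (lookup f) = 0" if "f \<in> S_deg n d" "\<forall>j\<in>set ?js. a j (c j) = 1"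
        "foldr (\<lambda>j. dderiv n (a j)) ?js f = 0" for f a
      using sol[of f a] that Q(3) by metis
    then show "\<exists>Q. good c Q" using Q(1,2) unfolding good_def by blast
  qed
  from bchoice[OF this] obtain Q where "\<forall>c\<in>A. good c (Q c)" by blast
  then have good: "good c (Q c)" if "c \<in> A" for c using that by blast
  have Q1: "Q c \<in> polyfun ?Y \<and> (\<exists>y. Q c y \<noteq> 0)" if "c \<in> A" for c
    using good[OF that] unfolding good_def by (elim conjE) (intro conjI)
  have fin: "finite A" unfolding A_def by (intro finite_PiE) auto
  show ?thesis
  proof (intro bexI[of _ "\<lambda>y. \<Prod>c\<in>A. Q c y"] conjI allI impI)
    show "(\<lambda>y. \<Prod>c\<in>A. Q c y) \<in> polyfun ?Y" by (rule polyfun_prod[of A Q ?Y]) (simp add: Q1)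
    show "\<exists>y. (\<Prod>c\<in>A. Q c y) \<noteq> 0" by (rule polyfun_prod_nonzero[of A Q ?Y]) (simp_all add: fin Q1)
    fix f assume "decomposable n d s f"
    note D = decomposable_annihilated[OF this]
    from D[THEN conjunct2] obtain a c where
      ac: "(\<forall>j\<in>set ?js. c j \<le> n \<and> a j (c j) = 1) \<and> foldr (\<lambda>j. dderiv n (a j)) ?js f = 0"
      by (elim exE)
    note f = D[THEN conjunct1] and z = ac[THEN conjunct2]
    have "restrict c (set ?js) \<in> A" unfolding A_def using ac by (intro restrict_PiE_iff[THEN iffD2]) auto
    moreover have "Q (restrict c (set ?js)) (lookup f) = 0"
    proof -
      have "\<forall>j\<in>set ?js. a j (restrict c (set ?js) j) = 1" using ac by (simp del: upt_Suc set_upt)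
      then show ?thesis using good[OF calculation] f z unfolding good_def by meson
    qed
    ultimately show "(\<Prod>c\<in>A. Q c (lookup f)) = 0" using fin by (metis prod_zero_iff)
  qed
qed

section \<open>Density of decomposable forms\<close>

text \<open>The exponents are powers of \<open>D\<close> so that a monomial in the coordinates
  becomes a power of \<open>t\<close> with its exponents as base \<open>D\<close> digits. One curve
  then handles linear forms and forms of degree below \<open>D\<close> alike.\<close>

definition curve_pt :: "nat \<Rightarrow> real \<Rightarrow> nat \<Rightarrow> complex" where
  "curve_pt D t j = of_real t ^ (D ^ j)"

text \<open>Restriction to a subset \<open>A\<close> of the coordinates is allowed: points on the
  curve stay independent after any coordinates are dropped.\<close>

lemma curve_pt_coefficients_zero:
  assumes "D > 1" "finite T" "T \<subseteq> {0<..}" "finite A" "card A \<le> card T"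
    and "\<And>t. t \<in> T \<Longrightarrow> (\<Sum>j\<in>A. a j * curve_pt D t j) = 0" "j \<in> A"
  shows "a j = 0"
proof (rule generalized_vandermonde[where w = "\<lambda>j. D ^ j"])
  show "inj_on (\<lambda>j. D ^ j) A" using assms(1) by (intro inj_onI) simp
qed (use assms in \<open>auto simp: curve_pt_def\<close>)

lemma power_form_curve_pt: "m \<in> expos {0..n} e \<Longrightarrow> lookup (power_form n e (curve_pt D t)) m =
    of_real t ^ (\<Sum>i\<in>{0..n}. lookup m i * D ^ i) / (\<Prod>i\<in>{0..n}. fact (lookup m i))"
  by (simp add: lookup_gform curve_pt_def prod_dividef power_sum power_mult[symmetric] mult.commute)

text \<open>Up to nonzero factorials, the matrix of monomials against points is a generalized
  Vandermonde matrix, because distinct monomials of degree \<open>e < D\<close> have distinct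
  weights in base \<open>D\<close>. Its independent rows make the power forms span by
  transposition.\<close>

lemma power_form_curve_pt_spanning:
  fixes J :: "'i set" and t :: "'i \<Rightarrow> real"
  assumes J: "finite J" "card J = card (expos {0..n} e)" "inj_on t J" "\<And>q. q \<in> J \<Longrightarrow> t q > 0"
    and D: "e < D" and h: "h \<in> S_deg n e"
  shows "\<exists>b. h = (\<Sum>q\<in>J. const_poly (b q) * power_form n e (curve_pt D (t q)))"
proof -
  let ?A = "expos {0..n} e"
  let ?M = "\<lambda>m q. lookup (power_form n e (curve_pt D (t q))) m"
  have A: "finite ?A" by (simp add: finite_expos)
  have "\<exists>y. \<forall>m\<in>?A. (\<Sum>q\<in>J. y q * ?M m q) = lookup h m"
  proof (rule square_system_transpose[OF A J(1) J(2)[symmetric]], intro allI impI ballI)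
    fix z m assume z: "\<forall>q\<in>J. (\<Sum>m\<in>?A. z m * ?M m q) = 0" and m: "m \<in> ?A"
    let ?c = "\<lambda>m. \<Prod>i\<in>{0..n}. fact (lookup m i) :: complex"
    have "z m / ?c m = 0"
    proof (rule generalized_vandermonde[OF A _ _ _ _ _ m, where T = "t ` J" and c = "\<lambda>m. z m / ?c m"
        and w = "\<lambda>m. \<Sum>i\<in>{0..n}. lookup m i * D ^ i"])
      show "inj_on (\<lambda>m. \<Sum>i\<in>{0..n}. lookup m i * D ^ i) ?A"
      proof (rule inj_onI, rule poly_mapping_eqI)
        fix m m' i assume mm: "m \<in> ?A" "m' \<in> ?A"
          "(\<Sum>i\<in>{0..n}. lookup m i * D ^ i) = (\<Sum>i\<in>{0..n}. lookup m' i * D ^ i)"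
        have lt: "lookup m j < D" if "m \<in> ?A" for m j
          using lookup_le_expo_deg[of m j] that D by (simp add: expos_def)
        show "lookup m i = lookup m' i"
        proof (cases "i \<in> {0..n}")
          case True
          show ?thesis
            by (rule inj_on_base_expansion[of "\<lambda>i. i" "{0..n}" D])
              (use mm True D lt in \<open>auto simp: inj_on_def\<close>)
        next
          case False
          then have "i \<notin> keys m" "i \<notin> keys m'" using mm(1,2) by (auto simp: expos_def)
          then show ?thesis by (simp add: in_keys_iff)
        qed
      qed
      show "finite (t ` J)" "t ` J \<subseteq> {0<..}" using J by auto
      show "card ?A \<le> card (t ` J)" using J by (simp add: card_image)
      fix \<tau> assume "\<tau> \<in> t ` J"
      then obtain q where q: "q \<in> J" "\<tau> = t q" by blast
      have "(\<Sum>m\<in>?A. z m / ?c m * of_real \<tau> ^ (\<Sum>i\<in>{0..n}. lookup m i * D ^ i)) = (\<Sum>m\<in>?A. z m * ?M m q)"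
        by (intro sum.cong refl) (simp add: power_form_curve_pt q(2))
      then show "(\<Sum>m\<in>?A. z m / ?c m * of_real \<tau> ^ (\<Sum>i\<in>{0..n}. lookup m i * D ^ i)) = 0"
        using z q(1) by simp
    qed
    then show "z m = 0" by simp
  qed
  then obtain y where y: "\<forall>m\<in>?A. (\<Sum>q\<in>J. y q * ?M m q) = lookup h m" by blast
  have "h = (\<Sum>q\<in>J. const_poly (y q) * power_form n e (curve_pt D (t q)))"
  proof (rule poly_mapping_eqI)
    fix m show "lookup h m = lookup (\<Sum>q\<in>J. const_poly (y q) * power_form n e (curve_pt D (t q))) m"
    proof (cases "m \<in> ?A")
      case True
      then show ?thesis using y by (simp add: lookup_sum lookup_const_poly_mult)
    next
      case False
      then show ?thesis using h by (simp add: lookup_sum lookup_const_poly_mult lookup_gform forms_iff)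
    qed
  qed
  then show ?thesis by blast
qed

text \<open>\<open>a i\<close> is the equation of the hyperplane through the \<open>n\<close> curve
  points of block \<open>i\<close>, and \<open>f i\<close> is the sum of the power forms of these
  points. The last clause says that moving the linear forms reaches all of S_(d-s) after applying
  the product; the factor \<open>a i 0\<close> comes from differentiating
  \<open>X_0\<close>.\<close>

lemma base_point:
  assumes "s \<le> d" "1 \<le> s" "card (expos {0..n} (d - s)) \<le> n * s"
  shows "\<exists>a f. (\<forall>i<s. f i \<in> S_deg n d \<and> dderiv n (a i) (f i) = 0 \<and> a i 0 \<noteq> 0) \<and>
    (\<forall>i<s. \<forall>j<s. i \<noteq> j \<longrightarrow> (\<exists>u. dot n (a j) u = 1 \<and> dot n (a i) u = 0)) \<and>
    (\<forall>h\<in>S_deg n (d - s). \<exists>b. (\<forall>i<s. b i 0 = 0) \<and>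
      h = (\<Sum>i<s. const_poly (a i 0) * foldr (\<lambda>j. dderiv n (a j)) (remove1 i [0..<s]) (dderiv n (b i) (f i))))"
proof -
  define e where "e = d - s"
  \<comment> \<open>Exceeds \<open>1\<close>, to keep the exponents \<open>D ^ j\<close> distinct,
    and exceeds \<open>e\<close>, to make exponents of monomials of degree \<open>e\<close> valid
    digits.\<close>
  define D where "D = e + 2"
  have D: "D > 1" "e < D" by (auto simp: D_def)
  have d: "d = Suc (s - 1 + e)" using assms by (simp add: e_def)
  have n: "n \<ge> 1"
  proof (rule ccontr)
    assume "\<not> n \<ge> 1"
    then have "n = 0" by simp
    then have "card (expos {0..n} e) = 0" using assms(3) by (simp add: e_def)
    then show False by (simp add: card_expos)
  qed
  define t where "t q = real (fst q * n + snd q + 1)" for q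
  let ?x = "\<lambda>i k. curve_pt D (t (i, k))"
  have tpos: "t q > 0" for q unfolding t_def by (simp only: of_nat_0_less_iff add_gr_0 zero_less_one simp_thms)
  have tinj: "i = i' \<and> k = k'" if "t (i, k) = t (i', k')" "k < n" "k' < n" for i i' k k'
  proof -
    have eq: "i * n + k = i' * n + k'" using that(1) by (simp add: t_def) (metis of_nat_add of_nat_eq_iff of_nat_mult)
    have "(i * n + k) div n = i" "(i' * n + k') div n = i'" "(i * n + k) mod n = k" "(i' * n + k') mod n = k'"
      using that by auto
    then show ?thesis using eq by metis
  qed
  have cardT: "card ((\<lambda>k. t (i, k)) ` {..<n}) = n" for i
    by (subst card_image) (use tinj in \<open>auto simp: inj_on_def\<close>)
  have "\<exists>a. (\<exists>j\<in>{0..n}. a j \<noteq> 0) \<and> (\<forall>k\<in>{..<n}. (\<Sum>j\<in>{0..n}. a j * ?x i k j) = 0)" for i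
    by (rule underdetermined_solution) auto
  then obtain a where a: "\<And>i. \<exists>j\<in>{0..n}. a i j \<noteq> 0" "\<And>i k. k < n \<Longrightarrow> dot n (a i) (?x i k) = 0"
    unfolding dot_def by (metis lessThan_iff)
  \<comment> \<open>Otherwise a form in the \<open>n\<close> coordinates \<open>1..n\<close> would
    vanish at \<open>n\<close> curve points.\<close>
  have a0: "a i 0 \<noteq> 0" for i
  proof
    assume z: "a i 0 = 0"
    have "a i j = 0" if "j \<in> {1..n}" for j
    proof (rule curve_pt_coefficients_zero[OF D(1) _ _ _ _ _ that, where T = "(\<lambda>k. t (i, k)) ` {..<n}"])
      fix \<tau> assume "\<tau> \<in> (\<lambda>k. t (i, k)) ` {..<n}"
      then obtain k where k: "k < n" "\<tau> = t (i, k)" by blast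
      have "dot n (a i) (?x i k) = (\<Sum>j\<in>{1..n}. a i j * ?x i k j)"
        unfolding dot_def using z by (simp add: sum.atLeast_Suc_atMost)
      then show "(\<Sum>j\<in>{1..n}. a i j * curve_pt D \<tau> j) = 0" using a(2)[OF k(1)] k by simp
    qed (use tpos cardT in auto)
    then have "a i j = 0" if "j \<in> {0..n}" for j using z that by (cases j) auto
    then show False using a(1)[of i] by blast
  qed
  \<comment> \<open>A point of another block on the hyperplane would be the point number
    \<open>n + 1\<close> on it, one more than a hyperplane can contain.\<close>
  have general: "dot n (a j) (?x i k) \<noteq> 0" if "i \<noteq> j" "k < n" for i j k
  proof
    assume z: "dot n (a j) (?x i k) = 0"
    let ?T = "insert (t (i, k)) ((\<lambda>k. t (j, k)) ` {..<n})"
    have new: "t (i, k) \<notin> (\<lambda>k. t (j, k)) ` {..<n}" using tinj that by blast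
    have "a j l = 0" if l: "l \<in> {0..n}" for l
    proof (rule curve_pt_coefficients_zero[OF D(1) _ _ _ _ _ l, where T = ?T])
      fix \<tau> assume "\<tau> \<in> ?T"
      then show "(\<Sum>l\<in>{0..n}. a j l * curve_pt D \<tau> l) = 0" using z a(2)[of _ j] by (auto simp: dot_def)
    qed (use tpos cardT new in auto)
    then show False using a(1)[of j] by blast
  qed
  define f where "f i = (\<Sum>k<n. power_form n d (?x i k))" for i
  define \<pi> where "\<pi> i k = (\<Prod>j\<leftarrow>remove1 i [0..<s]. dot n (a j) (?x i k))" for i k
  have \<pi>: "\<pi> i k \<noteq> 0" if "k < n" for i k
    unfolding \<pi>_def prod_list_zero_iff using general that by (auto simp: set_remove1_eq) metis
  have fa: "f i \<in> S_deg n d" "dderiv n (a i) (f i) = 0" for i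
    unfolding f_def using a(2) by (auto simp: dderiv_sum d dderiv_gform intro!: forms_sum power_form_forms)
  \<comment> \<open>The remaining \<open>s - 1\<close> operators and \<open>D_b\<close> lower the
    degree from \<open>d\<close> to \<open>e\<close>; they scale each power form by its values under
    the linear forms, of which only the one of \<open>b\<close> can vanish.\<close>
  have Lf: "foldr (\<lambda>j. dderiv n (a j)) (remove1 i [0..<s]) (dderiv n b (f i)) =
      (\<Sum>k<n. const_poly (dot n b (?x i k) * \<pi> i k) * power_form n e (?x i k))" if "i < s" for i b
  proof -
    have len: "length (remove1 i [0..<s]) = s - 1" using that by (simp add: length_remove1)
    show ?thesis
      unfolding f_def d dderiv_sum dderiv_gform dderiv_foldr_sum dderiv_foldr_const_mult \<pi>_def const_poly_mult
      using dderiv_foldr_gform[of n a "remove1 i [0..<s]" e] by (simp add: len mult.assoc)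
  qed
  \<comment> \<open>With \<open>b 0 = 0\<close> there remain \<open>n\<close> unknowns for
    \<open>n\<close> prescribed values, a regular square system.\<close>
  have solve: "\<exists>b. b 0 = 0 \<and> (\<forall>k<n. dot n b (?x i k) = v k)" for i v
  proof -
    have "\<exists>z. \<forall>k\<in>{..<n}. (\<Sum>j\<in>{1..n}. z j * ?x i k j) = v k"
    proof (rule square_system_solvable; (intro allI impI ballI)?)
      fix z j assume z: "\<forall>k\<in>{..<n}. (\<Sum>j\<in>{1..n}. z j * ?x i k j) = 0" and j: "j \<in> {1..n}"
      show "z j = 0"
        by (rule curve_pt_coefficients_zero[OF D(1) _ _ _ _ _ j, where T = "(\<lambda>k. t (i, k)) ` {..<n}"])
          (use tpos cardT z in auto)
    qed auto
    then obtain z where z: "\<And>k. k < n \<Longrightarrow> (\<Sum>j\<in>{1..n}. z j * ?x i k j) = v k" by auto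
    have "dot n (z(0 := 0)) (?x i k) = (\<Sum>j\<in>{1..n}. z j * ?x i k j)" for k
      unfolding dot_def by (simp add: sum.atLeast_Suc_atMost)
    then show ?thesis using z by (intro exI[of _ "z(0 := 0)"]) simp
  qed
  show ?thesis
  proof (rule exI[of _ a], rule exI[of _ f], intro conjI allI impI ballI)
    fix i j assume "i < s" "j < s" "i \<noteq> j"
    let ?c = "dot n (a j) (?x i 0)"
    have c: "?c \<noteq> 0" "dot n (a i) (?x i 0) = 0" using general[of i j 0] a(2)[of 0 i] \<open>i \<noteq> j\<close> n by auto
    have sc: "dot n b (\<lambda>l. r * y l) = r * dot n b y" for b y r
      by (simp add: dot_def sum_distrib_left mult.left_commute)
    show "\<exists>u. dot n (a j) u = 1 \<and> dot n (a i) u = 0"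
      using c by (intro exI[of _ "\<lambda>l. inverse ?c * ?x i 0 l"]) (simp add: sc)
  next
    fix h assume h: "h \<in> S_deg n (d - s)"
    \<comment> \<open>Of the \<open>n s\<close> points, dim S_e are enough for spanning; the others
      receive coefficient \<open>0\<close> in \<open>b'\<close>.\<close>
    obtain J where J: "J \<subseteq> {..<s} \<times> {..<n}" "card J = card (expos {0..n} e)"
      using obtain_subset_with_card_n[of "card (expos {0..n} e)" "{..<s} \<times> {..<n}"] assms(3)
      by (auto simp: e_def mult.commute)
    have fJ: "finite J" using J(1) by (rule finite_subset) auto
    have "inj_on t J" by (intro inj_onI) (use J(1) tinj in \<open>force\<close>)
    then obtain b where b: "h = (\<Sum>q\<in>J. const_poly (b q) * power_form n e (curve_pt D (t q)))"
      using power_form_curve_pt_spanning[OF fJ J(2) _ _ D(2), of t h] tpos h by (auto simp: e_def)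
    define b' where "b' q = (if q \<in> J then b q else 0)" for q
    have h2: "h = (\<Sum>i<s. \<Sum>k<n. const_poly (b' (i, k)) * power_form n e (?x i k))"
    proof -
      have "h = (\<Sum>q\<in>J. const_poly (b' q) * power_form n e (curve_pt D (t q)))"
        unfolding b by (intro sum.cong) (auto simp: b'_def)
      also have "\<dots> = (\<Sum>q\<in>{..<s} \<times> {..<n}. const_poly (b' q) * power_form n e (curve_pt D (t q)))"
        using J(1) by (intro sum.mono_neutral_left) (auto simp: b'_def)
      finally show ?thesis by (simp add: sum.cartesian_product case_prod_beta)
    qed
    have "\<forall>i. \<exists>b. b 0 = 0 \<and> (\<forall>k<n. dot n b (?x i k) = b' (i, k) / (a i 0 * \<pi> i k))"
      by (intro allI solve)
    from choice[OF this] obtain l where l: "\<And>i. l i 0 = 0" "\<And>i k. k < n \<Longrightarrow> dot n (l i) (?x i k) = b' (i, k) / (a i 0 * \<pi> i k)"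
      by blast
    have "h = (\<Sum>i<s. const_poly (a i 0) * foldr (\<lambda>j. dderiv n (a j)) (remove1 i [0..<s]) (dderiv n (l i) (f i)))"
      unfolding h2
    proof (intro sum.cong refl)
      fix i assume "i \<in> {..<s}"
      then have i: "i < s" by simp
      have "const_poly (a i 0) * foldr (\<lambda>j. dderiv n (a j)) (remove1 i [0..<s]) (dderiv n (l i) (f i)) =
        (\<Sum>k<n. const_poly (a i 0 * (dot n (l i) (?x i k) * \<pi> i k)) * power_form n e (?x i k))"
        unfolding Lf[OF i] by (simp add: sum_distrib_left const_poly_mult mult.assoc)
      also have "\<dots> = (\<Sum>k<n. const_poly (b' (i, k)) * power_form n e (?x i k))"
        by (intro sum.cong refl) (use l(2) a0 \<pi> in simp)
      finally show "(\<Sum>k<n. const_poly (b' (i, k)) * power_form n e (?x i k)) =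
        const_poly (a i 0) * foldr (\<lambda>j. dderiv n (a j)) (remove1 i [0..<s]) (dderiv n (l i) (f i))" by simp
    qed
    then show "\<exists>b. (\<forall>i<s. b i 0 = 0) \<and>
      h = (\<Sum>i<s. const_poly (a i 0) * foldr (\<lambda>j. dderiv n (a j)) (remove1 i [0..<s]) (dderiv n (b i) (f i)))"
      by (intro exI[of _ l] conjI allI impI l(1))
  qed (use fa a0 in auto)
qed

section \<open>Shears and curves of decomposable forms\<close>

definition unit0 :: "nat \<Rightarrow> complex" where
  "unit0 j = (if j = 0 then 1 else 0)"

lemma dot_unit0: "dot n a unit0 = a 0"
  by (simp add: dot_def unit0_def if_distrib cong: if_cong)

text \<open>
  For \<open>b 0 = 0\<close> the operator \<open>shear\<close> is \<open>exp (\<epsilon> X\<^sub>0 D\<^sub>b)\<close>, the substitution \<open>X\<^sub>j \<mapsto> X\<^sub>j + \<epsilon> b\<^sub>j X\<^sub>0\<close>. It moves the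
  kernel of \<open>D\<^sub>a\<close> to that of \<open>D\<^sub>a - \<epsilon> a\<^sub>0 D\<^sub>b\<close>.
\<close>

definition shear_term :: "nat \<Rightarrow> (nat \<Rightarrow> complex) \<Rightarrow> nat \<Rightarrow> nat cpoly \<Rightarrow> nat cpoly" where
  "shear_term n b k p = const_poly (1 / fact k) * (lin_form n unit0 ^ k * (dderiv n b ^^ k) p)"

definition shear :: "nat \<Rightarrow> nat \<Rightarrow> (nat \<Rightarrow> complex) \<Rightarrow> complex \<Rightarrow> nat cpoly \<Rightarrow> nat cpoly" where
  "shear n d b \<epsilon> p = (\<Sum>k<Suc d. const_poly (\<epsilon> ^ k) * shear_term n b k p)"

lemma shear_forms:
  assumes "p \<in> S_deg n d" shows "shear n d b \<epsilon> p \<in> S_deg n d"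
  unfolding shear_def shear_term_def
proof (intro forms_sum forms_const_mult)
  fix k assume k: "k \<in> {..<Suc d}"
  then have "(dderiv n b ^^ k) p \<in> S_deg n (d - k)" using assms by (intro dderiv_power_forms) auto
  then show "lin_form n unit0 ^ k * (dderiv n b ^^ k) p \<in> S_deg n d"
    using lin_form_power_mult_forms[of _ n "d - k" unit0 k] k by simp
qed

text \<open>The commutator of \<open>D_a\<close> with \<open>X_0\<close> is \<open>a 0\<close>, and
  \<open>D_b\<close> commutes with \<open>X_0\<close> because \<open>b 0 = 0\<close>. So applying
  \<open>D_a\<close> to the exponential series gives \<open>\<epsilon> a_0 D_b\<close> of the same
  series.\<close>

lemma dderiv_shear:
  assumes p: "p \<in> S_deg n d" and a: "dderiv n a p = 0" and b: "b 0 = 0"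
  shows "dderiv n (\<lambda>j. a j - (\<epsilon> * a 0) * b j) (shear n d b \<epsilon> p) = 0"
proof -
  let ?B = "\<lambda>k. (dderiv n b ^^ k) p"
  let ?x = "lin_form n unit0"
  have aB: "dderiv n a (?B k) = 0" for k using a by (simp add: dderiv_power_commute)
  have bx: "dderiv n b (?x ^ k * ?B k) = ?x ^ k * ?B (Suc k)" for k
    by (cases k) (simp_all only: dderiv_lin_power_mult dot_unit0 b, simp_all)
  have ax0: "dderiv n a (?x ^ 0 * ?B 0) = 0" using a by simp
  have axS: "dderiv n a (?x ^ Suc k * ?B (Suc k)) = const_poly (of_nat (Suc k) * a 0) * (?x ^ k * ?B (Suc k))" for k
    unfolding dderiv_lin_power_mult dot_unit0 aB by simp
  have "dderiv n a (shear n d b \<epsilon> p) =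
      (\<Sum>k<d. const_poly (\<epsilon> ^ Suc k) * (const_poly (1 / fact (Suc k)) * dderiv n a (?x ^ Suc k * ?B (Suc k))))"
    unfolding shear_def shear_term_def dderiv_sum dderiv_const_mult
    by (simp only: sum.lessThan_Suc_shift ax0 mult_zero_right add_0)
  also have "\<dots> = (\<Sum>k<d. const_poly (\<epsilon> * a 0) * (const_poly (\<epsilon> ^ k) * (const_poly (1 / fact k) * (?x ^ k * ?B (Suc k)))))"
  proof (intro sum.cong refl)
    fix k
    have "\<epsilon> ^ Suc k * (1 / fact (Suc k) * (of_nat (Suc k) * a 0)) = \<epsilon> * a 0 * (\<epsilon> ^ k * (1 / fact k))"
      by (simp add: field_simps del: of_nat_Suc)
    then show "const_poly (\<epsilon> ^ Suc k) * (const_poly (1 / fact (Suc k)) * dderiv n a (?x ^ Suc k * ?B (Suc k))) =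
      const_poly (\<epsilon> * a 0) * (const_poly (\<epsilon> ^ k) * (const_poly (1 / fact k) * (?x ^ k * ?B (Suc k))))"
      unfolding axS by (simp only: mult.assoc[symmetric] const_poly_mult[symmetric])
  qed
  \<comment> \<open>The added term contains \<open>D_b\<close> to the power \<open>Suc d\<close>,
    which kills forms of degree \<open>d\<close>.\<close>
  also have "\<dots> = (\<Sum>k<Suc d. const_poly (\<epsilon> * a 0) * (const_poly (\<epsilon> ^ k) * (const_poly (1 / fact k) * (?x ^ k * ?B (Suc k)))))"
    using dderiv_power_forms_0[OF p, of b] by simp
  also have "\<dots> = const_poly (\<epsilon> * a 0) * dderiv n b (shear n d b \<epsilon> p)"
    unfolding shear_def shear_term_def dderiv_sum dderiv_const_mult bx sum_distrib_left ..
  finally show ?thesis by (simp add: dderiv_diff_scale)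
qed

lemma dderiv_power_add: "(dderiv n b ^^ k) (p + q) = (dderiv n b ^^ k) p + (dderiv n b ^^ k) q"
  by (induction k) (simp_all add: dderiv_add)

lemma dderiv_power_const_mult: "(dderiv n b ^^ k) (const_poly c * p) = const_poly c * (dderiv n b ^^ k) p"
  by (induction k) (simp_all add: dderiv_const_mult)

lemma shear_term_add: "shear_term n b k (p + q) = shear_term n b k p + shear_term n b k q"
  by (simp add: shear_term_def dderiv_power_add ring_distribs)

lemma shear_term_const_mult: "shear_term n b k (const_poly c * p) = const_poly c * shear_term n b k p"
  by (simp add: shear_term_def dderiv_power_const_mult mult.left_commute)

lemma polynomial_derivative_0:
  fixes c :: "nat \<Rightarrow> complex"
  shows "((\<lambda>\<epsilon>. \<Sum>k<Suc (Suc d). \<epsilon> ^ k * c k) has_field_derivative c 1) (at 0)"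
proof (induction d)
  case 0
  show ?case by (auto intro!: derivative_eq_intros)
next
  case (Suc d)
  have "((\<lambda>\<epsilon>. \<epsilon> ^ Suc (Suc d) * c (Suc (Suc d))) has_field_derivative 0) (at 0)"
    by (auto intro!: derivative_eq_intros)
  from DERIV_add[OF Suc this] show ?case by simp
qed

text \<open>Product rule at \<epsilon> = 0: varying the form contributes \<open>q\<close>, varying
  the coordinates contributes \<open>X_0 D_b p\<close>. The latter is the term \<open>k = 1\<close>
  of the series, which is present since \<open>d \<ge> 1\<close>.\<close>

lemma shear_derivative:
  assumes "d \<ge> 1"
  shows "((\<lambda>\<epsilon>. lookup (shear n d b \<epsilon> (p + const_poly \<epsilon> * q)) m) has_field_derivative
    lookup (q + lin_form n unit0 * dderiv n b p) m) (at 0)"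
proof -
  obtain d' where d: "d = Suc d'" using assms by (cases d) auto
  let ?P = "\<lambda>p \<epsilon>. \<Sum>k<Suc (Suc d'). \<epsilon> ^ k * lookup (shear_term n b k p) m"
  have "lookup (shear n d b \<epsilon> (p + const_poly \<epsilon> * q)) m = ?P p \<epsilon> + \<epsilon> * ?P q \<epsilon>" for \<epsilon>
    unfolding shear_def d shear_term_add shear_term_const_mult
    by (simp add: lookup_sum lookup_const_poly_mult lookup_add ring_distribs sum.distrib sum_distrib_left
        mult.left_commute del: sum.lessThan_Suc)
  moreover have "((\<lambda>\<epsilon>. ?P p \<epsilon> + \<epsilon> * ?P q \<epsilon>) has_field_derivative
      lookup (shear_term n b 1 p) m + (1 * ?P q 0 + lookup (shear_term n b 1 q) m * 0)) (at 0)"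
    by (intro DERIV_add DERIV_mult DERIV_ident polynomial_derivative_0)
  moreover have "?P q 0 = lookup q m"
    by (simp add: sum.lessThan_Suc_shift shear_term_def del: sum.lessThan_Suc)
  moreover have "shear_term n b 1 p = lin_form n unit0 * dderiv n b p" by (simp add: shear_term_def)
  ultimately show ?thesis by (simp add: lookup_add add.commute)
qed

lemma shear_0: "shear n d b 0 p = p"
  by (simp add: shear_def shear_term_def sum.lessThan_Suc_shift del: sum.lessThan_Suc)

lemma decomposableI:
  assumes "\<And>i. i < s \<Longrightarrow> g i \<in> S_deg n d" "\<And>i. i < s \<Longrightarrow> a i 0 \<noteq> 0" "\<And>i. i < s \<Longrightarrow> dderiv n (a i) (g i) = 0"
  shows "decomposable n d s (\<Sum>i<s. g i)"
  unfolding decomposable_def codim_one_decomposition_def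
proof (intro exI[of _ "\<lambda>i. g (i - 1)"] conjI ballI)
  fix i assume "i \<in> {1..s}"
  then have "i - 1 < s" by auto
  then show "codim_one_form n d (g (i - 1))" using assms unfolding codim_one_form_iff by blast
next
  show "(\<Sum>i<s. g i) = (\<Sum>i = 1..s. g (i - 1))" by (simp add: sum.atLeast1_atMost_eq)
qed

text \<open>Every vector of S_d is tangent at \<open>f0\<close> to a curve of decomposable forms, on
  which \<open>Q\<close> vanishes; the curves also stay in S_d, so the lemma on curves applies with
  \<open>Z\<close> all of S_d.\<close>

lemma decomposable_dense:
  assumes "s \<le> d" "1 \<le> s" "card (expos {0..n} (d - s)) \<le> n * s"
    and Q: "Q \<in> polyfun UNIV" "\<And>f. decomposable n d s f \<Longrightarrow> Q (lookup f) = 0"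
    and h: "h \<in> S_deg n d"
  shows "Q (lookup h) = 0"
proof -
  obtain a f where
    af: "\<And>i. i < s \<Longrightarrow> f i \<in> S_deg n d \<and> dderiv n (a i) (f i) = 0 \<and> a i 0 \<noteq> 0"
    and sep: "\<And>i j. i < s \<Longrightarrow> j < s \<Longrightarrow> i \<noteq> j \<Longrightarrow> \<exists>u. dot n (a j) u = 1 \<and> dot n (a i) u = 0"
    and onto: "\<And>h. h \<in> S_deg n (d - s) \<Longrightarrow> \<exists>b. (\<forall>i<s. b i 0 = 0) \<and>
      h = (\<Sum>i<s. const_poly (a i 0) * foldr (\<lambda>j. dderiv n (a j)) (remove1 i [0..<s]) (dderiv n (b i) (f i)))"
    using base_point[OF assms(1-3)] by blast
  let ?\<Lambda> = "foldr (\<lambda>j. dderiv n (a j)) [0..<s]" and ?x = "lin_form n unit0"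
  define f0 where "f0 = (\<Sum>i<s. f i)"
  have f0: "f0 \<in> S_deg n d" unfolding f0_def using af by (intro forms_sum) auto
  \<comment> \<open>First \<open>b\<close> is chosen so that the moved linear forms account for the
    image of \<open>h\<close> under the product of the operators. The rest lies in the kernel of the
    product and splits into the \<open>g i\<close>.\<close>
  have tangent: "\<exists>b g. (\<forall>i<s. b i 0 = 0 \<and> g i \<in> S_deg n d \<and> dderiv n (a i) (g i) = 0) \<and>
      h = (\<Sum>i<s. g i + ?x * dderiv n (b i) (f i))" if h: "h \<in> S_deg n d" for h
  proof -
    have "?\<Lambda> h \<in> S_deg n (d - s)" using h assms(1) by (intro dderiv_foldr_forms) simp
    then obtain b where b: "\<And>i. i < s \<Longrightarrow> b i 0 = 0"
      "?\<Lambda> h = (\<Sum>i<s. const_poly (a i 0) * foldr (\<lambda>j. dderiv n (a j)) (remove1 i [0..<s]) (dderiv n (b i) (f i)))"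
      using onto by blast
    let ?r = "\<Sum>i<s. ?x * dderiv n (b i) (f i)"
    have "?\<Lambda> ?r = ?\<Lambda> h"
      unfolding b(2) dderiv_foldr_sum
    proof (intro sum.cong refl)
      fix i assume "i \<in> {..<s}"
      then have i: "i < s" by simp
      have "dderiv n (a i) (?x * dderiv n (b i) (f i)) = const_poly (a i 0) * dderiv n (b i) (f i)"
        unfolding dderiv_lin_mult dot_unit0 using af[OF i] by (simp add: dderiv_commute[of n "a i"])
      then show "?\<Lambda> (?x * dderiv n (b i) (f i)) =
          const_poly (a i 0) * foldr (\<lambda>j. dderiv n (a j)) (remove1 i [0..<s]) (dderiv n (b i) (f i))"
        using i by (subst dderiv_foldr_remove1[of i]) (simp_all add: dderiv_foldr_const_mult)
    qed
    then have z: "?\<Lambda> (h - ?r) = 0" by (simp add: dderiv_foldr_diff)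
    have "?x * dderiv n (b i) (f i) \<in> S_deg n d" if "i < s" for i
    proof -
      have "dderiv n (b i) (f i) \<in> S_deg n (d - 1)" using af[OF that] assms(1,2) by (intro dderiv_forms) simp
      then show ?thesis using lin_form_mult_forms[of "dderiv n (b i) (f i)" n "d - 1"] assms(1,2) by simp
    qed
    then have hr: "h - ?r \<in> S_deg n d" using h by (intro forms_diff forms_sum) auto
    have sep': "\<exists>u. dot n (a j) u = 1 \<and> dot n (a i) u = 0"
      if "i \<in> set [0..<s]" "j \<in> set [0..<s]" "i \<noteq> j" for i j
      using sep[of i j] that by simp
    have "\<exists>g. (\<forall>i\<in>set [0..<s]. g i \<in> S_deg n d \<and> dderiv n (a i) (g i) = 0) \<and> h - ?r = (\<Sum>i\<in>set [0..<s]. g i)"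
      by (rule kernel_of_product[OF distinct_upt _ hr z]) (rule sep')
    then obtain g where
      g: "(\<forall>i\<in>set [0..<s]. g i \<in> S_deg n d \<and> dderiv n (a i) (g i) = 0) \<and> h - ?r = (\<Sum>i\<in>set [0..<s]. g i)"
      by (elim exE)
    have "h = (\<Sum>i<s. g i) + ?r" using g[THEN conjunct2] by (simp add: atLeast0LessThan algebra_simps)
    then have "h = (\<Sum>i<s. g i + ?x * dderiv n (b i) (f i))" by (simp add: sum.distrib)
    then show ?thesis using b(1) g[THEN conjunct1] by (intro exI[of _ b] exI[of _ g]) simp
  qed
  let ?Z = "lookup ` S_deg n d"
  have "Q (\<lambda>v. lookup f0 v + lookup (h - f0) v) = 0"
  proof (rule polyfun_vanish_of_curves[OF Q(1), where Z = ?Z])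
    show "lookup (h - f0) \<in> ?Z" using h f0 by (intro imageI forms_diff)
    fix z assume "z \<in> ?Z"
    then obtain h' where h': "h' \<in> S_deg n d" "z = lookup h'" by blast
    obtain b g where bg: "\<And>i. i < s \<Longrightarrow> b i 0 = 0 \<and> g i \<in> S_deg n d \<and> dderiv n (a i) (g i) = 0"
      and eq: "h' = (\<Sum>i<s. g i + ?x * dderiv n (b i) (f i))" using tangent[OF h'(1)] by blast
    \<comment> \<open>Two motions at once: \<open>f i\<close> moves along \<open>g i\<close> within
      the kernel of its operator, and the shear moves the operator.\<close>
    define G where "G \<epsilon> i = shear n d (b i) \<epsilon> (f i + const_poly \<epsilon> * g i)" for \<epsilon> i
    have Gf: "G \<epsilon> i \<in> S_deg n d" if "i < s" for \<epsilon> i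
      unfolding G_def using af bg that by (intro shear_forms forms_add forms_const_mult) auto
    define \<gamma> where "\<gamma> \<epsilon> = (\<Sum>i<s. G \<epsilon> i)" for \<epsilon>
    have \<gamma>f: "\<gamma> \<epsilon> \<in> S_deg n d" for \<epsilon> unfolding \<gamma>_def using Gf by (intro forms_sum) auto
    show "\<exists>\<gamma>. \<gamma> 0 = lookup f0 \<and> (\<forall>v. ((\<lambda>e. \<gamma> e v) has_field_derivative z v) (at 0)) \<and>
        (\<forall>e. (\<lambda>v. (\<gamma> e v - lookup f0 v) / e) \<in> ?Z) \<and> (\<forall>e. Q (\<gamma> e) = 0)"
    proof (intro exI[of _ "\<lambda>\<epsilon>. lookup (\<gamma> \<epsilon>)"] conjI allI)
      show "lookup (\<gamma> 0) = lookup f0" by (simp add: \<gamma>_def G_def shear_0 f0_def)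
      show "((\<lambda>\<epsilon>. lookup (\<gamma> \<epsilon>) v) has_field_derivative z v) (at 0)" for v
        unfolding \<gamma>_def G_def h'(2) eq lookup_sum
        by (intro DERIV_sum shear_derivative) (use assms(1,2) in simp)
      show "(\<lambda>v. (lookup (\<gamma> \<epsilon>) v - lookup f0 v) / \<epsilon>) \<in> ?Z" for \<epsilon>
      proof
        show "const_poly (1 / \<epsilon>) * (\<gamma> \<epsilon> - f0) \<in> S_deg n d"
          using \<gamma>f f0 by (intro forms_const_mult forms_diff)
        show "(\<lambda>v. (lookup (\<gamma> \<epsilon>) v - lookup f0 v) / \<epsilon>) = lookup (const_poly (1 / \<epsilon>) * (\<gamma> \<epsilon> - f0))"
          by (simp add: fun_eq_iff lookup_const_poly_mult lookup_minus)
      qed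
      show "Q (lookup (\<gamma> \<epsilon>)) = 0" for \<epsilon>
        unfolding \<gamma>_def
      proof (intro Q(2) decomposableI[where a = "\<lambda>i j. a i j - (\<epsilon> * a i 0) * b i j"])
        fix i assume i: "i < s"
        show "G \<epsilon> i \<in> S_deg n d" using Gf[OF i] .
        \<comment> \<open>As \<open>b i 0 = 0\<close>, the moved linear form keeps the entry
          \<open>a i 0\<close>, so it is nonzero for every \<epsilon>.\<close>
        show "a i 0 - (\<epsilon> * a i 0) * b i 0 \<noteq> 0" using af[OF i] bg[OF i] by simp
        show "dderiv n (\<lambda>j. a i j - (\<epsilon> * a i 0) * b i j) (G \<epsilon> i) = 0"
          unfolding G_def using af[OF i] bg[OF i]
          by (intro dderiv_shear forms_add forms_const_mult) (simp_all add: dderiv_add dderiv_const_mult)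
      qed
    qed
  qed
  moreover have "(\<lambda>v. lookup f0 v + lookup (h - f0) v) = lookup h"
    by (simp add: lookup_minus fun_eq_iff)
  ultimately show ?thesis by simp
qed

section \<open>The generic form\<close>

text \<open>
  The unknowns \<open>Inl m\<close> are the coefficients of \<open>f\<close>, \<open>Inr (Inl (i, m))\<close> those of the \<open>i\<close>-th summand, and
  \<open>Inr (Inr (i, j))\<close> those of the linear form annihilating it.
\<close>

type_synonym param = "(nat \<Rightarrow>\<^sub>0 nat) + (nat \<times> (nat \<Rightarrow>\<^sub>0 nat)) + (nat \<times> nat)"

definition decomposition_system :: "nat \<Rightarrow> nat \<Rightarrow> nat \<Rightarrow> (param \<Rightarrow> complex) \<Rightarrow> bool" where
  "decomposition_system n d s x \<longleftrightarrow>
    (\<forall>i\<in>{1..s}. (\<exists>j\<in>{0..n}. x (Inr (Inr (i, j))) \<noteq> 0) \<and>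
      (\<forall>m\<in>expos {0..n} (d - 1). (\<Sum>j\<in>{0..n}. x (Inr (Inr (i, j))) *
        (of_nat (Suc (lookup m j)) * x (Inr (Inl (i, m + single j 1))))) = 0)) \<and>
    (\<forall>m\<in>expos {0..n} d. x (Inl m) - (\<Sum>i\<in>{1..s}. x (Inr (Inl (i, m)))) = 0)"

lemma constructible_decomposition_system: "constructible (decomposition_system n d s)"
  unfolding decomposition_system_def[abs_def]
  by (intro constructible.conj constructible_ball constructible_bex constructible.eq constructible.neq finite_atLeastAtMost finite_expos
      polyfun_diff polyfun_sum polyfun.mult polyfun.const polyfun.var UNIV_I)

definition form_of :: "nat \<Rightarrow> nat \<Rightarrow> ((nat \<Rightarrow>\<^sub>0 nat) \<Rightarrow> complex) \<Rightarrow> nat cpoly" where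
  "form_of n d y = (\<Sum>m\<in>expos {0..n} d. single m (y m))"

lemma lookup_form_of: "lookup (form_of n d y) m = (if m \<in> expos {0..n} d then y m else 0)"
  by (simp add: form_of_def lookup_sum lookup_single when_def finite_expos)

lemma form_of_forms: "form_of n d y \<in> S_deg n d"
  by (simp add: forms_iff lookup_form_of)

definition embed :: "((nat \<Rightarrow>\<^sub>0 nat) \<Rightarrow> complex) \<Rightarrow> param \<Rightarrow> complex" where
  "embed y v = (case v of Inl m \<Rightarrow> y m | Inr _ \<Rightarrow> 0)"

text \<open>\<open>W\<close> collects the finitely many unknowns to be eliminated, leaving a
  condition on the coefficients of \<open>f\<close>.\<close>

lemma decomposable_iff_system:
  fixes s :: nat
  assumes "d \<ge> 1" and f: "f \<in> S_deg n d"
  defines "W \<equiv> (\<lambda>p. Inr (Inl p)) ` ({1..s} \<times> expos {0..n} d) \<union> (\<lambda>p. Inr (Inr p)) ` ({1..s} \<times> {0..n})"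
  shows "decomposable n d s f \<longleftrightarrow>
    (\<exists>z. decomposition_system n d s (\<lambda>v. if v \<in> W then z v else embed (lookup f) v))"
proof -
  let ?x = "\<lambda>z v. if v \<in> W then z v else embed (lookup f) v"
  have x: "?x z (Inl m) = lookup f m"
    "i \<in> {1..s} \<Longrightarrow> m \<in> expos {0..n} d \<Longrightarrow> ?x z (Inr (Inl (i, m))) = z (Inr (Inl (i, m)))"
    "i \<in> {1..s} \<Longrightarrow> j \<in> {0..n} \<Longrightarrow> ?x z (Inr (Inr (i, j))) = z (Inr (Inr (i, j)))" for z i j m
    by (auto simp: W_def embed_def)
  have up: "m + single j 1 \<in> expos {0..n} d" if "m \<in> expos {0..n} (d - 1)" "j \<in> {0..n}" for m j
    using that assms(1) expos_add_single_iff[of m j "{0..n}" "d - 1"] by simp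
  have system: "decomposition_system n d s (?x z) \<longleftrightarrow>
    (\<forall>i\<in>{1..s}. (\<exists>j\<in>{0..n}. z (Inr (Inr (i, j))) \<noteq> 0) \<and>
      (\<forall>m\<in>expos {0..n} (d - 1). (\<Sum>j\<in>{0..n}. z (Inr (Inr (i, j))) *
        (of_nat (Suc (lookup m j)) * z (Inr (Inl (i, m + single j 1))))) = 0)) \<and>
    (\<forall>m\<in>expos {0..n} d. lookup f m - (\<Sum>i\<in>{1..s}. z (Inr (Inl (i, m)))) = 0)" for z
    unfolding decomposition_system_def x(1)
    by (intro arg_cong2[where f = "(\<and>)"] ball_cong bex_cong refl arg_cong2[where f = "(=)"]
        arg_cong[where f = Not] sum.cong arg_cong2[where f = "(*)"] arg_cong2[where f = "(-)"] x up)
  show ?thesis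
  proof
    assume "decomposable n d s f"
    then obtain g where g: "\<forall>i\<in>{1..s}. codim_one_form n d (g i)" "f = (\<Sum>i=1..s. g i)"
      unfolding decomposable_def codim_one_decomposition_def by blast
    then have "\<forall>i\<in>{1..s}. \<exists>a. (\<exists>j\<le>n. a j \<noteq> 0) \<and> dderiv n a (g i) = 0"
      unfolding codim_one_form_iff by blast
    from bchoice[OF this] obtain a where a: "\<forall>i\<in>{1..s}. (\<exists>j\<le>n. a i j \<noteq> 0) \<and> dderiv n (a i) (g i) = 0" by blast
    define z where "z v = (case v of Inl m \<Rightarrow> 0 | Inr (Inl (i, m)) \<Rightarrow> lookup (g i) m
      | Inr (Inr (i, j)) \<Rightarrow> a i j)" for v :: param
    have z: "z (Inr (Inl (i, m))) = lookup (g i) m" "z (Inr (Inr (i, j))) = a i j" for i j m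
      by (simp_all add: z_def)
    have "decomposition_system n d s (?x z)"
      unfolding system z lookup_dop[symmetric]
    proof (intro conjI ballI)
      fix i assume i: "i \<in> {1..s}"
      show "\<exists>j\<in>{0..n}. a i j \<noteq> 0" using a i by (meson atLeastAtMost_iff le0)
      show "lookup (dderiv n (a i) (g i)) m = 0" for m using a i by simp
    next
      show "lookup f m - (\<Sum>i = 1..s. lookup (g i) m) = 0" for m by (simp add: g(2) lookup_sum)
    qed
    then show "\<exists>z. decomposition_system n d s (?x z)" by (rule exI[of _ z])
  next
    assume "\<exists>z. decomposition_system n d s (?x z)"
    then obtain z where z: "decomposition_system n d s (?x z)" by (elim exE)
    define g where "g i = form_of n d (\<lambda>m. z (Inr (Inl (i, m))))" for i
    define a where "a i j = z (Inr (Inr (i, j)))" for i j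
    note z' = z[unfolded system]
    have "codim_one_form n d (g i)" if i: "i \<in> {1..s}" for i
      unfolding codim_one_form_iff
    proof (intro conjI exI[of _ "a i"])
      show gi: "g i \<in> S_deg n d" unfolding g_def by (rule form_of_forms)
      have "\<exists>j\<in>{0..n}. a i j \<noteq> 0" using z'[THEN conjunct1] i unfolding a_def by blast
      then show "\<exists>j\<le>n. a i j \<noteq> 0" by auto
      have lg: "dderiv n (a i) (g i) \<in> S_deg n (d - 1)" using gi assms(1) by (intro dderiv_forms) simp
      show "dderiv n (a i) (g i) = 0"
      proof (rule poly_mapping_eqI)
        fix m show "lookup (dderiv n (a i) (g i)) m = lookup 0 m"
        proof (cases "m \<in> expos {0..n} (d - 1)")
          case True
          have "lookup (dderiv n (a i) (g i)) m = (\<Sum>j\<in>{0..n}. z (Inr (Inr (i, j))) *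
             (of_nat (Suc (lookup m j)) * z (Inr (Inl (i, m + single j 1)))))"
            unfolding lookup_dop g_def lookup_form_of a_def
            by (intro sum.cong refl) (simp only: up[OF True] if_True)
          also have "\<dots> = 0" using z'[THEN conjunct1] i True by blast
          finally show ?thesis by simp
        next
          case False
          then show ?thesis using lg by (simp add: forms_iff)
        qed
      qed
    qed
    moreover have "f = (\<Sum>i = 1..s. g i)"
    proof (rule poly_mapping_eqI)
      fix m show "lookup f m = lookup (\<Sum>i = 1..s. g i) m"
      proof (cases "m \<in> expos {0..n} d")
        case True
        then have "lookup f m = (\<Sum>i\<in>{1..s}. z (Inr (Inl (i, m))))"
          using z'[THEN conjunct2] by simp
        then show ?thesis using True by (simp add: lookup_sum g_def lookup_form_of)
      next
        case False
        then show ?thesis using f by (simp add: lookup_sum g_def lookup_form_of forms_iff)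
      qed
    qed
    ultimately show "decomposable n d s f"
      unfolding decomposable_def codim_one_decomposition_def by blast
  qed
qed

text \<open>If the second alternative of the dichotomy held, \<open>P\<close> would vanish on all
  decomposable forms, hence by density on all of S_d, contrary to its value at
  \<open>f1\<close>.\<close>

lemma generic_decomposable:
  assumes "s \<le> d" "1 \<le> s" "card (expos {0..n} (d - s)) \<le> n * s"
  shows "\<exists>P\<in>polyfun (expos {0..n} d). (\<exists>y. P y \<noteq> 0) \<and>
    (\<forall>f\<in>S_deg n d. P (lookup f) \<noteq> 0 \<longrightarrow> decomposable n d s f)"
proof -
  define W :: "param set" where
    "W = (\<lambda>p. Inr (Inl p)) ` ({1..s} \<times> expos {0..n} d) \<union> (\<lambda>p. Inr (Inr p)) ` ({1..s} \<times> {0..n})"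
  have "finite W" by (simp add: W_def finite_expos)
  define S where "S x \<longleftrightarrow> (\<exists>z. decomposition_system n d s (\<lambda>v. if v \<in> W then z v else x v))" for x
  have S: "constructible S" unfolding S_def[abs_def]
    using \<open>finite W\<close> constructible_decomposition_system by (rule constructible_ex_finite)
  have dS: "decomposable n d s f \<longleftrightarrow> S (embed (lookup f))" if "f \<in> S_deg n d" for f
    unfolding S_def W_def using assms(1,2) that by (intro decomposable_iff_system) auto
  let ?X = "(\<lambda>f. embed (lookup f)) ` S_deg n d"
  have aff: "affine_set ?X"
    unfolding affine_set_def
  proof (intro ballI allI)
    fix x y t assume "x \<in> ?X" "y \<in> ?X"
    then obtain f g where fg: "f \<in> S_deg n d" "g \<in> S_deg n d"
      "x = embed (lookup f)" "y = embed (lookup g)" by blast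
    have "f + const_poly t * (g - f) \<in> S_deg n d"
      using fg by (intro forms_add forms_const_mult forms_diff)
    moreover have "(\<lambda>v. x v + t * (y v - x v)) = embed (lookup (f + const_poly t * (g - f)))"
      by (auto simp: fg embed_def fun_eq_iff lookup_add lookup_const_poly_mult lookup_minus split: sum.splits)
    ultimately show "(\<lambda>v. x v + t * (y v - x v)) \<in> ?X" by blast
  qed
  have "embed (lookup 0) \<in> ?X" by (intro imageI forms_zero)
  from constructible_dichotomy[OF S aff this] obtain Q where Q0: "Q \<in> polyfun UNIV"
    "(\<exists>x\<in>?X. Q x \<noteq> 0) \<and>
     ((\<forall>x\<in>?X. Q x \<noteq> 0 \<longrightarrow> S x) \<or> (\<forall>x\<in>?X. Q x \<noteq> 0 \<longrightarrow> \<not> S x))" by (elim bexE)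
  note Q = Q0(1) conjunct1[OF Q0(2)] conjunct2[OF Q0(2)]
  \<comment> \<open>\<open>Q\<close> is read as a polynomial in the coefficients of degree
    \<open>d\<close> alone, all other arguments being set to \<open>0\<close>.\<close>
  define P where "P y = Q (embed (\<lambda>m. if m \<in> expos {0..n} d then y m else 0))" for y
  have P: "P \<in> polyfun (expos {0..n} d)"
    unfolding P_def
  proof (rule polyfun_subst[OF Q(1)])
    fix v :: param
    show "(\<lambda>x. embed (\<lambda>m. if m \<in> expos {0..n} d then x m else 0) v) \<in> polyfun (expos {0..n} d)"
    proof (cases v)
      case (Inl m)
      then show ?thesis
        by (cases "m \<in> expos {0..n} d") (simp_all add: embed_def polyfun.const polyfun.var)
    next
      case (Inr w)
      then show ?thesis by (simp add: embed_def polyfun.const)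
    qed
  qed
  have PQ: "P (lookup f) = Q (embed (lookup f))" if "f \<in> S_deg n d" for f
  proof -
    have "(\<lambda>m. if m \<in> expos {0..n} d then lookup f m else 0) = lookup f"
      using that by (auto simp: fun_eq_iff forms_iff)
    then show ?thesis by (simp add: P_def)
  qed
  obtain f1 where f1: "f1 \<in> S_deg n d" "P (lookup f1) \<noteq> 0" using Q(2) PQ by auto
  have "\<not> (\<forall>x\<in>?X. Q x \<noteq> 0 \<longrightarrow> \<not> S x)"
  proof
    assume no: "\<forall>x\<in>?X. Q x \<noteq> 0 \<longrightarrow> \<not> S x"
    have "P (lookup f1) = 0"
    proof (rule decomposable_dense[OF assms _ _ f1(1)])
      show "P \<in> polyfun UNIV" using P by (rule polyfun_mono) simp
      show "P (lookup f) = 0" if f: "decomposable n d s f" for f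
      proof -
        have "f \<in> S_deg n d" using decomposable_annihilated[OF f] by (rule conjunct1)
        then show ?thesis using no dS PQ f by auto
      qed
    qed
    then show False using f1(2) by simp
  qed
  then have "\<forall>x\<in>?X. Q x \<noteq> 0 \<longrightarrow> S x" using Q(3) by blast
  then have "\<forall>f\<in>S_deg n d. P (lookup f) \<noteq> 0 \<longrightarrow> decomposable n d s f" using dS PQ by auto
  then show ?thesis using P f1(2) by blast
qed

section \<open>Scaling and Zariski open sets of projective space\<close>

lemma codim_one_form_scale: "codim_one_form n d g \<Longrightarrow> codim_one_form n d (const_poly c * g)"
  unfolding codim_one_form_iff by (auto simp: dderiv_const_mult intro: forms_const_mult)

lemma decomposable_scale: "decomposable n d s f \<Longrightarrow> decomposable n d s (const_poly c * f)"
  unfolding decomposable_def codim_one_decomposition_def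
  by (elim exE conjE, rule_tac x = "\<lambda>i. const_poly c * g i" in exI)
    (simp add: codim_one_form_scale sum_distrib_left)

lemma decomposable_scale_iff:
  assumes "c \<noteq> 0" shows "decomposable n d s (const_poly c * f) \<longleftrightarrow> decomposable n d s f"
proof -
  have "const_poly (inverse c) * (const_poly c * f) = f"
    using assms by (simp add: mult.assoc[symmetric] const_poly_mult[symmetric])
  then show ?thesis using decomposable_scale by metis
qed

lemma eval_form_const_mult:
  assumes "G \<in> forms V e"
  shows "eval_poly G (lookup (const_poly c * f)) = c ^ e * eval_poly G (lookup f)"
proof -
  have "lookup (const_poly c * f) = (\<lambda>m. c * lookup f m)" by (simp add: fun_eq_iff lookup_const_poly_mult)
  then show ?thesis using eval_poly_forms_scale[OF assms] by simp
qed

lemma proj_point_eqD: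
  assumes "proj_point f = proj_point g" shows "\<exists>c. g = const_poly c * f"
proof -
  have "g \<in> proj_point g" unfolding proj_point_def by (intro CollectI exI[of _ 1]) simp
  then have "g \<in> proj_point f" using assms by simp
  then show ?thesis unfolding proj_point_def by blast
qed

text \<open>By homogeneity the vanishing of \<open>G\<close> does not depend on the representative
  of a point, so the complement is exactly the image of the zero set of \<open>G\<close>.\<close>

lemma zariski_open_nonvanishing:
  assumes G: "G \<in> forms (expos {0..n} d) e"
  shows "zariski_open n d (proj_point ` {f \<in> S_deg n d - {0}. eval_poly G (lookup f) \<noteq> 0})"
proof -
  let ?U = "proj_point ` {f \<in> S_deg n d - {0}. eval_poly G (lookup f) \<noteq> 0}"
  have "proj_forms n d - ?U = proj_point ` {f \<in> S_deg n d - {0}. \<forall>P\<in>{G}. eval_poly P (lookup f) = 0}"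
  proof -
    have "eval_poly G (lookup f) = 0 \<longrightarrow> eval_poly G (lookup g) = 0"
      if "proj_point f = proj_point g" for f g
      using proj_point_eqD[OF that] eval_form_const_mult[OF G] by auto
    then show ?thesis unfolding proj_forms_def by auto
  qed
  then have "zariski_closed n d (proj_forms n d - ?U)"
    unfolding zariski_closed_def using G by (intro exI[of _ "{G}"]) auto
  then show ?thesis unfolding zariski_open_def proj_forms_def by auto
qed

text \<open>Along the multiples of \<open>x\<close>, the function \<open>R\<close> is a polynomial
  in \<open>t\<close> with coefficients \<open>h e\<close> at \<open>x\<close>, one of which is
  nonzero.\<close>

lemma polyfun_scaled_nonzero:
  assumes R: "\<And>x. R x = (\<Sum>e<N. eval_poly (h e) x)" and h: "\<And>e. h e \<in> forms V e"
    and "e0 < N" "eval_poly (h e0) x \<noteq> 0"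
  shows "\<exists>t. t \<noteq> 0 \<and> R (\<lambda>v. t * x v) \<noteq> 0"
proof -
  define p where "p = (\<Sum>e<N. monom (eval_poly (h e) x) e)"
  have "coeff p e0 = eval_poly (h e0) x" using assms(3) by (simp add: p_def coeff_sum)
  then have "p \<noteq> 0" using assms(4) by auto
  \<comment> \<open>The factor \<open>t\<close> excludes the value \<open>t = 0\<close>.\<close>
  then have "p * [:0, 1:] \<noteq> 0" by simp
  then obtain t where t: "poly (p * [:0, 1:]) t \<noteq> 0" using poly_all_0_iff_0 by blast
  have "R (\<lambda>v. t * x v) = (\<Sum>e<N. t ^ e * eval_poly (h e) x)"
    unfolding R by (intro sum.cong refl eval_poly_forms_scale[of _ V] h)
  also have "\<dots> = poly p t" by (simp add: p_def poly_sum poly_monom mult.commute)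
  finally show ?thesis using t by (intro exI[of _ t]) auto
qed

lemma card_expos_choose: "s \<le> d \<Longrightarrow> card (expos {0..n} (d - s)) = (d + n - s) choose n"
  using binomial_symmetric[of n "d + n - s"] by (simp add: card_expos add.commute)

text \<open>The value \<open>s = d\<close> is admissible since dim S_0 = 1 \<le> n d. So all
  relevant \<open>s\<close> are at most \<open>d\<close>, where the binomial coefficient is dim
  S_(d-s).\<close>

lemma s_zero_properties:
  assumes "n \<ge> 1" "d \<ge> 1"
  shows "1 \<le> s_zero n d" "s_zero n d \<le> d"
    "card (expos {0..n} (d - s_zero n d)) \<le> n * s_zero n d"
    "\<And>s. s < s_zero n d \<Longrightarrow> n * s < card (expos {0..n} (d - s))"
proof -
  let ?P = "\<lambda>s. s \<ge> 1 \<and> int n * int s - int ((d + n - s) choose n) \<ge> 0"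
  have P: "?P s \<longleftrightarrow> s \<ge> 1 \<and> card (expos {0..n} (d - s)) \<le> n * s" if "s \<le> d" for s
    using that unfolding card_expos_choose[OF that] by (simp flip: of_nat_mult)
  have Pd: "?P d" using assms unfolding P[OF order_refl] by (simp add: expos_0)
  have s: "?P (s_zero n d)" "s_zero n d \<le> d"
    unfolding s_zero_def by (rule LeastI[of ?P], rule Pd) (rule Least_le[of ?P], rule Pd)
  show "1 \<le> s_zero n d" "s_zero n d \<le> d" "card (expos {0..n} (d - s_zero n d)) \<le> n * s_zero n d"
    using s P[OF s(2)] by auto
  fix t assume t: "t < s_zero n d"
  then have "\<not> ?P t" unfolding s_zero_def by (rule not_less_Least)
  moreover have "t \<le> d" using t s(2) by simp
  \<comment> \<open>The value \<open>0\<close> lies outside the range of the minimum; for it the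
    claim is that S_d is nonzero.\<close>
  ultimately have "t = 0 \<or> n * t < card (expos {0..n} (d - t))" using P[of t] by auto
  then show "n * t < card (expos {0..n} (d - t))" by (auto simp: card_expos)
qed

theorem theorem2p13:
  fixes n d :: nat
  assumes "n \<ge> 1" and "d \<ge> 1"
  shows "\<exists>U. U \<noteq> {} \<and> zariski_open n d U \<and>
    (\<forall>f\<in>S_deg n d. proj_point f \<in> U \<longrightarrow>
      (\<exists>g. codim_one_decomposition n d f (s_zero n d) g) \<and>
      (\<forall>s < s_zero n d. \<not> (\<exists>g. codim_one_decomposition n d f s g)))"
proof -
  let ?s = "s_zero n d" and ?Y = "expos {0..n} d"
  note s0 = s_zero_properties[OF assms]
  from generic_decomposable[OF s0(2,1,3)] obtain P where P0: "P \<in> polyfun ?Y"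
    "(\<exists>y. P y \<noteq> 0) \<and> (\<forall>f\<in>S_deg n d. P (lookup f) \<noteq> 0 \<longrightarrow> decomposable n d ?s f)"
    by (elim bexE)
  note P = P0(1) conjunct1[OF P0(2)] conjunct2[OF P0(2)]
  define bad where "bad s Q \<longleftrightarrow> Q \<in> polyfun ?Y \<and> (\<exists>y. Q y \<noteq> 0) \<and>
    (\<forall>f. decomposable n d s f \<longrightarrow> Q (lookup f) = 0)" for s Q
  have "\<forall>s\<in>{..<?s}. \<exists>Q. bad s Q"
  proof
    fix s assume "s \<in> {..<?s}"
    then have s: "s \<le> d" "s < ?s" using s0(2) by auto
    from few_summands_special[OF s(1) s0(4)[OF s(2)]] show "\<exists>Q. bad s Q"
      unfolding bad_def Bex_def by simp
  qed
  from bchoice[OF this] obtain Q where Q: "\<And>s. s < ?s \<Longrightarrow> bad s (Q s)" by auto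
  \<comment> \<open>Nonvanishing of \<open>R\<close> certifies both halves: \<open>P\<close> gives a
    decomposition into \<open>?s\<close> summands, and each \<open>Q s\<close> excludes one into
    \<open>s\<close> summands.\<close>
  define R where "R y = P y * (\<Prod>s<?s. Q s y)" for y
  have Qp: "(\<lambda>y. \<Prod>s<?s. Q s y) \<in> polyfun ?Y"
    using Q by (intro polyfun_prod) (simp add: bad_def)
  have "R \<in> polyfun ?Y" unfolding R_def using P(1) Qp by (rule polyfun.mult)
  from polyfun_homogeneous_components[OF this] obtain h N where
    hN: "(\<forall>e. h e \<in> forms ?Y e) \<and> (\<forall>x. R x = (\<Sum>e<N. eval_poly (h e) x))" by (elim exE)
  note h = hN[THEN conjunct1, rule_format] hN[THEN conjunct2, rule_format]
  obtain y1 where y1: "P y1 \<noteq> 0" using P(2) by blast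
  have "\<exists>y. (\<Prod>s<?s. Q s y) \<noteq> 0"
    using Q by (intro polyfun_prod_nonzero[where V = ?Y]) (auto simp: bad_def)
  then obtain y2 where y2: "(\<Prod>s<?s. Q s y2) \<noteq> 0" by blast
  have "\<exists>y\<in>UNIV. P y \<noteq> 0 \<and> (\<Prod>s<?s. Q s y) \<noteq> 0"
    by (rule polyfun_common_nonzero[of UNIV P y1 "\<lambda>y. \<Prod>s<?s. Q s y" y2])
      (simp_all add: affine_UNIV y1 y2[simplified] polyfun_mono[OF P(1)] polyfun_mono[OF Qp])
  then obtain y where "R y \<noteq> 0" by (auto simp: R_def)
  then have "R (lookup (form_of n d y)) \<noteq> 0"
    using polyfun_cong[OF \<open>R \<in> polyfun ?Y\<close>, of "lookup (form_of n d y)" y] by (simp add: lookup_form_of)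
  then obtain e where e: "e < N" "eval_poly (h e) (lookup (form_of n d y)) \<noteq> 0"
    unfolding h(2) by (metis lessThan_iff sum.neutral)
  define G where "G = h e"
  have G: "G \<in> forms ?Y e" unfolding G_def by (rule h(1))
  let ?U = "proj_point ` {f \<in> S_deg n d - {0}. eval_poly G (lookup f) \<noteq> 0}"
  \<comment> \<open>\<open>R\<close> need not be homogeneous, so a nonzero component at
    \<open>f\<close> only gives a nonzero value of \<open>R\<close> at some multiple of
    \<open>f\<close>; decomposability is unaffected by this scaling.\<close>
  have good: "decomposable n d ?s f \<and> (\<forall>s<?s. \<not> decomposable n d s f)"
    if f: "f \<in> S_deg n d" "eval_poly G (lookup f) \<noteq> 0" for f
  proof -
    obtain t where t: "t \<noteq> 0" "R (\<lambda>m. t * lookup f m) \<noteq> 0"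
      using polyfun_scaled_nonzero[OF h(2,1) e(1), of "lookup f"] f(2) by (auto simp: G_def)
    let ?f = "const_poly t * f"
    have "(\<lambda>m. t * lookup f m) = lookup ?f" by (simp add: fun_eq_iff lookup_const_poly_mult)
    then have R: "P (lookup ?f) \<noteq> 0" "(\<Prod>s<?s. Q s (lookup ?f)) \<noteq> 0" using t(2) by (auto simp: R_def)
    have "decomposable n d ?s ?f" using P(3) R(1) f(1) by (auto intro: forms_const_mult)
    moreover have "\<not> decomposable n d s ?f" if "s < ?s" for s
      using R(2) Q[OF that] that by (auto simp: bad_def)
    ultimately show ?thesis using t(1) by (simp add: decomposable_scale_iff)
  qed
  have "?U \<noteq> {}"
  proof (cases "form_of n d y = 0")
    case False
    then show ?thesis using e(2) form_of_forms[of n d y] by (auto simp: G_def)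
  next
    \<comment> \<open>A nonzero value of the homogeneous \<open>G\<close> at the zero form forces
      \<open>e = 0\<close>. Then \<open>G\<close> is a nonzero constant, and any nonzero form gives
      a point of the open set.\<close>
    case True
    have z: "eval_poly G (lookup (const_poly 0 * f)) \<noteq> 0" for f
      using e(2) True by (simp add: G_def)
    have "eval_poly G (lookup f) \<noteq> 0" for f
      using z[of f] unfolding eval_form_const_mult[OF G] by (cases e) auto
    moreover have "card ?Y \<noteq> 0" by (simp add: card_expos)
    then obtain m where "m \<in> ?Y" by fastforce
    then have "form_of n d (\<lambda>_. 1) \<noteq> 0" by (metis lookup_form_of lookup_zero zero_neq_one)
    ultimately show ?thesis using form_of_forms[of n d "\<lambda>_. 1"] by auto
  qed
  moreover have "zariski_open n d ?U" by (rule zariski_open_nonvanishing[OF G])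
  moreover have "\<forall>f\<in>S_deg n d. proj_point f \<in> ?U \<longrightarrow>
      decomposable n d ?s f \<and> (\<forall>s<?s. \<not> decomposable n d s f)"
  proof (intro ballI impI)
    fix f assume f: "f \<in> S_deg n d" "proj_point f \<in> ?U"
    from f(2) obtain g where "eval_poly G (lookup g) \<noteq> 0" "proj_point f = proj_point g" by auto
    then have "eval_poly G (lookup f) \<noteq> 0"
      using proj_point_eqD[of f g] eval_form_const_mult[OF G] by auto
    with f(1) show "decomposable n d ?s f \<and> (\<forall>s<?s. \<not> decomposable n d s f)" by (rule good)
  qed
  ultimately show ?thesis unfolding decomposable_def by (intro exI[of _ ?U] conjI)
qed

end
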